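(* Let $X$ be a compact Calabi-Yau page-$1$-$\partial\bar\partial$-manifold with $\dim_{\mathbb{C}}X=n$. Fix a non-vanishing holomorphic $(n,0)$-form $u$ on $X$ and suppose that $$\psi\lrcorner(\rho\lrcorner u)\in\mathcal{Z}_2^{n-2,2}(X)$$ for all $\psi,\rho\in C^\infty_{0,1}(X,T^{1,0}X)$ such that $\psi\lrcorner u,\ \rho\lrcorner u\in\ker d\cup\operatorname{Im}\partial$. (i) Then the essential Kuranishi family of $X$ is unobstructed. (ii) If, moreover, $\mathcal{Z}_1^{n-1,1}(X)=\mathcal{Z}_2^{n-1,1}(X)$, then the Kuranishi family of $X$ is unobstructed.
   Context: Forms and contraction. $C^\infty_{p,q}(X)$ denotes the smooth $\mathbb{C}$-valued $(p,q)$-forms on $X$, and $C^\infty_{0,1}(X,T^{1,0}X)$ the smooth $(0,1)$-forms with values in the holomorphic tangent bundle $T^{1,0}X$. In local holomorphic coordinates $z_a$, for $\theta=\sum_a\theta^a\otimes\partial/\partial z_a$ with $\theta^a$ $(0,1)$-forms, $\theta\lrcorner v:=\sum_a\theta^a\wedge(\tfrac{\partial}{\partial z_a}\lrcorner v)$ for a form $v$ (so bidegree $(p,q)$ goes to $(p-1,q+1)$). The bracket of $\theta,\theta'\in C^\infty_{0,1}(X,T^{1,0}X)$ is $[\theta,\theta']=\sum_{a,b}\big(\theta^a\wedge\partial_a\theta'^b+\theta'^a\wedge\partial_a\theta^b\big)\otimes\partial/\partial z_b\in C^\infty_{0,2}(X,T^{1,0}X)$, where $\partial_a$ acts on the coefficients.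 Calabi-Yau. In this setting, $X$ is Calabi-Yau if its canonical bundle $K_X$ is trivial; then a non-vanishing holomorphic $(n,0)$-form $u$ exists, is unique up to scalar, and $\theta\mapsto\theta\lrcorner u$ is an isomorphism $C^\infty_{0,1}(X,T^{1,0}X)\to C^\infty_{n-1,1}(X)$ inducing an isomorphism $H^{0,1}(X,T^{1,0}X)\to H^{n-1,1}_{\bar\partial}(X)$. $E_r$-closed and exact forms ($r=1,2$). $E_r^{p,q}(X)$ denotes the spaces on the $r$-th page of the Frölicher spectral sequence of $X$ (with $E_1^{p,q}=H^{p,q}_{\bar\partial}$). $\mathcal{Z}_1^{p,q}(X)$ is the space of $\bar\partial$-closed smooth $(p,q)$-forms; $\mathcal{Z}_2^{p,q}(X)$ is the space of smooth $(p,q)$-forms $\alpha$ with $\bar\partial\alpha=0$ and $\partial\alpha\in\operatorname{Im}\bar\partial$. $\mathcal{C}_2^{p,q}(X)$ is the space of $(p,q)$-forms $\partial\zeta+\bar\partial\xi$ with $\zeta\in C^\infty_{p-1,q}(X)$, $\bar\partial\zeta=0$, and $\xi\in C^\infty_{p,q-1}(X)$ arbitrary. One has $E_2^{p,q}(X)=\mathcal{Z}_2^{p,q}(X)/\mathcal{C}_2^{p,q}(X)$; the class of $\alpha\in\mathcal{Z}_2^{p,q}(X)$ is denoted $\{\alpha\}_{E_2}$. Page-$1$-$\partial\bar\partial$-manifold. A compact complex manifold $X$ such that for every bidegree $(p,q)$ every class in $E_2^{p,q}(X)$ can be represented by a $d$-closed $(p,q)$-form and for every $k$ the linear map $\bigoplus_{p+q=k}E_2^{p,q}(X)\to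 H^k_{DR}(X,\mathbb{C})$, $\sum\{\alpha^{p,q}\}_{E_2}\mapsto\{\sum\alpha^{p,q}\}_{DR}$, is well-defined by means of $d$-closed pure-type representatives $\alpha^{p,q}$ and bijective. Integrability equations. Given $\psi_1$ with $\bar\partial\psi_1=0$, the integrability condition $\bar\partial\psi=\tfrac12[\psi,\psi]$ for a power series $\psi=\psi_1+\sum_{\nu\ge2}\psi_\nu$ (with $\psi_\nu$ homogeneous of degree $\nu$ in the parameters) is equivalent to the sequence of equations $\bar\partial\psi_\nu=\tfrac12\sum_{\mu=1}^{\nu-1}[\psi_\mu,\psi_{\nu-\mu}]$, $\nu\ge2$, with $\psi_\nu\in C^\infty_{0,1}(X,T^{1,0}X)$. "Solvable starting from $\psi_1$" means that there exist $\psi_\nu$, $\nu\geq 2$, satisfying all of them. Unobstructedness. Let $m=\dim_{\mathbb{C}}H^{0,1}(X,T^{1,0}X)$. The Kuranishi family of $X$ is unobstructed if there are representatives $\beta_1,\dots,\beta_m$ of classes forming a basis of $H^{0,1}(X,T^{1,0}X)$ such that for every $(t_1,\dots,t_m)\in\mathbb{C}^m$ all the equations $\bar\partial\psi_\nu=\tfrac12\sum_{\mu=1}^{\nu-1}[\psi_\mu,\psi_{\nu-\mu}]$, $\nu\ge2$, are solvable starting from $\psi_1(t)=t_1\beta_1+\dots+t_m\beta_m$. The essential Kuranishi family of the Calabi-Yau page-$1$-$\partial\bar\partial$-manifold $X$ is unobstructed if every class in $E_2^{n-1,1}(X)$ admits a representative of the form $\psi_1\lrcorner u$, with $\psi_1\in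 C^\infty_{0,1}(X,T^{1,0}X)$, such that all the equations $\bar\partial\psi_\nu=\tfrac12\sum_{\mu=1}^{\nu-1}[\psi_\mu,\psi_{\nu-\mu}]$, $\nu\ge2$, are solvable starting from $\psi_1$. *)

theory Defs
  imports "HOL-Analysis.Analysis" "HOL-Library.Function_Algebras"
begin

section \<open>Smooth and holomorphic maps\<close>

primrec Ck_on :: "nat \<Rightarrow> 'a::real_normed_vector set \<Rightarrow> ('a \<Rightarrow> 'b::real_normed_vector) \<Rightarrow> bool" where
  "Ck_on 0 S f \<longleftrightarrow> continuous_on S f"
| "Ck_on (Suc k) S f \<longleftrightarrow>
     (\<forall>x\<in>S. f differentiable (at x)) \<and> (\<forall>v. Ck_on k S (\<lambda>x. frechet_derivative f (at x) v))"

text \<open>Only used for open \<open>S\<close>.\<close>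

definition smooth_on :: "'a::real_normed_vector set \<Rightarrow> ('a \<Rightarrow> 'b::real_normed_vector) \<Rightarrow> bool" where
  "smooth_on S f \<longleftrightarrow> (\<forall>k. Ck_on k S f)"

text \<open>A map between open subsets of complex vector spaces is holomorphic if it is smooth and
  satisfies the Cauchy-Riemann equations, that is, its differential is complex linear.\<close>

definition holomorphic_map_on :: "(complex^'n) set \<Rightarrow> (complex^'n \<Rightarrow> complex^'m) \<Rightarrow> bool" where
  "holomorphic_map_on S f \<longleftrightarrow> smooth_on S f \<and>
     (\<forall>z\<in>S. \<forall>k v. frechet_derivative f (at z) (k *s v) = k *s frechet_derivative f (at z) v)"

text \<open>The Wirtinger derivatives with respect to \<open>z\<^sub>a\<close> and its conjugate.\<close>

definition dz_deriv :: "'n::finite \<Rightarrow> (complex^'n \<Rightarrow> complex) \<Rightarrow> complex^'n \<Rightarrow> complex" where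
  "dz_deriv a f z =
     (frechet_derivative f (at z) (axis a 1) - \<i> * frechet_derivative f (at z) (axis a \<i>)) / 2"

definition dzbar_deriv :: "'n::finite \<Rightarrow> (complex^'n \<Rightarrow> complex) \<Rightarrow> complex^'n \<Rightarrow> complex" where
  "dzbar_deriv a f z =
     (frechet_derivative f (at z) (axis a 1) + \<i> * frechet_derivative f (at z) (axis a \<i>)) / 2"


section \<open>Complex manifolds\<close>

text \<open>A chart is a coordinate domain together with its coordinate map; the values of the
  coordinate map outside the domain are irrelevant.\<close>

type_synonym ('a, 'n) chart = "'a set \<times> ('a \<Rightarrow> complex^'n)"

abbreviation cdom :: "('a, 'n) chart \<Rightarrow> 'a set" where "cdom \<equiv> fst"

abbreviation cmap :: "('a, 'n) chart \<Rightarrow> 'a \<Rightarrow> complex^'n" where "cmap \<equiv> snd"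

definition cimg :: "('a, 'n) chart \<Rightarrow> (complex^'n) set" where
  "cimg c = cmap c ` cdom c"

definition overlap :: "('a, 'n) chart \<Rightarrow> ('a, 'n) chart \<Rightarrow> (complex^'n) set" where
  "overlap c c' = cmap c ` (cdom c \<inter> cdom c')"

definition transition :: "('a, 'n) chart \<Rightarrow> ('a, 'n) chart \<Rightarrow> complex^'n \<Rightarrow> complex^'n" where
  "transition c c' = cmap c' \<circ> inv_into (cdom c) (cmap c)"

text \<open>The complex dimension is \<open>CARD('n)\<close>. Second countability follows from compactness.\<close>

locale compact_complex_manifold =
  fixes X :: "'a topology" and A :: "('a, 'n::finite) chart set"
  assumes Hausdorff: "Hausdorff_space X"
    and compact: "compact_space X"
    and cover: "(\<Union>c\<in>A. cdom c) = topspace X"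
    and openin_cdom: "c \<in> A \<Longrightarrow> openin X (cdom c)"
    and open_cimg: "c \<in> A \<Longrightarrow> open (cimg c)"
    and homeomorphic:
      "c \<in> A \<Longrightarrow> homeomorphic_map (subtopology X (cdom c)) (top_of_set (cimg c)) (cmap c)"
    and holomorphic_transition:
      "c \<in> A \<Longrightarrow> c' \<in> A \<Longrightarrow> holomorphic_map_on (overlap c c') (transition c c')"


section \<open>Exterior algebra at a point\<close>

text \<open>A complex-valued \<open>k\<close>-covector is a function of lists of tangent vectors that vanishes on lists
  whose length is not \<open>k\<close>. The exterior product of a 1-covector \<open>l\<close> with a covector \<open>\<eta>\<close> is
  given by the Laplace expansion, normalised such that the product of \<open>k\<close> 1-covectors is the
  determinant of their values.\<close>

definition cov_wedge :: "('v \<Rightarrow> complex) \<Rightarrow> ('v list \<Rightarrow> complex) \<Rightarrow> 'v list \<Rightarrow> complex" where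
  "cov_wedge l \<eta> vs =
     (\<Sum>j<length vs. (- 1) ^ j * l (vs ! j) * \<eta> (take j vs @ drop (Suc j) vs))"

definition dz :: "'n::finite \<Rightarrow> complex^'n \<Rightarrow> complex" where
  "dz a v = v $ a"

definition dzbar :: "'n::finite \<Rightarrow> complex^'n \<Rightarrow> complex" where
  "dzbar a v = cnj (v $ a)"

text \<open>\<open>pq_monomial as bs\<close> is the exterior product of the \<open>dz a\<close> for \<open>a\<close> in \<open>as\<close> followed by the
  \<open>dzbar b\<close> for \<open>b\<close> in \<open>bs\<close>.\<close>

definition pq_monomial :: "'n::finite list \<Rightarrow> 'n list \<Rightarrow> (complex^'n) list \<Rightarrow> complex" where
  "pq_monomial as bs =
     foldr cov_wedge (map dz as @ map dzbar bs) (\<lambda>vs. if vs = [] then 1 else 0)"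

text \<open>Bidegrees are integers; if one of them is negative, only the zero covector remains.\<close>

definition pq_covectors :: "int \<Rightarrow> int \<Rightarrow> ((complex^'n::finite) list \<Rightarrow> complex) set" where
  "pq_covectors p q =
     {\<eta>. \<exists>f. \<eta> = (\<lambda>vs. \<Sum>as\<in>{as. int (length as) = p}. \<Sum>bs\<in>{bs. int (length bs) = q}.
                          f as bs * pq_monomial as bs vs)}"

text \<open>The interior product with the complex tangent vector \<open>\<partial>/\<partial>z\<^sub>a = (\<partial>/\<partial>x\<^sub>a - \<i> \<partial>/\<partial>y\<^sub>a) / 2\<close>.\<close>

definition interior_dz :: "'n::finite \<Rightarrow> ((complex^'n) list \<Rightarrow> complex) \<Rightarrow> (complex^'n) list \<Rightarrow> complex"
  where "interior_dz a \<eta> vs = (\<eta> (axis a 1 # vs) - \<i> * \<eta> (axis a \<i> # vs)) / 2"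


section \<open>Differential forms\<close>

text \<open>A form is given by its local expression in each chart, a function of the coordinates
  \<open>z\<close> and of a list of tangent vectors; local expressions correspond under pullback along the
  transition maps. Local expressions are zero where they have no meaning, so that equality of
  forms is equality of functions; sums and differences of forms are pointwise.\<close>

type_synonym ('a, 'n) form =
  "('a, 'n) chart \<Rightarrow> complex^'n \<Rightarrow> (complex^'n) list \<Rightarrow> complex"

definition forms :: "('a, 'n::finite) chart set \<Rightarrow> int \<Rightarrow> int \<Rightarrow> ('a, 'n) form set" where
  "forms A p q = {\<omega>.
     (\<forall>c z vs. c \<notin> A \<or> z \<notin> cimg c \<longrightarrow> \<omega> c z vs = 0) \<and>
     (\<forall>c\<in>A. \<forall>z\<in>cimg c. \<omega> c z \<in> pq_covectors p q) \<and>
     (\<forall>c\<in>A. \<forall>vs. smooth_on (cimg c) (\<lambda>z. \<omega> c z vs)) \<and>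
     (\<forall>c\<in>A. \<forall>c'\<in>A. \<forall>z\<in>overlap c c'. \<forall>vs.
        \<omega> c z vs =
        \<omega> c' (transition c c' z) (map (frechet_derivative (transition c c') (at z)) vs))}"

definition del_form :: "('a, 'n::finite) form \<Rightarrow> ('a, 'n) form" where
  "del_form \<omega> = (\<lambda>c z vs. if z \<in> cimg c
     then \<Sum>a\<in>UNIV. cov_wedge (dz a) (\<lambda>ws. dz_deriv a (\<lambda>w. \<omega> c w ws) z) vs else 0)"

definition delbar_form :: "('a, 'n::finite) form \<Rightarrow> ('a, 'n) form" where
  "delbar_form \<omega> = (\<lambda>c z vs. if z \<in> cimg c
     then \<Sum>a\<in>UNIV. cov_wedge (dzbar a) (\<lambda>ws. dzbar_deriv a (\<lambda>w. \<omega> c w ws) z) vs else 0)"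

definition d_form :: "('a, 'n::finite) form \<Rightarrow> ('a, 'n) form" where
  "d_form \<omega> = del_form \<omega> + delbar_form \<omega>"

text \<open>Smooth complex-valued \<open>k\<close>-forms: sums of forms of the bidegrees of total degree \<open>k\<close>.\<close>

definition kforms :: "('a, 'n::finite) chart set \<Rightarrow> int \<Rightarrow> ('a, 'n) form set" where
  "kforms A k = {(\<Sum>p\<in>{0..k}. \<alpha> p) |\<alpha>. \<forall>p\<in>{0..k}. \<alpha> p \<in> forms A p (k - p)}"


section \<open>Forms with values in the holomorphic tangent bundle\<close>

text \<open>The component \<open>\<theta> c z vs $ a\<close> is the value of \<open>\<theta>\<^sup>a\<close> in \<open>\<theta> = \<Sum>\<^sub>a \<theta>\<^sup>a \<otimes> \<partial>/\<partial>z\<^sub>a\<close>. Since the differential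
  of a transition map is complex linear, it acts on these components as the holomorphic Jacobian.\<close>

type_synonym ('a, 'n) vform =
  "('a, 'n) chart \<Rightarrow> complex^'n \<Rightarrow> (complex^'n) list \<Rightarrow> complex^'n"

definition vforms :: "('a, 'n::finite) chart set \<Rightarrow> int \<Rightarrow> ('a, 'n) vform set" where
  "vforms A q = {\<theta>.
     (\<forall>c z vs. c \<notin> A \<or> z \<notin> cimg c \<longrightarrow> \<theta> c z vs = 0) \<and>
     (\<forall>c\<in>A. \<forall>z\<in>cimg c. \<forall>a. (\<lambda>vs. \<theta> c z vs $ a) \<in> pq_covectors 0 q) \<and>
     (\<forall>c\<in>A. \<forall>vs. smooth_on (cimg c) (\<lambda>z. \<theta> c z vs)) \<and>
     (\<forall>c\<in>A. \<forall>c'\<in>A. \<forall>z\<in>overlap c c'. \<forall>vs.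
        frechet_derivative (transition c c') (at z) (\<theta> c z vs) =
        \<theta> c' (transition c c' z) (map (frechet_derivative (transition c c') (at z)) vs))}"

definition vscale :: "complex \<Rightarrow> ('a, 'n::finite) vform \<Rightarrow> ('a, 'n) vform" where
  "vscale t \<theta> = (\<lambda>c z vs. t *s \<theta> c z vs)"

definition delbar_vform :: "('a, 'n::finite) vform \<Rightarrow> ('a, 'n) vform" where
  "delbar_vform \<theta> = (\<lambda>c z vs. \<chi> b. delbar_form (\<lambda>c z vs. \<theta> c z vs $ b) c z vs)"

text \<open>Contraction and bracket of forms in \<open>vforms A 1\<close>.\<close>

definition contract :: "('a, 'n::finite) vform \<Rightarrow> ('a, 'n) form \<Rightarrow> ('a, 'n) form" where
  "contract \<theta> \<omega> =
     (\<lambda>c z vs. \<Sum>a\<in>UNIV. cov_wedge (\<lambda>v. \<theta> c z [v] $ a) (interior_dz a (\<omega> c z)) vs)"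

definition bracket :: "('a, 'n::finite) vform \<Rightarrow> ('a, 'n) vform \<Rightarrow> ('a, 'n) vform" where
  "bracket \<theta> \<theta>' = (\<lambda>c z vs. \<chi> b. \<Sum>a\<in>UNIV.
       cov_wedge (\<lambda>v. \<theta> c z [v] $ a) (\<lambda>ws. dz_deriv a (\<lambda>w. \<theta>' c w ws $ b) z) vs
     + cov_wedge (\<lambda>v. \<theta>' c z [v] $ a) (\<lambda>ws. dz_deriv a (\<lambda>w. \<theta> c w ws $ b) z) vs)"


section \<open>Calabi-Yau manifolds\<close>

definition nonvanishing_holomorphic_top_form ::
    "('a, 'n::finite) chart set \<Rightarrow> ('a, 'n) form \<Rightarrow> bool" where
  "nonvanishing_holomorphic_top_form A u \<longleftrightarrow>
     u \<in> forms A (int CARD('n)) 0 \<and> delbar_form u = 0 \<and>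
     (\<forall>c\<in>A. \<forall>z\<in>cimg c. u c z \<noteq> 0)"

text \<open>A trivialisation of the canonical bundle is a global holomorphic frame of it.\<close>

definition calabi_yau :: "('a, 'n::finite) chart set \<Rightarrow> bool" where
  "calabi_yau A \<longleftrightarrow> (\<exists>u. nonvanishing_holomorphic_top_form A u)"


section \<open>Froelicher spectral sequence and de Rham cohomology\<close>

definition Z1 :: "('a, 'n::finite) chart set \<Rightarrow> int \<Rightarrow> int \<Rightarrow> ('a, 'n) form set" where
  "Z1 A p q = {\<alpha> \<in> forms A p q. delbar_form \<alpha> = 0}"

definition Z2 :: "('a, 'n::finite) chart set \<Rightarrow> int \<Rightarrow> int \<Rightarrow> ('a, 'n) form set" where
  "Z2 A p q =
     {\<alpha> \<in> forms A p q. delbar_form \<alpha> = 0 \<and> del_form \<alpha> \<in> delbar_form ` forms A (p + 1) (q - 1)}"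

definition C2 :: "('a, 'n::finite) chart set \<Rightarrow> int \<Rightarrow> int \<Rightarrow> ('a, 'n) form set" where
  "C2 A p q = {del_form \<zeta> + delbar_form \<xi> |\<zeta> \<xi>.
     \<zeta> \<in> forms A (p - 1) q \<and> delbar_form \<zeta> = 0 \<and> \<xi> \<in> forms A p (q - 1)}"

definition E2_class ::
    "('a, 'n::finite) chart set \<Rightarrow> int \<Rightarrow> int \<Rightarrow> ('a, 'n) form \<Rightarrow> ('a, 'n) form set" where
  "E2_class A p q \<alpha> = {\<beta> \<in> Z2 A p q. \<beta> - \<alpha> \<in> C2 A p q}"

definition E2 :: "('a, 'n::finite) chart set \<Rightarrow> int \<Rightarrow> int \<Rightarrow> ('a, 'n) form set set" where
  "E2 A p q = E2_class A p q ` Z2 A p q"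

definition DR_closed :: "('a, 'n::finite) chart set \<Rightarrow> int \<Rightarrow> ('a, 'n) form set" where
  "DR_closed A k = {\<alpha> \<in> kforms A k. d_form \<alpha> = 0}"

definition DR_class ::
    "('a, 'n::finite) chart set \<Rightarrow> int \<Rightarrow> ('a, 'n) form \<Rightarrow> ('a, 'n) form set" where
  "DR_class A k \<alpha> = {\<beta> \<in> DR_closed A k. \<beta> - \<alpha> \<in> d_form ` kforms A (k - 1)}"

definition DR_cohomology :: "('a, 'n::finite) chart set \<Rightarrow> int \<Rightarrow> ('a, 'n) form set set" where
  "DR_cohomology A k = DR_class A k ` DR_closed A k"

text \<open>An element of the direct sum of the \<open>E2 A p (k - p)\<close> is a family of classes indexed by
  \<open>p \<in> {0..k}\<close>. Since every class has a \<open>d\<close>-closed representative, the map \<open>F\<close> below is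
  unique on the direct sum, and its existence says that the class of \<open>\<Sum>\<alpha>\<close> does not depend on the
  choice of the \<open>d\<close>-closed representatives \<open>\<alpha> p\<close>.\<close>

definition page1_ddbar :: "('a, 'n::finite) chart set \<Rightarrow> bool" where
  "page1_ddbar A \<longleftrightarrow>
     (\<forall>p q. \<forall>K\<in>E2 A p q. \<exists>\<alpha>\<in>K. d_form \<alpha> = 0) \<and>
     (\<forall>k. \<exists>F.
        (\<forall>\<alpha>. (\<forall>p\<in>{0..k}. \<alpha> p \<in> forms A p (k - p) \<and> d_form (\<alpha> p) = 0) \<longrightarrow>
           F (\<lambda>p\<in>{0..k}. E2_class A p (k - p) (\<alpha> p)) = DR_class A k (\<Sum>p\<in>{0..k}. \<alpha> p)) \<and>
        bij_betw F (\<Pi>\<^sub>E p\<in>{0..k}. E2 A p (k - p)) (DR_cohomology A k))"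


section \<open>Unobstructedness\<close>

definition integrability_solvable :: "('a, 'n::finite) chart set \<Rightarrow> ('a, 'n) vform \<Rightarrow> bool" where
  "integrability_solvable A \<psi>1 \<longleftrightarrow>
     \<psi>1 \<in> vforms A 1 \<and> delbar_vform \<psi>1 = 0 \<and>
     (\<exists>\<psi> :: nat \<Rightarrow> ('a, 'n) vform. \<psi> 1 = \<psi>1 \<and> (\<forall>\<nu>\<ge>2. \<psi> \<nu> \<in> vforms A 1) \<and>
        (\<forall>\<nu>\<ge>2. delbar_vform (\<psi> \<nu>) =
           vscale (1/2) (\<Sum>\<mu> = 1..\<nu> - 1. bracket (\<psi> \<mu>) (\<psi> (\<nu> - \<mu>)))))"

definition essential_kuranishi_unobstructed ::
    "('a, 'n::finite) chart set \<Rightarrow> ('a, 'n) form \<Rightarrow> bool" where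
  "essential_kuranishi_unobstructed A u \<longleftrightarrow>
     (\<forall>K\<in>E2 A (int CARD('n) - 1) 1. \<exists>\<psi>1\<in>vforms A 1.
        contract \<psi>1 u \<in> K \<and> integrability_solvable A \<psi>1)"

text \<open>\<open>B\<close> consists of representatives of pairwise distinct classes that form a basis of the
  Dolbeault cohomology space \<open>H\<^sup>0\<^sup>,\<^sup>1\<close> of the holomorphic tangent bundle.\<close>

definition H01T_basis_reps :: "('a, 'n::finite) chart set \<Rightarrow> ('a, 'n) vform set \<Rightarrow> bool" where
  "H01T_basis_reps A B \<longleftrightarrow>
     B \<subseteq> {\<theta> \<in> vforms A 1. delbar_vform \<theta> = 0} \<and>
     (\<forall>F t. finite F \<and> F \<subseteq> B \<and> (\<Sum>\<beta>\<in>F. vscale (t \<beta>) \<beta>) \<in> delbar_vform ` vforms A 0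
        \<longrightarrow> (\<forall>\<beta>\<in>F. t \<beta> = 0)) \<and>
     (\<forall>\<theta>\<in>vforms A 1. delbar_vform \<theta> = 0 \<longrightarrow>
        (\<exists>F t. finite F \<and> F \<subseteq> B \<and>
           \<theta> - (\<Sum>\<beta>\<in>F. vscale (t \<beta>) \<beta>) \<in> delbar_vform ` vforms A 0))"

text \<open>On a compact manifold \<open>H\<^sup>0\<^sup>,\<^sup>1\<close> has finite dimension \<open>m\<close>, so \<open>B\<close> has \<open>m\<close> elements
  \<open>\<beta>\<^sub>1, \<dots>, \<beta>\<^sub>m\<close> and the finite partial sums below are all the sums \<open>t\<^sub>1 \<beta>\<^sub>1 + \<dots> + t\<^sub>m \<beta>\<^sub>m\<close>. Quantifying
  over finite subsets makes the definition meaningful without that finiteness theorem.\<close>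

definition kuranishi_unobstructed :: "('a, 'n::finite) chart set \<Rightarrow> bool" where
  "kuranishi_unobstructed A \<longleftrightarrow>
     (\<exists>B. H01T_basis_reps A B \<and>
        (\<forall>F t. finite F \<and> F \<subseteq> B \<longrightarrow> integrability_solvable A (\<Sum>\<beta>\<in>F. vscale (t \<beta>) \<beta>)))"

end

theory Submission
  imports Defs
begin

text \<open>Contraction with the volume form \<open>u\<close> turns the deformation problem into one about forms. It
identifies \<open>(0, q)\<close>-forms with values in the tangent bundle with \<open>(n - 1, q)\<close>-forms, it commutes with
\<open>\<partial>-bar\<close> up to a sign that depends on \<open>n\<close> only (\<open>delbar_vform_of_form\<close>), and it expresses the bracket by
\<open>\<partial>\<close>: if \<open>contract \<psi> u\<close> and \<open>contract \<rho> u\<close> are \<open>\<partial>\<close>-closed, then \<open>\<partial>(contract \<psi> (contract \<rho> u))\<close> corresponds to \<open>- [\<psi>, \<rho>]\<close>. This is the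
Tian-Todorov identity (\<open>tian_todorov\<close>).

Suppose that \<open>\<psi>\<^sub>1, \<dots>, \<psi>\<^sub>\<nu>\<^sub>-\<^sub>1\<close> are constructed and that each \<open>contract \<psi>\<^sub>\<mu> u\<close> is \<open>d\<close>-closed or \<open>\<partial>\<close>-exact. By
hypothesis the forms \<open>\<gamma> = contract \<psi>\<^sub>\<mu> (contract \<psi>\<^sub>\<nu>\<^sub>-\<^sub>\<mu> u)\<close> lie in \<open>Z2\<close>. On a page-1 manifold the class of \<open>\<gamma>\<close> on the second
page has a \<open>d\<close>-closed representative, so \<open>\<gamma>\<close> differs from a \<open>d\<close>-closed form by some \<open>\<partial>\<zeta> + \<partial>-bar \<xi>\<close> with
\<open>\<partial>-bar \<zeta> = 0\<close>, and applying \<open>\<partial>\<close> leaves \<open>\<partial>\<gamma> = \<partial>-bar (\<partial>\<xi>)\<close> (\<open>Z2_del_ddbar_exact\<close>). Together with the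
Tian-Todorov identity this solves the equation of order \<open>\<nu>\<close>, and it does so with a \<open>\<psi>\<^sub>\<nu>\<close> for which
\<open>contract \<psi>\<^sub>\<nu> u\<close> is again \<open>\<partial>\<close>-exact (\<open>next_term\<close>). That keeps both the hypothesis and the Tian-Todorov identity
applicable, so the recursion never stops: every \<open>\<psi>\<^sub>1\<close> for which \<open>contract \<psi>\<^sub>1 u\<close> is \<open>d\<close>-closed is unobstructed
(\<open>integrability_solvableI\<close>).

The first assertion follows because every class on the second page has a \<open>d\<close>-closed representative. For
the second assertion, equality of \<open>Z1\<close> and \<open>Z2\<close> makes every \<open>\<partial>-bar\<close>-closed \<open>\<theta>\<close> cohomologous to one with
\<open>d\<close>-closed \<open>contract \<theta> u\<close> (\<open>closed_decomposition\<close>). Hence a basis of the cohomology can be represented by such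
elements, and the condition on \<open>contract \<theta> u\<close> is linear, so it holds for all linear combinations.

The larger part of the text develops the calculus behind this. All identities are first proved in a
chart, for families of covectors depending on a point. Passing to the manifold needs two facts: \<open>\<partial>\<close> of a
form is a form, because holomorphic coordinate changes commute with \<open>\<partial>\<close> (\<open>local_del_pullback\<close>), and
the components of the inverse of the contraction transform as a vector (\<open>pullback_vector_component\<close>).\<close>

section \<open>Wedge products of covectors\<close>

type_synonym 'n covector = "(complex^'n) list \<Rightarrow> complex"

lemma cov_wedge_Nil [simp]: "cov_wedge l \<eta> [] = 0"
  by (simp add: cov_wedge_def)

text \<open>The Laplace expansion along the first vector reduces identities between wedge products to inductions
over the list of vectors.\<close>

lemma cov_wedge_Cons:
  "cov_wedge l \<eta> (v # vs) = l v * \<eta> vs - cov_wedge l (\<lambda>ws. \<eta> (v # ws)) vs"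
  by (simp add: cov_wedge_def sum.lessThan_Suc_shift sum_negf[symmetric] mult.assoc
      del: sum.lessThan_Suc)

lemma cov_wedge_add: "cov_wedge l (\<lambda>ws. \<eta> ws + \<zeta> ws) = (\<lambda>vs. cov_wedge l \<eta> vs + cov_wedge l \<zeta> vs)"
  by (simp add: cov_wedge_def fun_eq_iff algebra_simps sum.distrib)

lemma cov_wedge_scale: "cov_wedge l (\<lambda>ws. c * \<eta> ws) = (\<lambda>vs. c * cov_wedge l \<eta> vs)"
  by (simp add: cov_wedge_def fun_eq_iff algebra_simps sum_distrib_left)

lemma cov_wedge_minus: "cov_wedge l (\<lambda>ws. - \<eta> ws) = (\<lambda>vs. - cov_wedge l \<eta> vs)"
  using cov_wedge_scale[of l "-1" \<eta>] by simp

lemma cov_wedge_diff: "cov_wedge l (\<lambda>ws. \<eta> ws - \<zeta> ws) = (\<lambda>vs. cov_wedge l \<eta> vs - cov_wedge l \<zeta> vs)"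
  by (simp add: cov_wedge_def fun_eq_iff algebra_simps sum_subtractf)

lemma cov_wedge_zero [simp]: "cov_wedge l (\<lambda>ws. 0) = (\<lambda>vs. 0)"
  by (simp add: cov_wedge_def fun_eq_iff)

lemma cov_wedge_sum: "cov_wedge l (\<lambda>ws. \<Sum>i\<in>I. \<eta> i ws) = (\<lambda>vs. \<Sum>i\<in>I. cov_wedge l (\<eta> i) vs)"
  by (induction I rule: infinite_finite_induct) (simp_all add: cov_wedge_add)

lemma cov_wedge_left_add: "cov_wedge (\<lambda>v. l v + m v) \<eta> = (\<lambda>vs. cov_wedge l \<eta> vs + cov_wedge m \<eta> vs)"
  by (simp add: cov_wedge_def fun_eq_iff algebra_simps sum.distrib)

lemma cov_wedge_left_scale: "cov_wedge (\<lambda>v. c * l v) \<eta> = (\<lambda>vs. c * cov_wedge l \<eta> vs)"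
  by (simp add: cov_wedge_def fun_eq_iff algebra_simps sum_distrib_left)

lemma cov_wedge_left_zero [simp]: "cov_wedge (\<lambda>v. 0) \<eta> = (\<lambda>vs. 0)"
  by (simp add: cov_wedge_def fun_eq_iff)

lemma cov_wedge_left_sum: "cov_wedge (\<lambda>v. \<Sum>i\<in>I. l i v) \<eta> = (\<lambda>vs. \<Sum>i\<in>I. cov_wedge (l i) \<eta> vs)"
  by (induction I rule: infinite_finite_induct) (simp_all add: cov_wedge_left_add)

text \<open>Both sides remove two vectors and evaluate \<open>l\<close> and \<open>m\<close> at them; exchanging the order of removal changes
the sign.\<close>

lemma cov_wedge_anticommute: "cov_wedge l (cov_wedge m \<eta>) = (\<lambda>vs. - cov_wedge m (cov_wedge l \<eta>) vs)"
proof
  fix vs show "cov_wedge l (cov_wedge m \<eta>) vs = - cov_wedge m (cov_wedge l \<eta>) vs"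
  proof (induction vs arbitrary: \<eta>)
    case (Cons v vs)
    have "cov_wedge l (cov_wedge m \<eta>) (v # vs) =
        l v * cov_wedge m \<eta> vs - m v * cov_wedge l \<eta> vs
        + cov_wedge l (cov_wedge m (\<lambda>ws. \<eta> (v # ws))) vs" for l m
      by (simp add: cov_wedge_Cons cov_wedge_diff cov_wedge_scale)
    then show ?case using Cons.IH[of "\<lambda>ws. \<eta> (v # ws)"] by simp
  qed simp
qed

lemma cov_wedge_same [simp]: "cov_wedge l (cov_wedge l \<eta>) = (\<lambda>vs. 0)"
proof
  fix vs show "cov_wedge l (cov_wedge l \<eta>) vs = 0"
    using fun_cong[OF cov_wedge_anticommute[of l l \<eta>], of vs] by simp
qed

abbreviation wedges :: "('v \<Rightarrow> complex) list \<Rightarrow> ('v list \<Rightarrow> complex) \<Rightarrow> 'v list \<Rightarrow> complex" where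
  "wedges ls \<eta> \<equiv> foldr cov_wedge ls \<eta>"

definition unit_covector :: "'v list \<Rightarrow> complex" where
  "unit_covector vs = (if vs = [] then 1 else 0)"

lemma wedges_scale: "wedges ls (\<lambda>ws. c * \<eta> ws) = (\<lambda>vs. c * wedges ls \<eta> vs)"
  by (induction ls) (simp_all add: cov_wedge_scale)

lemma wedges_add: "wedges ls (\<lambda>ws. \<eta> ws + \<zeta> ws) = (\<lambda>vs. wedges ls \<eta> vs + wedges ls \<zeta> vs)"
  by (induction ls) (simp_all add: cov_wedge_add)

lemma wedges_zero [simp]: "wedges ls (\<lambda>ws. 0) = (\<lambda>vs. 0)"
  by (induction ls) simp_all

lemma cov_wedge_wedges:
  "cov_wedge l (wedges ls \<eta>) = (\<lambda>vs. (- 1) ^ length ls * wedges ls (cov_wedge l \<eta>) vs)"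
proof (induction ls)
  case (Cons m ls)
  show ?case
    by (simp add: cov_wedge_anticommute[of l m] Cons.IH cov_wedge_scale)
qed simp

lemma wedges_wedges:
  "wedges ls (wedges ms \<eta>) = (\<lambda>vs. (- 1) ^ (length ls * length ms) * wedges ms (wedges ls \<eta>) vs)"
proof (induction ls)
  case (Cons l ls)
  have "wedges (l # ls) (wedges ms \<eta>) vs = (- 1) ^ (length ls * length ms) * cov_wedge l (wedges ms (wedges ls \<eta>)) vs" for vs
    by (simp add: Cons.IH cov_wedge_scale)
  then show ?case
    by (subst (asm) cov_wedge_wedges) (simp add: fun_eq_iff power_add)
qed simp

lemma wedge_wedges_eq_0_if_mem:
  assumes "l \<in> set ls"
  shows "cov_wedge l (wedges ls \<eta>) = (\<lambda>vs. 0)"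
  using assms
proof (induction ls)
  case (Cons m ls)
  then show ?case
    by (cases "m = l") (auto simp: cov_wedge_anticommute[of l m])
qed simp

lemma wedges_eq_0_if_not_distinct:
  assumes "\<not> distinct as"
  shows "wedges (map f as) \<eta> = (\<lambda>vs. 0)"
  using assms
proof (induction as)
  case (Cons a as)
  then show ?case
    by (cases "a \<in> set as") (auto intro: wedge_wedges_eq_0_if_mem)
qed simp

lemma sum_delta_times:
  fixes f :: "'n::finite \<Rightarrow> complex"
  shows "(\<Sum>b\<in>UNIV. (if b = a then 1 else 0) * f b) = f a"
    and "(\<Sum>b\<in>UNIV. (if a = b then 1 else 0) * f b) = f a"
proof -
  have "(\<Sum>b\<in>UNIV. (if b = a then 1 else 0) * f b) = (\<Sum>b\<in>UNIV. if b = a then f b else 0)"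
    by (intro sum.cong) auto
  then show "(\<Sum>b\<in>UNIV. (if b = a then 1 else 0) * f b) = f a" by simp
  then show "(\<Sum>b\<in>UNIV. (if a = b then 1 else 0) * f b) = f a" by (simp only: eq_commute[of a])
qed

section \<open>Interior products\<close>

text \<open>The value of \<open>l\<close> at the complex tangent vector \<open>\<partial>/\<partial>z\<^sub>a\<close>. For a real linear \<open>l\<close> this is the coefficient of
\<open>dz a\<close>.\<close>

definition dz_part :: "'n::finite \<Rightarrow> (complex^'n \<Rightarrow> complex) \<Rightarrow> complex" where
  "dz_part a l = (l (axis a 1) - \<i> * l (axis a \<i>)) / 2"

lemma dz_part_dz: "dz_part a (dz b) = (if a = b then 1 else 0)"
  by (simp add: dz_part_def dz_def axis_def)

lemma dz_part_dzbar [simp]: "dz_part a (dzbar b) = 0"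
  by (simp add: dz_part_def dzbar_def axis_def)

lemma interior_dz_add: "interior_dz a (\<lambda>ws. \<eta> ws + \<zeta> ws) = (\<lambda>vs. interior_dz a \<eta> vs + interior_dz a \<zeta> vs)"
  by (simp add: interior_dz_def fun_eq_iff field_simps)

lemma interior_dz_scale: "interior_dz a (\<lambda>ws. c * \<eta> ws) = (\<lambda>vs. c * interior_dz a \<eta> vs)"
  by (simp add: interior_dz_def fun_eq_iff algebra_simps)

lemma interior_dz_minus: "interior_dz a (\<lambda>ws. - \<eta> ws) = (\<lambda>vs. - interior_dz a \<eta> vs)"
  using interior_dz_scale[of a "-1" \<eta>] by simp

lemma interior_dz_zero [simp]: "interior_dz a (\<lambda>ws. 0) = (\<lambda>vs. 0)"
  by (simp add: interior_dz_def fun_eq_iff)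

lemma interior_dz_sum: "interior_dz a (\<lambda>ws. \<Sum>i\<in>I. \<eta> i ws) = (\<lambda>vs. \<Sum>i\<in>I. interior_dz a (\<eta> i) vs)"
  by (induction I rule: infinite_finite_induct) (simp_all add: interior_dz_add)

lemma interior_dz_unit [simp]: "interior_dz a unit_covector = (\<lambda>vs. 0)"
  by (simp add: interior_dz_def fun_eq_iff unit_covector_def)

text \<open>The antiderivation rule is the Laplace expansion along the first vector, taken at the two real vectors
that make up \<open>\<partial>/\<partial>z\<^sub>a\<close>.\<close>

lemma interior_dz_wedge:
  "interior_dz a (cov_wedge l \<eta>) = (\<lambda>vs. dz_part a l * \<eta> vs - cov_wedge l (interior_dz a \<eta>) vs)"
proof -
  have "interior_dz a \<eta> = (\<lambda>vs. (1/2) * \<eta> (axis a 1 # vs) - (\<i>/2) * \<eta> (axis a \<i> # vs))"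
    by (simp add: interior_dz_def fun_eq_iff field_simps)
  then have eq: "cov_wedge l (interior_dz a \<eta>) = (\<lambda>vs. (1/2) * cov_wedge l (\<lambda>ws. \<eta> (axis a 1 # ws)) vs
      - (\<i>/2) * cov_wedge l (\<lambda>ws. \<eta> (axis a \<i> # ws)) vs)"
    by (simp only: cov_wedge_diff cov_wedge_scale)
  show ?thesis
    unfolding eq
    by (simp add: interior_dz_def cov_wedge_Cons dz_part_def fun_eq_iff field_simps)
qed

text \<open>Applied with all indices, this iterated interior product removes the factor \<open>dz\<^sub>1 \<and> \<dots> \<and> dz\<^sub>n\<close> from a covector of
type \<open>(n, q)\<close> and leaves its \<open>(0, q)\<close>-coefficient.\<close>

definition strip :: "'n::finite list \<Rightarrow> ('n covector) \<Rightarrow> 'n covector" where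
  "strip as \<eta> = fold interior_dz as \<eta>"

lemma strip_Nil [simp]: "strip [] \<eta> = \<eta>" and strip_Cons [simp]: "strip (a # as) \<eta> = strip as (interior_dz a \<eta>)"
  by (simp_all add: strip_def)

lemma strip_add: "strip as (\<lambda>ws. \<eta> ws + \<zeta> ws) = (\<lambda>vs. strip as \<eta> vs + strip as \<zeta> vs)"
  by (induction as arbitrary: \<eta> \<zeta>) (simp_all add: interior_dz_add)

lemma strip_scale: "strip as (\<lambda>ws. c * \<eta> ws) = (\<lambda>vs. c * strip as \<eta> vs)"
  by (induction as arbitrary: \<eta>) (simp_all add: interior_dz_scale)

lemma strip_minus: "strip as (\<lambda>ws. - \<eta> ws) = (\<lambda>vs. - strip as \<eta> vs)"
  using strip_scale[of as "-1" \<eta>] by simp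

lemma strip_zero [simp]: "strip as (\<lambda>ws. 0) = (\<lambda>vs. 0)"
  by (induction as) simp_all

lemma strip_sum: "strip as (\<lambda>ws. \<Sum>i\<in>I. \<eta> i ws) = (\<lambda>vs. \<Sum>i\<in>I. strip as (\<eta> i) vs)"
  by (induction I rule: infinite_finite_induct) (simp_all add: strip_add)

lemma strip_wedge:
  assumes "\<And>a. dz_part a l = 0"
  shows "strip as (cov_wedge l \<eta>) = (\<lambda>vs. (- 1) ^ length as * cov_wedge l (strip as \<eta>) vs)"
proof (induction as arbitrary: \<eta>)
  case (Cons a as)
  then show ?case
    by (simp add: interior_dz_wedge assms strip_minus)
qed simp

text \<open>If \<open>dz a \<and> \<eta> = 0\<close>, then applying the interior product with \<open>\<partial>/\<partial>z\<^sub>a\<close> to this equation shows that \<open>\<eta>\<close> is \<open>dz a\<close>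
times its interior product, and the latter is still annihilated by the remaining factors.\<close>

lemma wedges_strip:
  assumes "distinct as" "\<And>a. a \<in> set as \<Longrightarrow> cov_wedge (dz a) \<eta> = (\<lambda>vs. 0)"
  shows "wedges (map dz as) (strip as \<eta>) = \<eta>"
  using assms
proof (induction as arbitrary: \<eta>)
  case (Cons a as)
  have 0: "interior_dz a (cov_wedge (dz b) \<eta>) = (\<lambda>vs. 0)" if "b \<in> set (a # as)" for b
    using Cons.prems that by simp
  then have eq: "cov_wedge (dz b) (interior_dz a \<eta>) = (\<lambda>vs. if a = b then \<eta> vs else 0)"
    if "b \<in> set (a # as)" for b
    using 0[OF that] by (auto simp: interior_dz_wedge dz_part_dz fun_eq_iff)
  have "wedges (map dz as) (strip as (interior_dz a \<eta>)) = interior_dz a \<eta>"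
    using Cons.prems by (intro Cons.IH) (auto simp: eq)
  then show ?case by (simp add: eq)
qed simp

section \<open>Covectors of type \<open>(p, q)\<close>\<close>

lemma pq_monomial_eq: "pq_monomial as bs = wedges (map dz as) (wedges (map dzbar bs) unit_covector)"
  by (simp add: pq_monomial_def unit_covector_def[abs_def])

lemma finite_lists_int_length: "finite {as :: 'n::finite list. int (length as) = p}"
proof -
  have "{as :: 'n list. int (length as) = p} \<subseteq> {as. set as \<subseteq> UNIV \<and> length as = nat p}"
    by (intro Collect_mono conjI subset_UNIV impI) (metis nat_int)
  then show ?thesis
    by (rule finite_subset) (rule finite_lists_length_eq, simp)
qed

text \<open>A single sum over pairs of index lists lets the general facts on finite spanning families apply.\<close>

lemma pq_covectors_eq:
  "pq_covectors p q = {\<eta>. \<exists>f. \<eta> = (\<lambda>vs. \<Sum>i\<in>{as. int (length as) = p} \<times> {bs. int (length bs) = q}.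
      f i * pq_monomial (fst i) (snd i) vs)}"
proof -
  have eq: "(\<Sum>as\<in>{as. int (length as) = p}. \<Sum>bs\<in>{bs. int (length bs) = q}. f as bs * pq_monomial as bs vs)
     = (\<Sum>i\<in>{as. int (length as) = p} \<times> {bs. int (length bs) = q}.
      case_prod f i * pq_monomial (fst i) (snd i) vs)" for f :: "'a list \<Rightarrow> 'a list \<Rightarrow> complex" and vs
    by (simp add: sum.cartesian_product case_prod_beta)
  have curry: "(\<exists>f. P (case_prod f)) \<longleftrightarrow> (\<exists>f. P f)" for P :: "('a list \<times> 'a list \<Rightarrow> complex) \<Rightarrow> bool"
    by (metis case_prod_curry)
  then show ?thesis
    unfolding pq_covectors_def eq by (intro Collect_cong) (rule curry)
qed

lemma pq_covectors_zero [simp]: "(\<lambda>vs. 0) \<in> pq_covectors p q"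
  unfolding pq_covectors_eq by (auto intro!: exI[of _ "\<lambda>_. 0"])

lemma pq_covectors_add:
  assumes "\<eta> \<in> pq_covectors p q" "\<zeta> \<in> pq_covectors p q"
  shows "(\<lambda>vs. \<eta> vs + \<zeta> vs) \<in> pq_covectors p q"
proof -
  obtain f g where "\<eta> = (\<lambda>vs. \<Sum>i\<in>{as. int (length as) = p} \<times> {bs. int (length bs) = q}.
      f i * pq_monomial (fst i) (snd i) vs)" "\<zeta> = (\<lambda>vs. \<Sum>i\<in>{as. int (length as) = p} \<times> {bs. int (length bs) = q}.
      g i * pq_monomial (fst i) (snd i) vs)"
    using assms unfolding pq_covectors_eq by blast
  then show ?thesis unfolding pq_covectors_eq
    by (auto intro!: exI[of _ "\<lambda>i. f i + g i"] simp: algebra_simps sum.distrib)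
qed

lemma pq_covectors_scale:
  assumes "\<eta> \<in> pq_covectors p q"
  shows "(\<lambda>vs. c * \<eta> vs) \<in> pq_covectors p q"
proof -
  obtain f where "\<eta> = (\<lambda>vs. \<Sum>i\<in>{as. int (length as) = p} \<times> {bs. int (length bs) = q}.
      f i * pq_monomial (fst i) (snd i) vs)"
    using assms unfolding pq_covectors_eq by blast
  then show ?thesis unfolding pq_covectors_eq
    by (auto intro!: exI[of _ "\<lambda>i. c * f i"] simp: algebra_simps sum_distrib_left)
qed

lemma pq_covectors_minus: "\<eta> \<in> pq_covectors p q \<Longrightarrow> (\<lambda>vs. - \<eta> vs) \<in> pq_covectors p q"
  using pq_covectors_scale[of \<eta> p q "-1"] by simp

lemma pq_covectors_diff:
  "\<eta> \<in> pq_covectors p q \<Longrightarrow> \<zeta> \<in> pq_covectors p q \<Longrightarrow> (\<lambda>vs. \<eta> vs - \<zeta> vs) \<in> pq_covectors p q"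
  using pq_covectors_add[OF _ pq_covectors_minus, of \<eta> p q \<zeta>] by simp

lemma pq_covectors_sum:
  "(\<And>i. i \<in> I \<Longrightarrow> \<eta> i \<in> pq_covectors p q) \<Longrightarrow> (\<lambda>vs. \<Sum>i\<in>I. \<eta> i vs) \<in> pq_covectors p q"
  by (induction I rule: infinite_finite_induct) (simp_all add: pq_covectors_add)

lemma pq_monomial_in:
  fixes as bs :: "'a::finite list"
  assumes "int (length as) = p" "int (length bs) = q"
  shows "pq_monomial as bs \<in> pq_covectors p q"
proof -
  let ?S = "{as :: 'a list. int (length as) = p} \<times> {bs :: 'a list. int (length bs) = q}"
  have "(\<Sum>i\<in>?S. (if i = (as, bs) then 1 else 0) * pq_monomial (fst i) (snd i) vs)
      = (\<Sum>i\<in>?S. if i = (as, bs) then pq_monomial as bs vs else 0)" for vs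
    by (intro sum.cong) auto
  moreover have "(\<Sum>i\<in>?S. if i = (as, bs) then pq_monomial as bs vs else 0) = pq_monomial as bs vs" for vs
    using assms by (subst sum.delta) (intro finite_cartesian_product finite_lists_int_length, simp)
  ultimately have "(\<Sum>i\<in>?S. (if i = (as, bs) then 1 else 0) * pq_monomial (fst i) (snd i) vs) = pq_monomial as bs vs" for vs
    by (simp only:)
  then have "pq_monomial as bs = (\<lambda>vs. \<Sum>i\<in>?S. (if i = (as, bs) then 1 else 0) * pq_monomial (fst i) (snd i) vs)"
    by (intro ext) (rule sym)
  note eq = this
  show ?thesis
    unfolding pq_covectors_eq mem_Collect_eq
    by (rule exI[of _ "\<lambda>i. if i = (as, bs) then 1 else 0"], subst eq, rule refl)
qed

lemma pq_covectors_induct [consumes 1, case_names monomial zero add scale]: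
  fixes \<eta> :: "'a::finite covector"
  assumes "\<eta> \<in> pq_covectors p q"
    and mon: "\<And>as bs. int (length as) = p \<Longrightarrow> int (length bs) = q \<Longrightarrow> P (pq_monomial as bs)"
    and zero: "P (\<lambda>vs. 0)"
    and add: "\<And>\<eta> \<zeta>. P \<eta> \<Longrightarrow> P \<zeta> \<Longrightarrow> P (\<lambda>vs. \<eta> vs + \<zeta> vs)"
    and scale: "\<And>c \<eta>. P \<eta> \<Longrightarrow> P (\<lambda>vs. c * \<eta> vs)"
  shows "P \<eta>"
proof -
  obtain f where f: "\<eta> = (\<lambda>vs. \<Sum>i\<in>{as. int (length as) = p} \<times> {bs. int (length bs) = q}.
      f i * pq_monomial (fst i) (snd i) vs)"
    using assms unfolding pq_covectors_eq by blast
  let ?S = "{as :: 'a list. int (length as) = p} \<times> {bs :: 'a list. int (length bs) = q}"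
  have *: "P (\<lambda>vs. \<Sum>i\<in>I. f i * pq_monomial (fst i) (snd i) vs)" if "finite I" "I \<subseteq> ?S" for I
    using that
  proof (induction I rule: finite_induct)
    case empty
    show ?case using zero by simp
  next
    case (insert i I)
    have "P (\<lambda>vs. f i * pq_monomial (fst i) (snd i) vs)"
      using insert.prems by (intro scale mon) auto
    moreover have "P (\<lambda>vs. \<Sum>i\<in>I. f i * pq_monomial (fst i) (snd i) vs)"
      using insert by simp
    ultimately show ?case
      using insert.hyps add by simp
  qed
  show ?thesis
    by (subst f, rule *, intro finite_cartesian_product finite_lists_int_length, rule order_refl)
qed

lemma dz_wedge_pq: "\<eta> \<in> pq_covectors p q \<Longrightarrow> cov_wedge (dz a) \<eta> \<in> pq_covectors (p + 1) q"
proof (induction rule: pq_covectors_induct)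
  case (monomial as bs)
  have "cov_wedge (dz a) (pq_monomial as bs) = pq_monomial (a # as) bs"
    by (simp add: pq_monomial_eq)
  moreover have "pq_monomial (a # as) bs \<in> pq_covectors (p + 1) q"
    using monomial by (intro pq_monomial_in) simp_all
  ultimately show ?case by simp
next
  case zero
  then show ?case by simp
next
  case (add \<eta> \<zeta>)
  then show ?case by (simp only: cov_wedge_add pq_covectors_add)
next
  case (scale c \<eta>)
  then show ?case by (simp only: cov_wedge_scale pq_covectors_scale)
qed

lemma dzbar_wedge_pq: "\<eta> \<in> pq_covectors p q \<Longrightarrow> cov_wedge (dzbar a) \<eta> \<in> pq_covectors p (q + 1)"
proof (induction rule: pq_covectors_induct)
  case (monomial as bs)
  have "cov_wedge (dzbar a) (pq_monomial as bs) = (\<lambda>vs. (- 1) ^ length as * pq_monomial as (a # bs) vs)"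
    unfolding pq_monomial_eq by (subst cov_wedge_wedges) simp
  moreover have "pq_monomial as (a # bs) \<in> pq_covectors p (q + 1)"
    using monomial by (intro pq_monomial_in) simp_all
  ultimately show ?case by (simp add: pq_covectors_scale)
next
  case zero
  then show ?case by simp
next
  case (add \<eta> \<zeta>)
  then show ?case by (simp only: cov_wedge_add pq_covectors_add)
next
  case (scale c \<eta>)
  then show ?case by (simp only: cov_wedge_scale pq_covectors_scale)
qed

lemma interior_dz_wedges_dzbar: "interior_dz a (wedges (map dzbar bs) unit_covector) = (\<lambda>vs. 0)"
  by (induction bs) (simp_all add: interior_dz_wedge)

lemma interior_dz_pq_monomial: "interior_dz a (pq_monomial as bs) \<in> pq_covectors (int (length as) - 1) (int (length bs))"
proof (induction as)
  case Nil
  then show ?case by (simp add: pq_monomial_eq interior_dz_wedges_dzbar)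
next
  case (Cons c as)
  have eq: "pq_monomial (c # as) bs = cov_wedge (dz c) (pq_monomial as bs)"
    by (simp add: pq_monomial_eq)
  have "cov_wedge (dz c) (interior_dz a (pq_monomial as bs)) \<in> pq_covectors (int (length (c # as)) - 1) (int (length bs))"
    using dz_wedge_pq[OF Cons.IH] by simp
  then show ?case unfolding eq interior_dz_wedge
    by (intro pq_covectors_diff pq_covectors_scale pq_monomial_in) simp_all
qed

lemma interior_dz_pq: "\<eta> \<in> pq_covectors p q \<Longrightarrow> interior_dz a \<eta> \<in> pq_covectors (p - 1) q"
proof (induction rule: pq_covectors_induct)
  case (monomial as bs)
  then show ?case using interior_dz_pq_monomial by blast
qed (simp_all add: interior_dz_add interior_dz_scale pq_covectors_add pq_covectors_scale)

lemma strip_pq: "\<eta> \<in> pq_covectors p q \<Longrightarrow> strip as \<eta> \<in> pq_covectors (p - int (length as)) q"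
proof (induction as arbitrary: \<eta> p)
  case (Cons a as)
  have "p - 1 - int (length as) = p - int (length (a # as))" by simp
  then show ?case using Cons.IH[OF interior_dz_pq[OF Cons.prems, of a]] by (simp only: strip_Cons)
qed simp

text \<open>A monomial with more factors \<open>dz\<close> than there are coordinates repeats one of them.\<close>

lemma dz_wedge_top:
  assumes "\<eta> \<in> pq_covectors (int CARD('n::finite)) q"
  shows "cov_wedge (dz (a :: 'n)) \<eta> = (\<lambda>vs. 0)"
  using assms
proof (induction rule: pq_covectors_induct)
  case (monomial as bs)
  have "\<not> distinct (a # as)"
    using card_mono[of "UNIV :: 'n set" "set (a # as)"] monomial distinct_card[of "a # as"] by fastforce
  then have "wedges (map dz (a # as)) (wedges (map dzbar bs) unit_covector) = (\<lambda>vs. 0)"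
    by (rule wedges_eq_0_if_not_distinct)
  then show ?case by (simp add: pq_monomial_eq)
qed (simp_all add: cov_wedge_add cov_wedge_scale)

lemma pq_covectors_length:
  "\<eta> \<in> pq_covectors p q \<Longrightarrow> int (length vs) \<noteq> p + q \<Longrightarrow> \<eta> vs = 0"
proof (induction rule: pq_covectors_induct)
  case (monomial as bs)
  have *: "length us \<noteq> length ls \<Longrightarrow> wedges ls unit_covector us = 0" for ls and us :: "(complex^'a) list"
  proof (induction ls arbitrary: us)
    case (Cons l ls)
    then show ?case by (auto simp: cov_wedge_def)
  qed (simp add: unit_covector_def)
  have "pq_monomial as bs vs = wedges (map dz as @ map dzbar bs) unit_covector vs"
    by (simp add: pq_monomial_eq)
  also have "\<dots> = 0" using monomial by (intro *) auto
  finally show ?case .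
qed simp_all

lemma scalar_covector: "\<eta> \<in> pq_covectors 0 0 \<Longrightarrow> \<eta> = (\<lambda>vs. \<eta> [] * unit_covector vs)"
proof
  fix vs assume "\<eta> \<in> pq_covectors 0 0"
  then show "\<eta> vs = \<eta> [] * unit_covector vs"
    using pq_covectors_length[of \<eta> 0 0 vs] by (cases "vs = []") (auto simp: unit_covector_def)
qed

lemma wedge_unit: "cov_wedge l unit_covector vs = (if length vs = 1 then l (hd vs) else 0)"
proof (cases vs)
  case (Cons v ws)
  then show ?thesis by (cases ws) (auto simp: cov_wedge_Cons unit_covector_def cov_wedge_def)
qed simp

lemma wedge_unit_singleton [simp]: "cov_wedge l unit_covector [v] = l v"
  by (simp add: wedge_unit)

text \<open>The 1-covectors of type \<open>(0, 1)\<close>, seen as functions of one vector.\<close>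

definition antilinear_form :: "(complex^'n::finite \<Rightarrow> complex) \<Rightarrow> bool" where
  "antilinear_form l \<longleftrightarrow> (\<exists>c. l = (\<lambda>v. \<Sum>b\<in>UNIV. c b * dzbar b v))"

lemma covector_01:
  assumes "\<eta> \<in> pq_covectors 0 1"
  shows "\<eta> = cov_wedge (\<lambda>v. \<eta> [v]) unit_covector" and "antilinear_form (\<lambda>v. \<eta> [v])"
proof -
  show "\<eta> = cov_wedge (\<lambda>v. \<eta> [v]) unit_covector"
  proof
    fix vs show "\<eta> vs = cov_wedge (\<lambda>v. \<eta> [v]) unit_covector vs"
      using pq_covectors_length[OF assms, of vs]
      by (cases vs rule: remdups_adj.cases) (auto simp: wedge_unit)
  qed
  show "antilinear_form (\<lambda>v. \<eta> [v])" using assms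
  proof (induction rule: pq_covectors_induct)
    case (monomial as bs)
    then obtain b where "as = []" "bs = [b]" by (cases bs) auto
    then show ?case unfolding antilinear_form_def
      by (intro exI[of _ "\<lambda>c. if c = b then 1 else 0"]) (simp add: pq_monomial_eq sum_delta_times)
  next
    case zero
    then show ?case unfolding antilinear_form_def by (intro exI[of _ "\<lambda>c. 0"]) simp
  next
    case (add \<eta> \<zeta>)
    then obtain c d where "(\<lambda>v. \<eta> [v]) = (\<lambda>v. \<Sum>b\<in>UNIV. c b * dzbar b v)" "(\<lambda>v. \<zeta> [v]) = (\<lambda>v. \<Sum>b\<in>UNIV. d b * dzbar b v)"
      unfolding antilinear_form_def by blast
    then show ?case unfolding antilinear_form_def
      by (intro exI[of _ "\<lambda>b. c b + d b"]) (simp add: fun_eq_iff algebra_simps sum.distrib)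
  next
    case (scale k \<eta>)
    then obtain c where "(\<lambda>v. \<eta> [v]) = (\<lambda>v. \<Sum>b\<in>UNIV. c b * dzbar b v)"
      unfolding antilinear_form_def by blast
    then show ?case unfolding antilinear_form_def
      by (intro exI[of _ "\<lambda>b. k * c b"]) (simp add: fun_eq_iff algebra_simps sum_distrib_left)
  qed
qed

lemma dz_part_sum: "dz_part a (\<lambda>v. \<Sum>i\<in>I. c i * l i v) = (\<Sum>i\<in>I. c i * dz_part a (l i))"
  by (simp add: dz_part_def sum_distrib_left sum_subtractf[symmetric] sum_divide_distrib algebra_simps)

lemma antilinear_dz_part: "antilinear_form l \<Longrightarrow> dz_part a l = 0"
  by (auto simp: antilinear_form_def dz_part_sum)

lemma antilinear_wedge_pq:
  assumes "antilinear_form l" "\<eta> \<in> pq_covectors p q"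
  shows "cov_wedge l \<eta> \<in> pq_covectors p (q + 1)"
proof -
  obtain c where "l = (\<lambda>v. \<Sum>b\<in>UNIV. c b * dzbar b v)"
    using assms(1) unfolding antilinear_form_def by blast
  then show ?thesis
    by (auto simp: cov_wedge_left_sum cov_wedge_left_scale intro!: pq_covectors_sum pq_covectors_scale dzbar_wedge_pq assms(2))
qed

text \<open>Euler's identity: the operator counts the factors \<open>dz\<close> of a monomial.\<close>

lemma dz_wedge_interior:
  "\<eta> \<in> pq_covectors p q \<Longrightarrow> (\<Sum>a\<in>UNIV. cov_wedge (dz a) (interior_dz a \<eta>) vs) = of_int p * \<eta> vs"
proof (induction arbitrary: vs rule: pq_covectors_induct)
  case (monomial as bs)
  have "(\<Sum>a\<in>UNIV. cov_wedge (dz a) (interior_dz a (pq_monomial as bs)) vs) = of_nat (length as) * pq_monomial as bs vs" for vs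
  proof (induction as arbitrary: vs)
    case Nil
    then show ?case by (simp add: pq_monomial_eq interior_dz_wedges_dzbar)
  next
    case (Cons c as)
    let ?\<eta> = "pq_monomial as bs"
    have "(\<Sum>a\<in>UNIV. cov_wedge (dz a) (interior_dz a (cov_wedge (dz c) ?\<eta>)) vs)
      = (\<Sum>a\<in>UNIV. (if a = c then cov_wedge (dz a) ?\<eta> vs else 0) + cov_wedge (dz c) (cov_wedge (dz a) (interior_dz a ?\<eta>)) vs)"
      by (intro sum.cong refl)
        (auto simp: interior_dz_wedge cov_wedge_diff cov_wedge_scale dz_part_dz cov_wedge_anticommute[of "dz c"])
    also have "\<dots> = cov_wedge (dz c) ?\<eta> vs + cov_wedge (dz c) (\<lambda>ws. \<Sum>a\<in>UNIV. cov_wedge (dz a) (interior_dz a ?\<eta>) ws) vs"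
      by (simp add: sum.distrib sum.delta cov_wedge_sum)
    also have "\<dots> = (1 + of_nat (length as)) * cov_wedge (dz c) ?\<eta> vs"
      by (simp add: Cons.IH cov_wedge_scale algebra_simps)
    finally show ?case by (simp add: pq_monomial_eq)
  qed
  then show ?case by (simp flip: monomial(1))
qed (simp_all add: interior_dz_add interior_dz_scale cov_wedge_add cov_wedge_scale sum.distrib
     algebra_simps sum_distrib_left[symmetric])

text \<open>The dual of Euler's identity counts the missing factors. For \<open>p = n - 1\<close> it recovers a covector from its
products with the \<open>dz a\<close>.\<close>

lemma sum_interior_wedge:
  fixes \<eta> :: "'n::finite covector"
  assumes "\<eta> \<in> pq_covectors p q"
  shows "(\<Sum>a\<in>UNIV. interior_dz a (cov_wedge (dz a) \<eta>) vs) = (of_nat CARD('n) - of_int p) * \<eta> vs"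
  using dz_wedge_interior[OF assms, of vs]
  by (simp add: interior_dz_wedge dz_part_dz sum_subtractf algebra_simps)

section \<open>Smooth functions\<close>

lemma has_frechet_derivative:
  "f differentiable at x \<Longrightarrow> (f has_derivative frechet_derivative f (at x)) (at x)"
  by (simp add: frechet_derivative_works)

lemma frechet_derivative_eqI:
  "(f has_derivative f') (at x) \<Longrightarrow> frechet_derivative f (at x) = f'"
  by (rule frechet_derivative_at[symmetric])

lemma frechet_derivative_cong_open:
  assumes "open S" "x \<in> S" "\<And>y. y \<in> S \<Longrightarrow> f y = g y"
  shows "frechet_derivative f (at x) = frechet_derivative g (at x)"
proof -
  have "(f has_derivative f') (at x) \<longleftrightarrow> (g has_derivative f') (at x)" for f'
    using has_derivative_transform_within_open[of f f' x UNIV S g]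
      has_derivative_transform_within_open[of g f' x UNIV S f] assms by auto
  then show ?thesis by (simp add: frechet_derivative_def)
qed

lemma differentiable_cong_open:
  assumes "open S" "x \<in> S" "\<And>y. y \<in> S \<Longrightarrow> f y = g y"
  shows "f differentiable at x \<longleftrightarrow> g differentiable at x"
proof -
  have "(f has_derivative f') (at x) \<longleftrightarrow> (g has_derivative f') (at x)" for f'
    using has_derivative_transform_within_open[of f f' x UNIV S g]
      has_derivative_transform_within_open[of g f' x UNIV S f] assms by auto
  then show ?thesis by (simp add: differentiable_def)
qed

text \<open>Derivatives at points of an open set depend only on the values on this set.\<close>

lemma Ck_on_cong:
  assumes "open S" "\<And>x. x \<in> S \<Longrightarrow> f x = g x"
  shows "Ck_on k S f \<longleftrightarrow> Ck_on k S g"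
  using assms(2)
proof (induction k arbitrary: f g)
  case 0
  then show ?case by (simp cong: continuous_on_cong)
next
  case (Suc k)
  have "f differentiable at x \<longleftrightarrow> g differentiable at x"
    and eq: "frechet_derivative f (at x) = frechet_derivative g (at x)" if "x \<in> S" for x
    using differentiable_cong_open[OF assms(1) that, of f g]
      frechet_derivative_cong_open[OF assms(1) that, of f g] Suc.prems by auto
  moreover have "Ck_on k S (\<lambda>x. frechet_derivative f (at x) v) \<longleftrightarrow> Ck_on k S (\<lambda>x. frechet_derivative g (at x) v)" for v
    by (rule Suc.IH) (simp add: eq)
  ultimately show ?case by simp
qed

lemma Ck_on_SucD: "Ck_on (Suc k) S f \<Longrightarrow> Ck_on k S f"
proof (induction k arbitrary: f)
  case 0
  then show ?case
    by (auto intro!: continuous_at_imp_continuous_on differentiable_imp_continuous_within)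
next
  case (Suc k)
  then show ?case by simp
qed

text \<open>Any derivative of \<open>f\<close> may be used in place of the one chosen by \<open>frechet_derivative\<close>.\<close>

lemma Ck_on_SucI:
  assumes "open S" and der: "\<And>x. x \<in> S \<Longrightarrow> (f has_derivative f' x) (at x)"
    and "\<And>v. Ck_on k S (\<lambda>x. f' x v)"
  shows "Ck_on (Suc k) S f"
proof -
  have "Ck_on k S (\<lambda>x. frechet_derivative f (at x) v) \<longleftrightarrow> Ck_on k S (\<lambda>x. f' x v)" for v
    by (rule Ck_on_cong[OF assms(1)]) (simp add: frechet_derivative_eqI[OF der])
  then show ?thesis
    using assms by (auto intro: differentiableI)
qed

lemma Ck_on_SucE:
  assumes "Ck_on (Suc k) S f"
  shows "x \<in> S \<Longrightarrow> (f has_derivative frechet_derivative f (at x)) (at x)"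
    and "Ck_on k S (\<lambda>x. frechet_derivative f (at x) v)"
  using assms by (simp_all add: has_frechet_derivative)

lemma Ck_on_bounded_linear:
  assumes "bounded_linear L" "open S" "Ck_on k S f"
  shows "Ck_on k S (\<lambda>x. L (f x))"
  using assms(3)
proof (induction k arbitrary: f)
  case 0
  then show ?case
    using bounded_linear.continuous_on[OF assms(1)] by auto
next
  case (Suc k)
  show ?case
    by (rule Ck_on_SucI[OF assms(2) bounded_linear.has_derivative[OF assms(1) Ck_on_SucE(1)[OF Suc.prems]]
          Suc.IH[OF Ck_on_SucE(2)[OF Suc.prems]]])
qed

lemma Ck_on_const: "open S \<Longrightarrow> Ck_on k S (\<lambda>x. c)"
proof (induction k arbitrary: c)
  case (Suc k)
  then show ?case by simp
qed simp

lemma Ck_on_add: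
  assumes "open S" "Ck_on k S f" "Ck_on k S g"
  shows "Ck_on k S (\<lambda>x. f x + g x)"
  using assms(2,3)
proof (induction k arbitrary: f g)
  case 0
  then show ?case by (auto intro: continuous_on_add)
next
  case (Suc k)
  show ?case
    by (rule Ck_on_SucI[OF assms(1) has_derivative_add[OF Suc.prems[THEN Ck_on_SucE(1)]]
          Suc.IH[OF Suc.prems[THEN Ck_on_SucE(2)]]])
qed

lemma Ck_on_mult:
  fixes f g :: "'a::real_normed_vector \<Rightarrow> complex"
  assumes "open S" "Ck_on k S f" "Ck_on k S g"
  shows "Ck_on k S (\<lambda>x. f x * g x)"
  using assms(2,3)
proof (induction k arbitrary: f g)
  case 0
  then show ?case by (auto intro: continuous_on_mult)
next
  case (Suc k)
  show ?case
    by (rule Ck_on_SucI[OF assms(1) has_derivative_mult[OF Suc.prems[THEN Ck_on_SucE(1)]]])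
      (simp_all add: Ck_on_add assms(1) Suc.IH Suc.prems[THEN Ck_on_SucD] Suc.prems[THEN Ck_on_SucE(2)])
qed

lemma Ck_on_inverse:
  fixes f :: "'a::real_normed_vector \<Rightarrow> complex"
  assumes "open S" "Ck_on k S f" "\<And>x. x \<in> S \<Longrightarrow> f x \<noteq> 0"
  shows "Ck_on k S (\<lambda>x. inverse (f x))"
  using assms(2)
proof (induction k)
  case 0
  then show ?case using assms(3) by (auto intro: continuous_on_inverse)
next
  case (Suc k)
  show ?case
    by (rule Ck_on_SucI[OF assms(1) Deriv.has_derivative_inverse[OF assms(3) Ck_on_SucE(1)[OF Suc.prems]]])
      (simp_all add: Ck_on_mult Ck_on_bounded_linear[OF bounded_linear_minus[OF bounded_linear_ident]]
        assms(1) Suc.IH[OF Ck_on_SucD[OF Suc.prems]] Ck_on_SucE(2)[OF Suc.prems])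
qed

lemma smooth_on_cong: "open S \<Longrightarrow> (\<And>x. x \<in> S \<Longrightarrow> f x = g x) \<Longrightarrow> smooth_on S f \<longleftrightarrow> smooth_on S g"
  unfolding smooth_on_def using Ck_on_cong by blast

lemma smooth_on_bounded_linear: "bounded_linear L \<Longrightarrow> open S \<Longrightarrow> smooth_on S f \<Longrightarrow> smooth_on S (\<lambda>x. L (f x))"
  by (simp add: smooth_on_def Ck_on_bounded_linear)

lemma smooth_on_const: "open S \<Longrightarrow> smooth_on S (\<lambda>x. c)"
  by (simp add: smooth_on_def Ck_on_const)

lemma smooth_on_add: "open S \<Longrightarrow> smooth_on S f \<Longrightarrow> smooth_on S g \<Longrightarrow> smooth_on S (\<lambda>x. f x + g x)"
  by (simp add: smooth_on_def Ck_on_add)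

lemma smooth_on_mult:
  fixes f g :: "'a::real_normed_vector \<Rightarrow> complex"
  shows "open S \<Longrightarrow> smooth_on S f \<Longrightarrow> smooth_on S g \<Longrightarrow> smooth_on S (\<lambda>x. f x * g x)"
  by (simp add: smooth_on_def Ck_on_mult)

lemma smooth_on_inverse:
  fixes f :: "'a::real_normed_vector \<Rightarrow> complex"
  shows "open S \<Longrightarrow> smooth_on S f \<Longrightarrow> (\<And>x. x \<in> S \<Longrightarrow> f x \<noteq> 0) \<Longrightarrow> smooth_on S (\<lambda>x. inverse (f x))"
  by (simp add: smooth_on_def Ck_on_inverse)

lemma smooth_on_sum:
  "open S \<Longrightarrow> (\<And>i. i \<in> I \<Longrightarrow> smooth_on S (f i)) \<Longrightarrow> smooth_on S (\<lambda>x. \<Sum>i\<in>I. f i x)"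
  by (induction I rule: infinite_finite_induct) (simp_all add: smooth_on_const smooth_on_add)

lemma smooth_on_cmult:
  fixes f :: "'a::real_normed_vector \<Rightarrow> complex"
  shows "open S \<Longrightarrow> smooth_on S f \<Longrightarrow> smooth_on S (\<lambda>x. c * f x)"
  by (simp add: smooth_on_mult smooth_on_const)

lemma smooth_on_derivative: "smooth_on S f \<Longrightarrow> smooth_on S (\<lambda>x. frechet_derivative f (at x) v)"
  unfolding smooth_on_def by (metis Ck_on.simps(2))

lemma smooth_on_differentiable: "smooth_on S f \<Longrightarrow> x \<in> S \<Longrightarrow> f differentiable at x"
  unfolding smooth_on_def by (metis Ck_on.simps(2))

lemma smooth_on_continuous: "smooth_on S f \<Longrightarrow> continuous_on S f"
  unfolding smooth_on_def by (metis Ck_on.simps(1))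

lemma bounded_linear_axis: "bounded_linear (axis a :: complex \<Rightarrow> complex^'n::finite)"
  unfolding linear_conv_bounded_linear[symmetric]
  by (intro linearI) (auto simp: vec_eq_iff axis_def)

lemma vec_eq_sum_axis: "(v :: complex^'n::finite) = (\<Sum>a\<in>UNIV. axis a (v $ a))"
  by (simp add: vec_eq_iff axis_def)

lemma smooth_on_vec_iff:
  fixes f :: "'a::real_normed_vector \<Rightarrow> complex^'n::finite"
  assumes "open S"
  shows "smooth_on S f \<longleftrightarrow> (\<forall>a. smooth_on S (\<lambda>x. f x $ a))"
proof
  assume "\<forall>a. smooth_on S (\<lambda>x. f x $ a)"
  then have "smooth_on S (\<lambda>x. \<Sum>a\<in>UNIV. axis a (f x $ a))"
    by (intro smooth_on_sum smooth_on_bounded_linear[OF bounded_linear_axis] assms) auto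
  then show "smooth_on S f" by (simp flip: vec_eq_sum_axis)
qed (auto intro: smooth_on_bounded_linear[OF bounded_linear_vec_nth] assms)

lemma frechet_derivative_component:
  fixes f :: "'a::real_normed_vector \<Rightarrow> complex^'n::finite"
  assumes "f differentiable at x"
  shows "frechet_derivative (\<lambda>x. f x $ a) (at x) v = frechet_derivative f (at x) v $ a"
proof -
  have "((\<lambda>x. f x $ a) has_derivative (\<lambda>v. frechet_derivative f (at x) v $ a)) (at x)"
    using assms by (intro bounded_linear.has_derivative[OF bounded_linear_vec_nth]) (simp add: has_frechet_derivative)
  then show ?thesis by (simp add: frechet_derivative_eqI)
qed

section \<open>Symmetry of second derivatives\<close>

text \<open>The mean value theorem, first in direction \<open>v\<close> for the difference of two parallel edges of the square,
then in direction \<open>w\<close>.\<close>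

lemma real_second_difference:
  fixes f :: "'a::real_normed_vector \<Rightarrow> real"
  assumes "t > 0"
    and f: "\<And>s r. s \<in> {0..t} \<Longrightarrow> r \<in> {0..t} \<Longrightarrow> f differentiable at (z + s *\<^sub>R v + r *\<^sub>R w)"
    and f': "\<And>s r. s \<in> {0..t} \<Longrightarrow> r \<in> {0..t} \<Longrightarrow>
      (\<lambda>x. frechet_derivative f (at x) v) differentiable at (z + s *\<^sub>R v + r *\<^sub>R w)"
  shows "\<exists>s\<in>{0..t}. \<exists>r\<in>{0..t}. f (z + t *\<^sub>R v + t *\<^sub>R w) - f (z + t *\<^sub>R v) - f (z + t *\<^sub>R w) + f z
    = t * t * frechet_derivative (\<lambda>x. frechet_derivative f (at x) v) (at (z + s *\<^sub>R v + r *\<^sub>R w)) w"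
proof -
  let ?g = "\<lambda>s. f (z + s *\<^sub>R v + t *\<^sub>R w) - f (z + s *\<^sub>R v + 0 *\<^sub>R w)"
  let ?D = "\<lambda>x. frechet_derivative f (at x)"
  have lin: "linear (frechet_derivative h (at x))" if "h differentiable at x" for h :: "'a \<Rightarrow> real" and x
    using that by (rule linear_frechet_derivative)
  have fd: "((\<lambda>s. f (z + s *\<^sub>R v + r *\<^sub>R w)) has_derivative (\<lambda>h. h * ?D (z + s *\<^sub>R v + r *\<^sub>R w) v)) (at s)"
    if "s \<in> {0..t}" "r \<in> {0..t}" for s r
  proof -
    have "((\<lambda>s. z + s *\<^sub>R v + r *\<^sub>R w) has_derivative (\<lambda>h. h *\<^sub>R v)) (at s)"
      by (auto intro!: derivative_eq_intros)
    moreover have "(f has_derivative ?D (z + s *\<^sub>R v + r *\<^sub>R w)) (at (z + s *\<^sub>R v + r *\<^sub>R w))"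
      using f[OF that] by (simp add: has_frechet_derivative)
    ultimately have "((\<lambda>s. f (z + s *\<^sub>R v + r *\<^sub>R w)) has_derivative (\<lambda>h. ?D (z + s *\<^sub>R v + r *\<^sub>R w) (h *\<^sub>R v))) (at s)"
      by (rule has_derivative_compose)
    then show ?thesis by (simp add: linear_scale[OF lin[OF f[OF that]]])
  qed
  have "\<exists>s\<in>{0<..<t}. ?g t - ?g 0 = (t - 0) * (?D (z + s *\<^sub>R v + t *\<^sub>R w) v - ?D (z + s *\<^sub>R v + 0 *\<^sub>R w) v)"
  proof -
    have "(?g has_derivative (\<lambda>h. h * (?D (z + s *\<^sub>R v + t *\<^sub>R w) v - ?D (z + s *\<^sub>R v + 0 *\<^sub>R w) v))) (at s within {0..t})"
      if "s \<in> {0..t}" for s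
    proof -
      have "t \<in> {0..t}" "0 \<in> {0..t}" using \<open>t > 0\<close> by simp_all
      from has_derivative_diff[OF fd[OF that this(1)] fd[OF that this(2)]]
      show ?thesis unfolding right_diff_distrib by (rule has_derivative_at_withinI)
    qed
    then show ?thesis
      using mvt_simple[OF \<open>t > 0\<close>, of ?g "\<lambda>s h. h * (?D (z + s *\<^sub>R v + t *\<^sub>R w) v - ?D (z + s *\<^sub>R v + 0 *\<^sub>R w) v)"]
      by auto
  qed
  then obtain s where s: "s \<in> {0<..<t}"
    and 1: "?g t - ?g 0 = t * (?D (z + s *\<^sub>R v + t *\<^sub>R w) v - ?D (z + s *\<^sub>R v + 0 *\<^sub>R w) v)" by auto
  let ?h = "\<lambda>r. ?D (z + s *\<^sub>R v + r *\<^sub>R w) v"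
  let ?D2 = "\<lambda>r. frechet_derivative (\<lambda>x. ?D x v) (at (z + s *\<^sub>R v + r *\<^sub>R w)) w"
  have "(?h has_derivative (\<lambda>h. h * ?D2 r)) (at r within {0..t})" if "r \<in> {0..t}" for r
  proof -
    have *: "(\<lambda>x. ?D x v) differentiable at (z + s *\<^sub>R v + r *\<^sub>R w)" using f' s that by auto
    have "((\<lambda>r. z + s *\<^sub>R v + r *\<^sub>R w) has_derivative (\<lambda>h. h *\<^sub>R w)) (at r)"
      by (auto intro!: derivative_eq_intros)
    moreover have "((\<lambda>x. ?D x v) has_derivative frechet_derivative (\<lambda>x. ?D x v) (at (z + s *\<^sub>R v + r *\<^sub>R w))) (at (z + s *\<^sub>R v + r *\<^sub>R w))"
      using * by (simp add: has_frechet_derivative)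
    ultimately have "(?h has_derivative (\<lambda>h. frechet_derivative (\<lambda>x. ?D x v) (at (z + s *\<^sub>R v + r *\<^sub>R w)) (h *\<^sub>R w))) (at r)"
      by (rule has_derivative_compose)
    moreover have "frechet_derivative (\<lambda>x. ?D x v) (at (z + s *\<^sub>R v + r *\<^sub>R w)) (h *\<^sub>R w) = h * ?D2 r" for h
      using linear_scale[OF lin[OF *], of h w] by simp
    ultimately show ?thesis by (simp only: has_derivative_at_withinI)
  qed
  then have "\<exists>r\<in>{0<..<t}. ?h t - ?h 0 = (t - 0) * ?D2 r"
    using mvt_simple[OF \<open>t > 0\<close>, of ?h "\<lambda>r h. h * ?D2 r"] by auto
  then obtain r where r: "r \<in> {0<..<t}" "?h t - ?h 0 = t * ?D2 r" by auto
  have "f (z + t *\<^sub>R v + t *\<^sub>R w) - f (z + t *\<^sub>R v) - f (z + t *\<^sub>R w) + f z = ?g t - ?g 0" by simp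
  also have "\<dots> = t * (t * ?D2 r)" using 1 r(2) by simp
  finally show ?thesis using s r(1) by (intro bexI[of _ s] bexI[of _ r]) auto
qed

text \<open>The second difference over a small square is symmetric in \<open>v\<close> and \<open>w\<close>. So the two mixed derivatives take
a common value at points arbitrarily close to \<open>z\<close>, and both are continuous.\<close>

lemma second_derivative_symmetric_real:
  fixes f :: "'a::real_normed_vector \<Rightarrow> real"
  assumes "open S" "z \<in> S" "smooth_on S f"
  shows "frechet_derivative (\<lambda>x. frechet_derivative f (at x) v) (at z) w
       = frechet_derivative (\<lambda>x. frechet_derivative f (at x) w) (at z) v"
proof (rule ccontr)
  let ?A = "\<lambda>v w x. frechet_derivative (\<lambda>x. frechet_derivative f (at x) v) (at x) w"
  assume ne: "?A v w z \<noteq> ?A w v z"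
  define e where "e = \<bar>?A v w z - ?A w v z\<bar> / 2"
  have "e > 0" using ne by (simp add: e_def)
  have cont: "continuous_on S (?A v w)" for v w
    by (intro smooth_on_continuous smooth_on_derivative assms)
  have "\<exists>d>0. \<forall>y. dist y z < d \<longrightarrow> y \<in> S \<and> dist (?A v w y) (?A v w z) < e" for v w
  proof -
    obtain d1 where d1: "d1 > 0" "\<And>y. y \<in> S \<Longrightarrow> dist y z < d1 \<Longrightarrow> dist (?A v w y) (?A v w z) < e"
      using cont[of v w] assms(2) \<open>e > 0\<close> unfolding continuous_on_iff by blast
    obtain d2 where d2: "d2 > 0" "\<And>y. dist y z < d2 \<Longrightarrow> y \<in> S"
      using assms(1,2) unfolding open_dist by blast
    show ?thesis using d1 d2 by (intro exI[of _ "min d1 d2"]) auto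
  qed
  from this[of v w] this[of w v] obtain d where "d > 0"
    and d: "\<And>y. dist y z < d \<Longrightarrow> y \<in> S" "\<And>y. dist y z < d \<Longrightarrow> dist (?A v w y) (?A v w z) < e"
      "\<And>y. dist y z < d \<Longrightarrow> dist (?A w v y) (?A w v z) < e"
    by (metis min_less_iff_conj)
  \<comment> \<open>This choice keeps the square spanned by \<open>t v\<close> and \<open>t w\<close> at \<open>z\<close> inside the ball of radius \<open>d\<close>.\<close>
  define t where "t = d / (2 * (norm v + norm w + 1))"
  have pos: "norm v + norm w + 1 > 0" by (simp add: add_nonneg_pos)
  have "t > 0" using \<open>d > 0\<close> pos by (simp add: t_def)
  have near: "dist (z + s *\<^sub>R v + r *\<^sub>R w) z < d" "dist (z + s *\<^sub>R w + r *\<^sub>R v) z < d"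
    if "s \<in> {0..t}" "r \<in> {0..t}" for s r
  proof -
    have *: "norm (s *\<^sub>R v + r *\<^sub>R w) < d" if "s \<in> {0..t}" "r \<in> {0..t}" for s r
    proof -
      have "norm (s *\<^sub>R v + r *\<^sub>R w) \<le> s * norm v + r * norm w"
        using that norm_triangle_ineq[of "s *\<^sub>R v" "r *\<^sub>R w"] by simp
      also have "\<dots> \<le> t * norm v + t * norm w"
        using that by (intro add_mono mult_right_mono) auto
      also have "\<dots> < 2 * (t * (norm v + norm w + 1))"
        using \<open>t > 0\<close> by (simp add: algebra_simps add_pos_nonneg add_nonneg_pos)
      also have "\<dots> = d" using pos by (simp add: t_def del: distrib_left_numeral)
      finally show ?thesis .
    qed
    show "dist (z + s *\<^sub>R v + r *\<^sub>R w) z < d" "dist (z + s *\<^sub>R w + r *\<^sub>R v) z < d"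
      using *[OF that] *[OF that(2,1)] by (simp_all add: dist_norm add.commute add.left_commute)
  qed
  have diff: "f differentiable at x" "(\<lambda>x. frechet_derivative f (at x) u) differentiable at x" if "dist x z < d" for x u
    using smooth_on_differentiable[OF assms(3)] smooth_on_differentiable[OF smooth_on_derivative[OF assms(3)]] d(1)[OF that] by auto
  obtain p where p: "dist p z < d" "f (z + t *\<^sub>R v + t *\<^sub>R w) - f (z + t *\<^sub>R v) - f (z + t *\<^sub>R w) + f z = t * t * ?A v w p"
    using real_second_difference[OF \<open>t > 0\<close>, of f z v w] near(1) diff by blast
  obtain q where q: "dist q z < d" "f (z + t *\<^sub>R w + t *\<^sub>R v) - f (z + t *\<^sub>R w) - f (z + t *\<^sub>R v) + f z = t * t * ?A w v q"
    using real_second_difference[OF \<open>t > 0\<close>, of f z w v] near(2) diff by blast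
  have swap: "z + t *\<^sub>R w + t *\<^sub>R v = z + t *\<^sub>R v + t *\<^sub>R w"
    by (simp only: add.assoc add.commute add.left_commute)
  have "t * t * ?A v w p = t * t * ?A w v q"
    using p(2) q(2)[unfolded swap] by linarith
  then have "?A v w p = ?A w v q" using \<open>t > 0\<close> by simp
  moreover have "dist (?A v w p) (?A v w z) < e" "dist (?A w v q) (?A w v z) < e"
    using d(2)[OF p(1)] d(3)[OF q(1)] .
  ultimately have "\<bar>?A v w z - ?A w v z\<bar> < 2 * e"
    by (simp add: dist_real_def)
  then show False by (simp add: e_def)
qed

lemma frechet_derivative_bounded_linear:
  assumes "bounded_linear L" "f differentiable at x"
  shows "frechet_derivative (\<lambda>x. L (f x)) (at x) = (\<lambda>v. L (frechet_derivative f (at x) v))"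
  using assms
  by (intro frechet_derivative_eqI bounded_linear.has_derivative[OF assms(1)]) (simp add: has_frechet_derivative)

lemma second_derivative_symmetric:
  fixes f :: "'a::real_normed_vector \<Rightarrow> complex"
  assumes "open S" "z \<in> S" "smooth_on S f"
  shows "frechet_derivative (\<lambda>x. frechet_derivative f (at x) v) (at z) w
       = frechet_derivative (\<lambda>x. frechet_derivative f (at x) w) (at z) v"
proof -
  have "L (frechet_derivative (\<lambda>x. frechet_derivative f (at x) v) (at z) w)
      = frechet_derivative (\<lambda>x. frechet_derivative (\<lambda>x. L (f x)) (at x) v) (at z) w"
    if L: "bounded_linear L" for L :: "complex \<Rightarrow> real" and v w
  proof -
    have "frechet_derivative (\<lambda>x. frechet_derivative (\<lambda>x. L (f x)) (at x) v) (at z)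
        = frechet_derivative (\<lambda>x. L (frechet_derivative f (at x) v)) (at z)"
      by (rule frechet_derivative_cong_open[OF assms(1,2)])
         (simp add: frechet_derivative_bounded_linear[OF L smooth_on_differentiable[OF assms(3)]])
    also have "\<dots> = (\<lambda>w. L (frechet_derivative (\<lambda>x. frechet_derivative f (at x) v) (at z) w))"
      by (intro frechet_derivative_bounded_linear[OF L] smooth_on_differentiable[OF smooth_on_derivative[OF assms(3)] assms(2)])
    finally show ?thesis by simp
  qed
  from this[OF bounded_linear_Re] this[OF bounded_linear_Im]
  show ?thesis
    using second_derivative_symmetric_real[OF assms(1,2) smooth_on_bounded_linear[OF bounded_linear_Re assms(1,3)], of v w]
      second_derivative_symmetric_real[OF assms(1,2) smooth_on_bounded_linear[OF bounded_linear_Im assms(1,3)], of v w]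
    unfolding complex_eq_iff by metis
qed

section \<open>Wirtinger derivatives of families of covectors\<close>

text \<open>The derivative by \<open>z\<^sub>a\<close> for \<open>s = - \<i>\<close> and by its conjugate for \<open>s = \<i>\<close>. The parameter serves to prove the
rules for both at once.\<close>

definition wirt :: "complex \<Rightarrow> 'n::finite \<Rightarrow> (complex^'n \<Rightarrow> complex) \<Rightarrow> complex^'n \<Rightarrow> complex" where
  "wirt s a f z = (frechet_derivative f (at z) (axis a 1) + s * frechet_derivative f (at z) (axis a \<i>)) / 2"

lemma dz_deriv_eq: "dz_deriv a = wirt (- \<i>) a"
  by (simp add: fun_eq_iff dz_deriv_def wirt_def)

lemma dzbar_deriv_eq: "dzbar_deriv a = wirt \<i> a"
  by (simp add: fun_eq_iff dzbar_deriv_def wirt_def)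

lemma wirt_cong_open:
  assumes "open S" "z \<in> S" "\<And>y. y \<in> S \<Longrightarrow> f y = g y"
  shows "wirt s a f z = wirt s a g z"
  by (simp add: wirt_def frechet_derivative_cong_open[OF assms])

lemma wirt_const [simp]: "wirt s a (\<lambda>w. c) z = 0"
  by (simp add: wirt_def)

lemma wirt_add:
  assumes "f differentiable at z" "g differentiable at z"
  shows "wirt s a (\<lambda>w. f w + g w) z = wirt s a f z + wirt s a g z"
  using frechet_derivative_eqI[OF has_derivative_add[OF assms[THEN has_frechet_derivative]]]
  by (simp add: wirt_def field_simps)

lemma wirt_mult:
  assumes "f differentiable at z" "g differentiable at z"
  shows "wirt s a (\<lambda>w. f w * g w) z = wirt s a f z * g z + f z * wirt s a g z"
  using frechet_derivative_eqI[OF has_derivative_mult[OF assms[THEN has_frechet_derivative]]]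
  by (simp add: wirt_def field_simps)

lemma wirt_cmult:
  assumes "f differentiable at z"
  shows "wirt s a (\<lambda>w. c * f w) z = c * wirt s a f z"
  using wirt_mult[of "\<lambda>w. c" z f s a] assms by simp

lemma wirt_sum:
  assumes "\<And>i. i \<in> I \<Longrightarrow> f i differentiable at z"
  shows "wirt s a (\<lambda>w. \<Sum>i\<in>I. f i w) z = (\<Sum>i\<in>I. wirt s a (f i) z)"
  using assms
  by (induction I rule: infinite_finite_induct) (simp_all add: wirt_add differentiable_sum)

lemma smooth_on_wirt:
  assumes "open S" "smooth_on S f"
  shows "smooth_on S (wirt s a f)"
proof -
  have "wirt s a f = (\<lambda>z. (1/2) * frechet_derivative f (at z) (axis a 1) + (s/2) * frechet_derivative f (at z) (axis a \<i>))"
    by (simp add: wirt_def fun_eq_iff field_simps)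
  moreover have "smooth_on S (\<lambda>z. (1/2) * frechet_derivative f (at z) (axis a 1) + (s/2) * frechet_derivative f (at z) (axis a \<i>))"
    by (intro smooth_on_add smooth_on_cmult smooth_on_derivative assms)
  ultimately show ?thesis by (simp only:)
qed

lemma wirt_commute:
  assumes "open S" "z \<in> S" "smooth_on S f"
  shows "wirt s a (wirt r b f) z = wirt r b (wirt s a f) z"
proof -
  let ?D = "\<lambda>v x. frechet_derivative f (at x) v"
  have d: "?D v differentiable at z" for v
    by (rule smooth_on_differentiable[OF smooth_on_derivative[OF assms(3)] assms(2)])
  have exp: "wirt s a (wirt r b f) z = (frechet_derivative (?D (axis b 1)) (at z) (axis a 1)
      + r * frechet_derivative (?D (axis b \<i>)) (at z) (axis a 1)
      + s * frechet_derivative (?D (axis b 1)) (at z) (axis a \<i>)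
      + s * r * frechet_derivative (?D (axis b \<i>)) (at z) (axis a \<i>)) / 4" for s r a b
  proof -
    have eq: "wirt r b f = (\<lambda>z. (1/2) * ?D (axis b 1) z + (r/2) * ?D (axis b \<i>) z)"
      by (simp add: wirt_def fun_eq_iff field_simps)
    have split: "wirt s a (wirt r b f) z = (1/2) * wirt s a (?D (axis b 1)) z + (r/2) * wirt s a (?D (axis b \<i>)) z"
      unfolding eq wirt_cmult[OF d, symmetric] by (intro wirt_add differentiable_mult differentiable_const d)
    show ?thesis
      unfolding split by (simp add: wirt_def[of _ _ "?D _"] field_simps)
  qed
  show ?thesis unfolding exp
    by (simp add: second_derivative_symmetric[OF assms, of "axis b _" "axis a _"] mult.commute)
qed

text \<open>The derivative of a family of covectors that depends on a point, taken separately at each list of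
vectors, that is, in the flat coordinates of a chart.\<close>

definition cov_deriv :: "complex \<Rightarrow> 'n::finite \<Rightarrow> (complex^'n \<Rightarrow> 'v \<Rightarrow> complex) \<Rightarrow> complex^'n \<Rightarrow> 'v \<Rightarrow> complex" where
  "cov_deriv s a F z = (\<lambda>vs. wirt s a (\<lambda>w. F w vs) z)"

definition smooth_family :: "(complex^'n::finite) set \<Rightarrow> (complex^'n \<Rightarrow> 'v \<Rightarrow> complex) \<Rightarrow> bool" where
  "smooth_family S F \<longleftrightarrow> (\<forall>vs. smooth_on S (\<lambda>z. F z vs))"

definition diff_family :: "(complex^'n::finite \<Rightarrow> 'v \<Rightarrow> complex) \<Rightarrow> complex^'n \<Rightarrow> bool" where
  "diff_family F z \<longleftrightarrow> (\<forall>vs. (\<lambda>w. F w vs) differentiable at z)"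

lemma smooth_diff_family: "smooth_family S F \<Longrightarrow> z \<in> S \<Longrightarrow> diff_family F z"
  unfolding smooth_family_def diff_family_def using smooth_on_differentiable by blast

lemma diff_family_const [simp]: "diff_family (\<lambda>w. \<eta>) z"
  by (simp add: diff_family_def)

lemma cov_deriv_const [simp]: "cov_deriv s a (\<lambda>w. \<eta>) z = (\<lambda>vs. 0)"
  by (simp add: cov_deriv_def)

lemma cov_deriv_cong_open:
  assumes "open S" "z \<in> S" "\<And>y. y \<in> S \<Longrightarrow> F y = G y"
  shows "cov_deriv s a F z = cov_deriv s a G z"
  unfolding cov_deriv_def by (intro ext wirt_cong_open[OF assms(1,2)]) (simp add: assms(3))

lemma diff_family_add:
  "diff_family F z \<Longrightarrow> diff_family G z \<Longrightarrow> diff_family (\<lambda>w vs. F w vs + G w vs) z"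
  by (simp add: diff_family_def)

lemma diff_family_mult:
  "diff_family F z \<Longrightarrow> f differentiable at z \<Longrightarrow> diff_family (\<lambda>w vs. f w * F w vs) z"
  by (simp add: diff_family_def)

lemma diff_family_sum:
  "(\<And>i. i \<in> I \<Longrightarrow> diff_family (F i) z) \<Longrightarrow> diff_family (\<lambda>w vs. \<Sum>i\<in>I. F i w vs) z"
  by (induction I rule: infinite_finite_induct) (simp_all add: diff_family_add)

lemma cov_deriv_add:
  "diff_family F z \<Longrightarrow> diff_family G z \<Longrightarrow>
    cov_deriv s a (\<lambda>w vs. F w vs + G w vs) z = (\<lambda>vs. cov_deriv s a F z vs + cov_deriv s a G z vs)"
  by (simp add: diff_family_def cov_deriv_def wirt_add)

lemma cov_deriv_mult:
  "diff_family F z \<Longrightarrow> f differentiable at z \<Longrightarrow>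
    cov_deriv s a (\<lambda>w vs. f w * F w vs) z = (\<lambda>vs. wirt s a f z * F z vs + f z * cov_deriv s a F z vs)"
  by (simp add: diff_family_def cov_deriv_def wirt_mult)

lemma cov_deriv_sum:
  "(\<And>i. i \<in> I \<Longrightarrow> diff_family (F i) z) \<Longrightarrow>
    cov_deriv s a (\<lambda>w vs. \<Sum>i\<in>I. F i w vs) z = (\<lambda>vs. \<Sum>i\<in>I. cov_deriv s a (F i) z vs)"
  by (simp add: diff_family_def cov_deriv_def wirt_sum)

lemma smooth_family_cov_deriv: "open S \<Longrightarrow> smooth_family S F \<Longrightarrow> smooth_family S (cov_deriv s a F)"
  by (simp add: smooth_family_def cov_deriv_def smooth_on_wirt)

lemma cov_deriv_commute:
  assumes "open S" "z \<in> S" "smooth_family S F"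
  shows "cov_deriv s a (cov_deriv r b F) z = cov_deriv r b (cov_deriv s a F) z"
  using assms(3) unfolding cov_deriv_def smooth_family_def
  by (intro ext wirt_commute[OF assms(1,2)]) blast

lemma smooth_family_sum:
  "open S \<Longrightarrow> (\<And>i. i \<in> I \<Longrightarrow> smooth_family S (F i)) \<Longrightarrow> smooth_family S (\<lambda>w vs. \<Sum>i\<in>I. F i w vs)"
  by (simp add: smooth_family_def smooth_on_sum)

lemma smooth_family_wedge:
  assumes "open S" "smooth_family S l" "smooth_family S F"
  shows "smooth_family S (\<lambda>w. cov_wedge (l w) (F w))"
  using assms unfolding smooth_family_def cov_wedge_def
  by (auto intro!: smooth_on_sum smooth_on_mult smooth_on_const)

lemma smooth_family_const: "open S \<Longrightarrow> smooth_family S (\<lambda>w. \<eta>)"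
  by (simp add: smooth_family_def smooth_on_const)

lemma diff_family_wedge:
  assumes "diff_family l z" "diff_family F z"
  shows "diff_family (\<lambda>w. cov_wedge (l w) (F w)) z"
  using assms unfolding diff_family_def cov_wedge_def by auto

lemma cov_deriv_wedge:
  assumes "diff_family l z" "diff_family F z"
  shows "cov_deriv s a (\<lambda>w. cov_wedge (l w) (F w)) z
    = (\<lambda>vs. cov_wedge (cov_deriv s a l z) (F z) vs + cov_wedge (l z) (cov_deriv s a F z) vs)"
proof
  fix vs
  have "cov_deriv s a (\<lambda>w. cov_wedge (l w) (F w)) z vs
     = (\<Sum>j<length vs. wirt s a (\<lambda>w. (- 1) ^ j * (l w (vs ! j) * F w (take j vs @ drop (Suc j) vs))) z)"
    unfolding cov_deriv_def cov_wedge_def mult.assoc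
    using assms by (intro wirt_sum) (auto simp: diff_family_def)
  also have "\<dots> = (\<Sum>j<length vs. (- 1) ^ j * (wirt s a (\<lambda>w. l w (vs ! j)) z * F z (take j vs @ drop (Suc j) vs)
      + l z (vs ! j) * wirt s a (\<lambda>w. F w (take j vs @ drop (Suc j) vs)) z))"
    using assms by (intro sum.cong refl) (simp add: wirt_cmult wirt_mult diff_family_def)
  finally show "cov_deriv s a (\<lambda>w. cov_wedge (l w) (F w)) z vs
    = cov_wedge (cov_deriv s a l z) (F z) vs + cov_wedge (l z) (cov_deriv s a F z) vs"
    by (simp add: cov_wedge_def cov_deriv_def algebra_simps sum.distrib)
qed

lemma interior_dz_alt: "interior_dz a \<eta> = (\<lambda>vs. (1/2) * \<eta> (axis a 1 # vs) + (- \<i>/2) * \<eta> (axis a \<i> # vs))"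
  by (simp add: interior_dz_def fun_eq_iff field_simps)

lemma smooth_family_interior: "open S \<Longrightarrow> smooth_family S F \<Longrightarrow> smooth_family S (\<lambda>w. interior_dz a (F w))"
  unfolding smooth_family_def interior_dz_alt by (simp only: smooth_on_add smooth_on_cmult simp_thms)

lemma diff_family_interior: "diff_family F z \<Longrightarrow> diff_family (\<lambda>w. interior_dz a (F w)) z"
  unfolding diff_family_def interior_dz_alt by simp

lemma cov_deriv_interior:
  "diff_family F z \<Longrightarrow> cov_deriv s a (\<lambda>w. interior_dz b (F w)) z = interior_dz b (cov_deriv s a F z)"
  unfolding diff_family_def interior_dz_alt cov_deriv_def
  by (intro ext, subst wirt_add) (simp_all only: wirt_cmult differentiable_mult differentiable_const simp_thms)

lemma smooth_family_strip: "open S \<Longrightarrow> smooth_family S F \<Longrightarrow> smooth_family S (\<lambda>w. strip as (F w))"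
  by (induction as arbitrary: F) (simp_all add: smooth_family_interior)

lemma cov_deriv_strip:
  "diff_family F z \<Longrightarrow> cov_deriv s a (\<lambda>w. strip as (F w)) z = strip as (cov_deriv s a F z)"
  by (induction as arbitrary: F) (simp_all add: diff_family_interior cov_deriv_interior)

section \<open>Coordinates with respect to monomials\<close>

text \<open>Linear functionals that are finite combinations of evaluations. Unlike arbitrary functionals they commute
with the differentiation of families.\<close>

inductive_set eval_span :: "(('v \<Rightarrow> complex) \<Rightarrow> complex) set" where
  eval: "(\<lambda>\<eta>. \<eta> x) \<in> eval_span"
| zero: "(\<lambda>\<eta>. 0) \<in> eval_span"
| add: "\<phi> \<in> eval_span \<Longrightarrow> \<psi> \<in> eval_span \<Longrightarrow> (\<lambda>\<eta>. \<phi> \<eta> + \<psi> \<eta>) \<in> eval_span"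
| scale: "\<phi> \<in> eval_span \<Longrightarrow> (\<lambda>\<eta>. c * \<phi> \<eta>) \<in> eval_span"

lemma eval_span_sum: "(\<And>i. i \<in> I \<Longrightarrow> \<phi> i \<in> eval_span) \<Longrightarrow> (\<lambda>\<eta>. \<Sum>i\<in>I. \<phi> i \<eta>) \<in> eval_span"
  by (induction I rule: infinite_finite_induct) (simp_all add: eval_span.intros)

lemma eval_span_add: "\<phi> \<in> eval_span \<Longrightarrow> \<phi> (\<lambda>x. \<eta> x + \<zeta> x) = \<phi> \<eta> + \<phi> \<zeta>"
  by (induction rule: eval_span.induct) (simp_all add: algebra_simps)

lemma eval_span_scale: "\<phi> \<in> eval_span \<Longrightarrow> \<phi> (\<lambda>x. c * \<eta> x) = c * \<phi> \<eta>"
  by (induction rule: eval_span.induct) (simp_all add: algebra_simps)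

lemma eval_span_deriv:
  "\<phi> \<in> eval_span \<Longrightarrow> diff_family F z \<Longrightarrow>
    (\<lambda>w. \<phi> (F w)) differentiable at z \<and> wirt s a (\<lambda>w. \<phi> (F w)) z = \<phi> (cov_deriv s a F z)"
  by (induction rule: eval_span.induct) (simp_all add: diff_family_def cov_deriv_def wirt_add wirt_cmult)

text \<open>Coordinates with respect to a finite spanning family can be read off from finitely many values. In the
induction a new function \<open>G j\<close> either lies in the old span, or it differs from its projection to the old span
at some point \<open>y\<close>, and then the values at \<open>y\<close> determine its coefficient.\<close>

lemma eval_span_coordinates:
  assumes "finite I"
  shows "\<exists>\<phi>. (\<forall>i. \<phi> i \<in> eval_span) \<and>
    (\<forall>f s. (\<Sum>i\<in>I. \<phi> i (\<lambda>s. \<Sum>j\<in>I. f j * G j s) * G i s) = (\<Sum>j\<in>I. f j * G j s))"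
  using assms
proof (induction I rule: finite_induct)
  case empty
  show ?case by (intro exI[of _ "\<lambda>i \<eta>. 0"]) (simp add: eval_span.zero)
next
  case (insert j I)
  then obtain \<phi> where \<phi>: "\<And>i. \<phi> i \<in> eval_span"
    "\<And>f s. (\<Sum>i\<in>I. \<phi> i (\<lambda>s. \<Sum>j\<in>I. f j * G j s) * G i s) = (\<Sum>j\<in>I. f j * G j s)" by blast
  define P where "P g s = (\<Sum>i\<in>I. \<phi> i g * G i s)" for g s
  have P_add: "P (\<lambda>s. c * g s + h s) s = c * P g s + P h s" for c g h s
    by (simp add: P_def eval_span_add[OF \<phi>(1)] eval_span_scale[OF \<phi>(1)] algebra_simps sum.distrib sum_distrib_left)
  have P_id: "P (\<lambda>s. \<Sum>j\<in>I. f j * G j s) s = (\<Sum>j\<in>I. f j * G j s)" for f s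
    using \<phi>(2) by (simp add: P_def)
  show ?case
  proof (cases "\<forall>s. P (G j) s = G j s")
    case True
    have "(\<Sum>i\<in>insert j I. (if i = j then (\<lambda>\<eta>. 0) else \<phi> i) (\<lambda>s. \<Sum>k\<in>insert j I. f k * G k s) * G i s)
       = (\<Sum>k\<in>insert j I. f k * G k s)" for f s
    proof -
      have "(\<Sum>i\<in>insert j I. (if i = j then (\<lambda>\<eta>. 0) else \<phi> i) (\<lambda>s. \<Sum>k\<in>insert j I. f k * G k s) * G i s)
         = P (\<lambda>s. f j * G j s + (\<Sum>k\<in>I. f k * G k s)) s"
        using insert.hyps by (auto simp: P_def intro!: sum.cong)
      then show ?thesis
        using insert.hyps True by (simp add: P_add P_id)
    qed
    then show ?thesis
      using \<phi>(1) by (intro exI[of _ "\<lambda>i. if i = j then (\<lambda>\<eta>. 0) else \<phi> i"]) (simp add: eval_span.zero)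
  next
    case False
    then obtain y where "P (G j) y \<noteq> G j y" by blast
    then have y: "G j y - P (G j) y \<noteq> 0" by simp
    \<comment> \<open>The coefficient of \<open>G j\<close>: the difference \<open>g - P g\<close> is a multiple of \<open>G j - P (G j)\<close>.\<close>
    define t where "t g = (1 / (G j y - P (G j) y)) * (g y + (-1) * P g y)" for g
    have t_in: "t \<in> eval_span"
    proof -
      have "(\<lambda>g. P g y) \<in> eval_span"
        unfolding P_def using eval_span.scale[OF \<phi>(1)] by (intro eval_span_sum) (simp add: mult.commute)
      then show ?thesis unfolding t_def by (intro eval_span.intros)
    qed
    define \<phi>' where "\<phi>' i = (if i = j then t else (\<lambda>g. \<phi> i g + (- \<phi> i (G j)) * t g))" for i
    have "(\<Sum>i\<in>insert j I. \<phi>' i (\<lambda>s. \<Sum>k\<in>insert j I. f k * G k s) * G i s)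
       = (\<Sum>k\<in>insert j I. f k * G k s)" for f s
    proof -
      let ?g = "\<lambda>s. f j * G j s + (\<Sum>k\<in>I. f k * G k s)"
      have tg: "t ?g = f j"
        using y by (simp add: t_def P_add P_id field_simps)
      have "(\<Sum>i\<in>insert j I. \<phi>' i ?g * G i s) = t ?g * G j s + (\<Sum>i\<in>I. (\<phi> i ?g + (- \<phi> i (G j)) * t ?g) * G i s)"
        using insert.hyps by (auto simp: \<phi>'_def intro!: sum.cong)
      also have "(\<Sum>i\<in>I. (\<phi> i ?g + (- \<phi> i (G j)) * t ?g) * G i s) = P ?g s - f j * P (G j) s"
        unfolding tg by (simp add: P_def algebra_simps sum_subtractf sum_distrib_left)
      finally show ?thesis
        using insert.hyps by (simp add: tg P_add P_id)
    qed
    moreover have "\<phi>' i \<in> eval_span" for i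
      unfolding \<phi>'_def using eval_span.add[OF \<phi>(1) eval_span.scale[OF t_in]] t_in by (cases "i = j") (simp_all only: if_True if_False simp_thms)
    ultimately show ?thesis by blast
  qed
qed

abbreviation pq_indices :: "int \<Rightarrow> int \<Rightarrow> ('n::finite list \<times> 'n list) set" where
  "pq_indices p q \<equiv> {as. int (length as) = p} \<times> {bs. int (length bs) = q}"

lemma pq_coordinates:
  obtains \<phi> :: "'n::finite list \<times> 'n list \<Rightarrow> ('n covector) \<Rightarrow> complex"
  where "\<And>i. \<phi> i \<in> eval_span"
    and "\<And>\<eta>. \<eta> \<in> pq_covectors p q \<Longrightarrow> \<eta> = (\<lambda>vs. \<Sum>i\<in>pq_indices p q. \<phi> i \<eta> * pq_monomial (fst i) (snd i) vs)"
proof -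
  have "finite (pq_indices p q :: ('n list \<times> 'n list) set)"
    by (intro finite_cartesian_product finite_lists_int_length)
  from eval_span_coordinates[OF this, of "\<lambda>i. pq_monomial (fst i) (snd i)"]
  obtain \<phi> :: "'n list \<times> 'n list \<Rightarrow> ('n covector) \<Rightarrow> complex" where \<phi>: "\<And>i. \<phi> i \<in> eval_span"
    "\<And>f s. (\<Sum>i\<in>pq_indices p q. \<phi> i (\<lambda>s. \<Sum>j\<in>pq_indices p q. f j * pq_monomial (fst j) (snd j) s) * pq_monomial (fst i) (snd i) s)
       = (\<Sum>j\<in>pq_indices p q. f j * pq_monomial (fst j) (snd j) s)"
    by blast
  have "\<eta> = (\<lambda>vs. \<Sum>i\<in>pq_indices p q. \<phi> i \<eta> * pq_monomial (fst i) (snd i) vs)" if mem: "\<eta> \<in> pq_covectors p q" for \<eta>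
  proof -
    obtain f where f: "\<eta> = (\<lambda>vs. \<Sum>i\<in>pq_indices p q. f i * pq_monomial (fst i) (snd i) vs)"
      using mem unfolding pq_covectors_eq by blast
    show ?thesis unfolding f by (rule ext) (rule \<phi>(2)[symmetric])
  qed
  with \<phi>(1) show thesis by (rule that)
qed

text \<open>The coefficients of the monomials are differentiable functions and the monomials are constant, so
differentiation preserves the type.\<close>

lemma cov_deriv_pq:
  fixes F :: "complex^'n::finite \<Rightarrow> 'n covector"
  assumes "open S" "z \<in> S" "\<And>w. w \<in> S \<Longrightarrow> F w \<in> pq_covectors p q" "diff_family F z"
  shows "cov_deriv s a F z \<in> pq_covectors p q"
proof -
  obtain \<phi> :: "'n list \<times> 'n list \<Rightarrow> ('n covector) \<Rightarrow> complex" where \<phi>: "\<And>i. \<phi> i \<in> eval_span"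
    "\<And>\<eta>. \<eta> \<in> pq_covectors p q \<Longrightarrow> \<eta> = (\<lambda>vs. \<Sum>i\<in>pq_indices p q. \<phi> i \<eta> * pq_monomial (fst i) (snd i) vs)"
    using pq_coordinates by blast
  let ?G = "\<lambda>i w vs. \<phi> i (F w) * pq_monomial (fst i) (snd i) vs"
  have *: "(\<lambda>w. \<phi> i (F w)) differentiable at z" for i
    using eval_span_deriv[OF \<phi>(1) assms(4)] by simp
  have G: "diff_family (?G i) z" for i
    by (intro diff_family_mult diff_family_const *)
  have "cov_deriv s a F z = cov_deriv s a (\<lambda>w vs. \<Sum>i\<in>pq_indices p q. ?G i w vs) z"
    by (rule cov_deriv_cong_open[OF assms(1,2)]) (rule \<phi>(2)[OF assms(3)])
  also have "\<dots> = (\<lambda>vs. \<Sum>i\<in>pq_indices p q. wirt s a (\<lambda>w. \<phi> i (F w)) z * pq_monomial (fst i) (snd i) vs)"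
    by (simp only: cov_deriv_sum[OF G] cov_deriv_mult[OF diff_family_const *] cov_deriv_const mult_zero_right add_0_right)
  also have "\<dots> \<in> pq_covectors p q"
    by (intro pq_covectors_sum pq_covectors_scale pq_monomial_in) auto
  finally show ?thesis .
qed

section \<open>The operators \<open>\<partial>\<close> and \<open>\<partial>-bar\<close> in a chart\<close>

text \<open>For \<open>s = - \<i>\<close> and \<open>m = dz\<close> this is \<open>\<partial>\<close>, for \<open>s = \<i>\<close> and \<open>m = dzbar\<close> it is \<open>\<partial>-bar\<close>.\<close>

definition local_d :: "complex \<Rightarrow> ('n::finite \<Rightarrow> complex^'n \<Rightarrow> complex) \<Rightarrow> (complex^'n \<Rightarrow> 'n covector)
    \<Rightarrow> complex^'n \<Rightarrow> 'n covector" where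
  "local_d s m F z = (\<lambda>vs. \<Sum>a\<in>UNIV. cov_wedge (m a) (cov_deriv s a F z) vs)"

abbreviation local_del where "local_del \<equiv> local_d (- \<i>) dz"
abbreviation local_delbar where "local_delbar \<equiv> local_d \<i> dzbar"

lemma del_form_eq: "del_form \<omega> c z = (if z \<in> cimg c then local_del (\<omega> c) z else (\<lambda>vs. 0))"
  by (simp add: del_form_def local_d_def cov_deriv_def dz_deriv_eq fun_eq_iff)

lemma delbar_form_eq: "delbar_form \<omega> c z = (if z \<in> cimg c then local_delbar (\<omega> c) z else (\<lambda>vs. 0))"
  by (simp add: delbar_form_def local_d_def cov_deriv_def dzbar_deriv_eq fun_eq_iff)

lemma local_d_cong_open:
  assumes "open S" "z \<in> S" "\<And>y. y \<in> S \<Longrightarrow> F y = G y"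
  shows "local_d s m F z = local_d s m G z"
  by (simp add: local_d_def cov_deriv_cong_open[OF assms])

lemma local_d_add:
  "diff_family F z \<Longrightarrow> diff_family G z \<Longrightarrow>
    local_d s m (\<lambda>w vs. F w vs + G w vs) z = (\<lambda>vs. local_d s m F z vs + local_d s m G z vs)"
  by (simp add: local_d_def cov_deriv_add cov_wedge_add sum.distrib)

lemma local_d_cmult:
  "diff_family F z \<Longrightarrow> local_d s m (\<lambda>w vs. c * F w vs) z = (\<lambda>vs. c * local_d s m F z vs)"
  using cov_deriv_mult[of F z "\<lambda>_. c" s]
  by (simp add: local_d_def cov_wedge_scale sum_distrib_left)

lemma smooth_family_local_d:
  assumes "open S" "smooth_family S F"
  shows "smooth_family S (local_d s m F)"
  unfolding local_d_def[abs_def]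
  by (intro smooth_family_sum smooth_family_wedge[where l = "\<lambda>w. m _"] smooth_family_const smooth_family_cov_deriv assms)

text \<open>Second derivatives commute and wedge products anticommute.\<close>

lemma local_d_anticommute:
  assumes "open S" "z \<in> S" "smooth_family S F"
  shows "local_d s m (local_d r k F) z = (\<lambda>vs. - local_d r k (local_d s m F) z vs)"
proof -
  have exp: "local_d s m (local_d r k F) z vs
      = (\<Sum>a\<in>UNIV. \<Sum>b\<in>UNIV. cov_wedge (m a) (cov_wedge (k b) (cov_deriv s a (cov_deriv r b F) z)) vs)"
    for s m r k vs
  proof -
    have d: "diff_family (cov_deriv r b F) z" for b
      using smooth_diff_family[OF smooth_family_cov_deriv] assms by blast
    have "cov_deriv s a (local_d r k F) z = (\<lambda>vs. \<Sum>b\<in>UNIV. cov_wedge (k b) (cov_deriv s a (cov_deriv r b F) z) vs)" for a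
    proof -
      have "cov_deriv s a (local_d r k F) z
         = (\<lambda>vs. \<Sum>b\<in>UNIV. cov_deriv s a (\<lambda>w. cov_wedge (k b) (cov_deriv r b F w)) z vs)"
        unfolding local_d_def[abs_def]
        by (intro cov_deriv_sum diff_family_wedge[where l = "\<lambda>w. k _"] diff_family_const d)
      then show ?thesis
        by (simp add: cov_deriv_wedge[where l = "\<lambda>w. k _", OF diff_family_const d])
    qed
    then show ?thesis
      by (simp add: local_d_def[of s] cov_wedge_sum)
  qed
  show ?thesis
  proof
    fix vs
    have "local_d s m (local_d r k F) z vs
       = (\<Sum>a\<in>UNIV. \<Sum>b\<in>UNIV. - cov_wedge (k b) (cov_wedge (m a) (cov_deriv r b (cov_deriv s a F) z)) vs)"
      unfolding exp by (intro sum.cong refl)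
        (simp add: cov_wedge_anticommute[of "m _"] cov_deriv_commute[OF assms, of s _ r])
    also have "\<dots> = - local_d r k (local_d s m F) z vs"
      unfolding exp by (subst sum.swap) (simp add: sum_negf)
    finally show "local_d s m (local_d r k F) z vs = - local_d r k (local_d s m F) z vs" .
  qed
qed

lemma local_d_squared:
  assumes "open S" "z \<in> S" "smooth_family S F"
  shows "local_d s m (local_d s m F) z = (\<lambda>vs. 0)"
proof
  fix vs show "local_d s m (local_d s m F) z vs = 0"
    using fun_cong[OF local_d_anticommute[OF assms, of s m s m], of vs] by simp
qed

section \<open>Contraction with a volume form\<close>

definition all_indices :: "'n::finite list" where
  "all_indices = (SOME as. distinct as \<and> set as = UNIV)"

lemma all_indices: "distinct (all_indices :: 'n::finite list)" "set (all_indices :: 'n list) = UNIV"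
  and length_all_indices: "length (all_indices :: 'n list) = CARD('n)"
proof -
  have "\<exists>as :: 'n list. distinct as \<and> set as = UNIV"
    using finite_distinct_list[OF finite[of "UNIV :: 'n set"]] by blast
  then have "distinct (all_indices :: 'n list) \<and> set (all_indices :: 'n list) = UNIV"
    unfolding all_indices_def by (rule someI_ex)
  then show "distinct (all_indices :: 'n list)" "set (all_indices :: 'n list) = UNIV" by auto
  then show "length (all_indices :: 'n list) = CARD('n)"
    by (metis distinct_card)
qed

text \<open>The coefficient of \<open>dz\<^sub>1 \<and> \<dots> \<and> dz\<^sub>n\<close> in a covector of type \<open>(n, 0)\<close>, the coordinates being ordered as in
\<open>all_indices\<close>.\<close>

definition top_coeff :: "('n::finite covector) \<Rightarrow> complex" where
  "top_coeff \<eta> = strip all_indices \<eta> []"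

text \<open>The inverse of the contraction with \<open>u\<close>, up to sign. If \<open>\<alpha>\<close> is the contraction of \<open>\<theta>\<close> with \<open>u\<close>, then \<open>dz a \<and> \<alpha>\<close> is
\<open>- \<theta>\<^sup>a \<and> u\<close>; removing the volume form leaves \<open>\<theta>\<^sup>a\<close> with the sign \<open>(- 1) ^ Suc n\<close>.\<close>

definition vector_component :: "('n::finite covector) \<Rightarrow> ('n covector)
    \<Rightarrow> 'n \<Rightarrow> 'n covector" where
  "vector_component u \<alpha> a = (\<lambda>vs. inverse (top_coeff u) * strip all_indices (cov_wedge (dz a) \<alpha>) vs)"

definition vcontract :: "('n::finite \<Rightarrow> complex^'n \<Rightarrow> complex) \<Rightarrow> ('n covector)
    \<Rightarrow> 'n covector" where
  "vcontract l \<eta> = (\<lambda>vs. \<Sum>a\<in>UNIV. cov_wedge (l a) (interior_dz a \<eta>) vs)"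

lemma wedges_strip_top:
  fixes \<zeta> :: "'n::finite covector"
  assumes "\<zeta> \<in> pq_covectors (int CARD('n)) q"
  shows "wedges (map dz all_indices) (strip all_indices \<zeta>) = \<zeta>"
  using wedges_strip[OF all_indices(1)] dz_wedge_top[OF assms] by blast

lemma strip_top:
  fixes u :: "'n::finite covector"
  assumes "u \<in> pq_covectors (int CARD('n)) 0"
  shows "strip all_indices u = (\<lambda>vs. top_coeff u * unit_covector vs)"
  unfolding top_coeff_def
  using strip_pq[OF assms, of all_indices] by (intro scalar_covector) (simp add: length_all_indices)

lemma dz_wedge_interior_top:
  fixes u :: "'n::finite covector"
  assumes "u \<in> pq_covectors (int CARD('n)) q"
  shows "cov_wedge (dz a) (interior_dz b u) = (\<lambda>vs. if a = b then u vs else 0)"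
proof -
  have "interior_dz b (cov_wedge (dz a) u) = (\<lambda>vs. 0)"
    by (simp add: dz_wedge_top[OF assms])
  then show ?thesis by (auto simp: interior_dz_wedge dz_part_dz fun_eq_iff)
qed

text \<open>Moving \<open>dz a\<close> past \<open>l b\<close> costs a sign, and by top degree \<open>dz a\<close> times the interior product of \<open>u\<close> with
\<open>\<partial>/\<partial>z\<^sub>b\<close> is \<open>u\<close> for \<open>a = b\<close> and zero otherwise.\<close>

lemma dz_wedge_vcontract:
  fixes u :: "'n::finite covector"
  assumes "u \<in> pq_covectors (int CARD('n)) q"
  shows "cov_wedge (dz a) (vcontract l u) = (\<lambda>vs. - cov_wedge (l a) u vs)"
proof
  fix vs
  have "cov_wedge (dz a) (vcontract l u) vs
     = (\<Sum>b\<in>UNIV. - cov_wedge (l b) (\<lambda>vs. if a = b then u vs else 0) vs)"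
    by (simp add: vcontract_def cov_wedge_sum cov_wedge_anticommute[of "dz a"] dz_wedge_interior_top[OF assms])
  also have "\<dots> = (\<Sum>b\<in>UNIV. if b = a then - cov_wedge (l b) u vs else 0)"
    by (intro sum.cong) auto
  finally show "cov_wedge (dz a) (vcontract l u) vs = - cov_wedge (l a) u vs" by simp
qed

context
  fixes u :: "'n::finite covector"
  assumes u: "u \<in> pq_covectors (int CARD('n)) 0" and u_nz: "u \<noteq> (\<lambda>vs. 0)"
begin

lemma top_coeff_nonzero: "top_coeff u \<noteq> 0"
proof
  assume "top_coeff u = 0"
  then have "strip all_indices u = (\<lambda>vs. 0)" using strip_top[OF u] by simp
  then show False using wedges_strip_top[OF u] u_nz by simp
qed

lemma strip_wedge_top:
  assumes "\<And>a. dz_part a l = 0"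
  shows "strip all_indices (cov_wedge l u) = (\<lambda>vs. (- 1) ^ CARD('n) * top_coeff u * cov_wedge l unit_covector vs)"
  by (simp add: strip_wedge[OF assms] strip_top[OF u] cov_wedge_scale length_all_indices mult.assoc)

lemma strip_wedge_wedge_top:
  assumes "\<And>a. dz_part a l = 0" "\<And>a. dz_part a m = 0"
  shows "strip all_indices (cov_wedge l (cov_wedge m u)) = (\<lambda>vs. top_coeff u * cov_wedge l (cov_wedge m unit_covector) vs)"
  by (simp add: strip_wedge[OF assms(1)] strip_wedge[OF assms(2)] strip_top[OF u] cov_wedge_scale
      length_all_indices mult.assoc[symmetric] power_add[symmetric] mult_2[symmetric])

text \<open>A covector of type \<open>(n, 1)\<close> is a multiple of its stripped part times \<open>u\<close>, since the covectors of type
\<open>(n, 0)\<close> form a line.\<close>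

lemma wedge_top_eq:
  assumes "\<zeta> \<in> pq_covectors (int CARD('n)) 1"
  shows "cov_wedge (\<lambda>v. strip all_indices \<zeta> [v]) u = (\<lambda>vs. (- 1) ^ CARD('n) * top_coeff u * \<zeta> vs)"
proof -
  let ?l = "\<lambda>v. strip all_indices \<zeta> [v]"
  have mem: "strip all_indices \<zeta> \<in> pq_covectors 0 1"
    using strip_pq[OF assms, of all_indices] by (simp add: length_all_indices)
  have "u = wedges (map dz all_indices) (\<lambda>vs. top_coeff u * unit_covector vs)"
    using wedges_strip_top[OF u] strip_top[OF u] by simp
  then have "u = (\<lambda>vs. top_coeff u * wedges (map dz all_indices) unit_covector vs)"
    by (simp only: wedges_scale)
  then have "cov_wedge ?l u = (\<lambda>vs. top_coeff u * cov_wedge ?l (wedges (map dz all_indices) unit_covector) vs)"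
    by (metis cov_wedge_scale)
  also have "\<dots> = (\<lambda>vs. top_coeff u * ((- 1) ^ CARD('n) * wedges (map dz all_indices) (cov_wedge ?l unit_covector) vs))"
    by (subst cov_wedge_wedges) (simp add: length_all_indices)
  also have "\<dots> = (\<lambda>vs. top_coeff u * ((- 1) ^ CARD('n) * \<zeta> vs))"
    by (simp only: covector_01(1)[OF mem, symmetric] wedges_strip_top[OF assms])
  finally show ?thesis by (simp add: mult_ac)
qed

text \<open>With \<open>\<theta>\<^sup>a\<close> the components of \<open>\<alpha>\<close>, the product \<open>\<theta>\<^sup>a \<and> u\<close> is \<open>dz a \<and> \<alpha>\<close> up to sign. Applying the interior
product with \<open>\<partial>/\<partial>z\<^sub>a\<close> and summing over \<open>a\<close> gives the contraction on the left and, by Euler's identity, \<open>\<alpha>\<close> on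
the right.\<close>

lemma vcontract_vector_component:
  assumes "\<alpha> \<in> pq_covectors (int CARD('n) - 1) 1"
  shows "vcontract (\<lambda>a v. vector_component u \<alpha> a [v]) u = (\<lambda>vs. (- 1) ^ Suc CARD('n) * \<alpha> vs)"
proof
  fix vs
  have mem: "cov_wedge (dz a) \<alpha> \<in> pq_covectors (int CARD('n)) 1" for a
    using dz_wedge_pq[OF assms] by simp
  have V: "cov_wedge (\<lambda>v. vector_component u \<alpha> a [v]) u = (\<lambda>vs. (- 1) ^ CARD('n) * cov_wedge (dz a) \<alpha> vs)" for a
    unfolding vector_component_def cov_wedge_left_scale wedge_top_eq[OF mem]
    using top_coeff_nonzero by (simp add: field_simps)
  have "strip all_indices (cov_wedge (dz a) \<alpha>) \<in> pq_covectors 0 1" for a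
    using strip_pq[OF mem, of all_indices] by (simp add: length_all_indices)
  then have "vector_component u \<alpha> a \<in> pq_covectors 0 1" for a
    unfolding vector_component_def by (intro pq_covectors_scale)
  then have dp: "dz_part b (\<lambda>v. vector_component u \<alpha> a [v]) = 0" for a b
    by (intro antilinear_dz_part covector_01(2))
  have "vcontract (\<lambda>a v. vector_component u \<alpha> a [v]) u vs
     = - (\<Sum>a\<in>UNIV. interior_dz a (cov_wedge (\<lambda>v. vector_component u \<alpha> a [v]) u) vs)"
    by (simp add: vcontract_def interior_dz_wedge dp sum_negf)
  also have "\<dots> = (- 1) ^ Suc CARD('n) * (\<Sum>a\<in>UNIV. interior_dz a (cov_wedge (dz a) \<alpha>) vs)"
    by (simp add: V interior_dz_scale sum_distrib_left sum_negf)
  finally show "vcontract (\<lambda>a v. vector_component u \<alpha> a [v]) u vs = (- 1) ^ Suc CARD('n) * \<alpha> vs"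
    by (simp add: sum_interior_wedge[OF assms])
qed

lemma vector_component_vcontract:
  assumes "\<And>a b. dz_part b (l a) = 0"
  shows "vector_component u (vcontract l u) a = (\<lambda>vs. (- 1) ^ Suc CARD('n) * cov_wedge (l a) unit_covector vs)"
  using top_coeff_nonzero
  by (simp add: vector_component_def dz_wedge_vcontract[OF u] strip_minus strip_wedge_top assms field_simps)

lemma vector_component_injective:
  assumes "\<alpha> \<in> pq_covectors (int CARD('n) - 1) q" "\<And>a. vector_component u \<alpha> a = (\<lambda>vs. 0)"
  shows "\<alpha> = (\<lambda>vs. 0)"
proof
  fix vs
  have mem: "cov_wedge (dz a) \<alpha> \<in> pq_covectors (int CARD('n)) q" for a
    using dz_wedge_pq[OF assms(1)] by simp
  have "strip all_indices (cov_wedge (dz a) \<alpha>) = (\<lambda>vs. 0)" for a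
    using assms(2)[of a] top_coeff_nonzero by (simp add: vector_component_def fun_eq_iff)
  then have "cov_wedge (dz a) \<alpha> = (\<lambda>vs. 0)" for a
    using wedges_strip_top[OF mem[of a]] by simp
  then show "\<alpha> vs = 0"
    using sum_interior_wedge[OF assms(1), of vs] by simp
qed

end

lemma vector_component_pq:
  fixes u :: "'n::finite covector"
  assumes "\<alpha> \<in> pq_covectors (int CARD('n) - 1) q"
  shows "vector_component u \<alpha> a \<in> pq_covectors 0 q"
proof -
  have "cov_wedge (dz a) \<alpha> \<in> pq_covectors (int CARD('n)) q"
    using dz_wedge_pq[OF assms] by simp
  from strip_pq[OF this, of all_indices] show ?thesis
    unfolding vector_component_def by (intro pq_covectors_scale) (simp add: length_all_indices)
qed

lemma vector_component_add: "vector_component u (\<lambda>vs. \<alpha> vs + \<beta> vs) a = (\<lambda>vs. vector_component u \<alpha> a vs + vector_component u \<beta> a vs)"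
  by (simp add: vector_component_def cov_wedge_add strip_add algebra_simps)

lemma vector_component_scale: "vector_component u (\<lambda>vs. c * \<alpha> vs) a = (\<lambda>vs. c * vector_component u \<alpha> a vs)"
  by (simp add: vector_component_def cov_wedge_scale strip_scale algebra_simps)

lemma diff_family_strip: "diff_family F z \<Longrightarrow> diff_family (\<lambda>w. strip as (F w)) z"
  by (induction as arbitrary: F) (simp_all add: diff_family_interior)

lemma dz_part_add: "dz_part a (\<lambda>v. l v + m v) = dz_part a l + dz_part a m"
  by (simp add: dz_part_def field_simps)

lemma dz_part_scale: "dz_part a (\<lambda>v. c * l v) = c * dz_part a l"
  by (simp add: dz_part_def algebra_simps)

section \<open>The Tian-Todorov identity in a chart\<close>

text \<open>The Leibniz rule for \<open>\<partial>\<close> of a contraction. The factor \<open>dz a\<close> from \<open>\<partial>\<close> is moved past \<open>p b\<close> and past the interior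
product with \<open>\<partial>/\<partial>z\<^sub>b\<close>; the terms with \<open>a = b\<close> that this leaves behind form the first sum.\<close>

lemma local_del_vcontract:
  assumes p: "\<And>a. diff_family (p a) z" and \<eta>: "diff_family \<eta> z"
  shows "local_del (\<lambda>w. vcontract (\<lambda>a. p a w) (\<eta> w)) z vs =
    - (\<Sum>a\<in>UNIV. cov_wedge (cov_deriv (- \<i>) a (p a) z) (\<eta> z) vs + cov_wedge (p a z) (cov_deriv (- \<i>) a \<eta> z) vs)
    + (\<Sum>a\<in>UNIV. \<Sum>b\<in>UNIV. cov_wedge (cov_deriv (- \<i>) a (p b) z) (interior_dz b (cov_wedge (dz a) (\<eta> z))) vs)
    + vcontract (\<lambda>a. p a z) (local_del \<eta> z) vs"
proof -
  let ?D = "cov_deriv (- \<i>)"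
  have "?D a (\<lambda>w. vcontract (\<lambda>a. p a w) (\<eta> w)) z
     = (\<lambda>vs. \<Sum>b\<in>UNIV. ?D a (\<lambda>w. cov_wedge (p b w) (interior_dz b (\<eta> w))) z vs)" for a
    unfolding vcontract_def by (intro cov_deriv_sum diff_family_wedge p diff_family_interior \<eta>)
  then have D: "?D a (\<lambda>w. vcontract (\<lambda>a. p a w) (\<eta> w)) z
     = (\<lambda>vs. \<Sum>b\<in>UNIV. cov_wedge (?D a (p b) z) (interior_dz b (\<eta> z)) vs
          + cov_wedge (p b z) (interior_dz b (?D a \<eta> z)) vs)" for a
    by (simp add: cov_deriv_wedge[OF p diff_family_interior[OF \<eta>]] cov_deriv_interior[OF \<eta>])
  have swap: "cov_wedge (dz a) (cov_wedge l (interior_dz b \<zeta>)) vs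
     = - (if a = b then cov_wedge l \<zeta> vs else 0) + cov_wedge l (interior_dz b (cov_wedge (dz a) \<zeta>)) vs"
    for a b l and \<zeta> :: "'a covector"
    by (auto simp: cov_wedge_anticommute[of "dz a"] interior_dz_wedge dz_part_dz cov_wedge_diff)
  have "local_del (\<lambda>w. vcontract (\<lambda>a. p a w) (\<eta> w)) z vs
     = (\<Sum>a\<in>UNIV. \<Sum>b\<in>UNIV. cov_wedge (dz a) (cov_wedge (?D a (p b) z) (interior_dz b (\<eta> z))) vs
          + cov_wedge (dz a) (cov_wedge (p b z) (interior_dz b (?D a \<eta> z))) vs)"
    by (simp add: local_d_def D cov_wedge_sum cov_wedge_add)
  also have "\<dots> = (\<Sum>a\<in>UNIV. \<Sum>b\<in>UNIV.
        - (if b = a then cov_wedge (?D a (p b) z) (\<eta> z) vs + cov_wedge (p b z) (?D a \<eta> z) vs else 0)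
        + (cov_wedge (?D a (p b) z) (interior_dz b (cov_wedge (dz a) (\<eta> z))) vs
        + cov_wedge (p b z) (interior_dz b (cov_wedge (dz a) (?D a \<eta> z))) vs))"
    unfolding swap by (intro sum.cong refl) auto
  also have "\<dots> = - (\<Sum>a\<in>UNIV. cov_wedge (?D a (p a) z) (\<eta> z) vs + cov_wedge (p a z) (?D a \<eta> z) vs)
    + (\<Sum>a\<in>UNIV. \<Sum>b\<in>UNIV. cov_wedge (?D a (p b) z) (interior_dz b (cov_wedge (dz a) (\<eta> z))) vs)
    + (\<Sum>a\<in>UNIV. \<Sum>b\<in>UNIV. cov_wedge (p b z) (interior_dz b (cov_wedge (dz a) (?D a \<eta> z))) vs)"
    by (simp only: sum.distrib sum_negf sum.delta finite_UNIV if_True UNIV_I finite add.assoc)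
  also have "(\<Sum>a\<in>UNIV. \<Sum>b\<in>UNIV. cov_wedge (p b z) (interior_dz b (cov_wedge (dz a) (?D a \<eta> z))) vs)
     = vcontract (\<lambda>a. p a z) (local_del \<eta> z) vs"
    by (subst sum.swap) (simp add: vcontract_def local_d_def interior_dz_sum cov_wedge_sum)
  finally show ?thesis .
qed

text \<open>A nowhere vanishing holomorphic \<open>(n, 0)\<close>-form on an open subset of \<open>\<complex>\<^sup>n\<close>.\<close>

locale local_volume =
  fixes S :: "(complex^'n::finite) set" and u :: "complex^'n \<Rightarrow> 'n covector"
  assumes open_S: "open S"
    and u_top: "w \<in> S \<Longrightarrow> u w \<in> pq_covectors (int CARD('n)) 0"
    and u_smooth: "smooth_family S u"
    and u_nonzero: "w \<in> S \<Longrightarrow> u w \<noteq> (\<lambda>vs. 0)"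
    and u_hol: "w \<in> S \<Longrightarrow> local_delbar u w = (\<lambda>vs. 0)"
begin

abbreviation h where "h w \<equiv> top_coeff (u w)"

lemma h_smooth: "smooth_on S h"
  using smooth_family_strip[OF open_S u_smooth, of all_indices]
  by (simp add: smooth_family_def top_coeff_def)

lemma h_nonzero: "w \<in> S \<Longrightarrow> h w \<noteq> 0"
  by (rule top_coeff_nonzero[OF u_top u_nonzero])

lemma u_diff: "w \<in> S \<Longrightarrow> diff_family u w"
  by (rule smooth_diff_family[OF u_smooth])

lemma cov_deriv_u_pq: "w \<in> S \<Longrightarrow> cov_deriv s a u w \<in> pq_covectors (int CARD('n)) 0"
  by (rule cov_deriv_pq[OF open_S _ u_top u_diff])

lemma strip_deriv_u:
  assumes "w \<in> S"
  shows "strip all_indices (cov_deriv s a u w) = (\<lambda>vs. wirt s a h w * unit_covector vs)"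
proof -
  have "top_coeff (cov_deriv s a u w) = wirt s a h w"
    unfolding top_coeff_def cov_deriv_strip[OF u_diff[OF assms], symmetric] by (simp add: cov_deriv_def)
  then show ?thesis
    using strip_top[OF cov_deriv_u_pq[OF assms]] by simp
qed

text \<open>Removing the volume form from \<open>\<partial>-bar u = 0\<close> leaves the Cauchy-Riemann equations for the coefficient.\<close>

lemma wirt_h_bar:
  assumes "w \<in> S"
  shows "wirt \<i> a h w = 0"
proof -
  have "0 = strip all_indices (local_delbar u w) [axis a 1]"
    using u_hol[OF assms] by simp
  also have "\<dots> = (\<Sum>b\<in>UNIV. strip all_indices (cov_wedge (dzbar b) (cov_deriv \<i> b u w)) [axis a 1])"
    by (simp add: local_d_def strip_sum)
  also have "\<dots> = (\<Sum>b\<in>UNIV. (- 1) ^ CARD('n) * (wirt \<i> b h w * dzbar b (axis a 1)))"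
    by (simp add: strip_wedge length_all_indices strip_deriv_u[OF assms] cov_wedge_scale)
  also have "\<dots> = (\<Sum>b\<in>UNIV. (if b = a then 1 else 0) * ((- 1) ^ CARD('n) * wirt \<i> b h w))"
    by (intro sum.cong) (auto simp: dzbar_def axis_def)
  also have "\<dots> = (- 1) ^ CARD('n) * wirt \<i> a h w"
    by (rule sum_delta_times)
  finally show ?thesis by simp
qed

lemma cov_deriv_u:
  assumes "w \<in> S"
  shows "cov_deriv s a u w = (\<lambda>vs. (wirt s a h w / h w) * u w vs)"
proof -
  let ?M = "wedges (map dz (all_indices :: 'n list)) unit_covector"
  have "cov_deriv s a u w = (\<lambda>vs. wirt s a h w * ?M vs)"
    using wedges_strip_top[OF cov_deriv_u_pq[OF assms], of s a]
    unfolding strip_deriv_u[OF assms] wedges_scale by (rule sym)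
  moreover have "u w = (\<lambda>vs. h w * ?M vs)"
    using wedges_strip_top[OF u_top[OF assms]]
    unfolding strip_top[OF u_top[OF assms]] wedges_scale by (rule sym)
  then have "u w vs = h w * ?M vs" for vs by (rule fun_cong)
  ultimately show ?thesis
    using h_nonzero[OF assms] by (simp add: fun_eq_iff)
qed

lemma local_del_u:
  assumes "w \<in> S"
  shows "local_del u w = (\<lambda>vs. 0)"
  by (simp add: local_d_def dz_wedge_top[OF cov_deriv_u_pq[OF assms]])

lemma inverse_h_smooth: "smooth_on S (\<lambda>w. inverse (h w))"
  by (rule smooth_on_inverse[OF open_S h_smooth h_nonzero])

lemma wirt_inverse_h_bar:
  assumes "w \<in> S"
  shows "wirt \<i> a (\<lambda>w. inverse (h w)) w = 0"
proof -
  have "wirt \<i> a (\<lambda>w. inverse (h w) * h w) w = wirt \<i> a (\<lambda>w. 1) w"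
    by (rule wirt_cong_open[OF open_S assms]) (simp add: h_nonzero)
  then have "wirt \<i> a (\<lambda>w. inverse (h w)) w * h w = 0"
    using wirt_mult[OF smooth_on_differentiable[OF inverse_h_smooth assms] smooth_on_differentiable[OF h_smooth assms], of \<i> a]
      wirt_h_bar[OF assms] by simp
  then show ?thesis using h_nonzero[OF assms] by simp
qed

lemma smooth_vector_component:
  assumes "smooth_family S \<alpha>"
  shows "smooth_family S (\<lambda>w. vector_component (u w) (\<alpha> w) a)"
  using smooth_family_strip[OF open_S smooth_family_wedge[where l = "\<lambda>w. dz a", OF open_S smooth_family_const[OF open_S] assms], of all_indices]
  unfolding smooth_family_def vector_component_def
  by (intro allI smooth_on_mult[OF open_S inverse_h_smooth]) blast

text \<open>The coefficient \<open>h\<close> of \<open>u\<close> is holomorphic, so only \<open>\<alpha>\<close> is differentiated. The sign arises from moving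
\<open>dzbar b\<close> past \<open>dz a\<close> and the \<open>n\<close> interior products.\<close>

lemma local_delbar_vector_component:
  assumes "w \<in> S" "diff_family \<alpha> w"
  shows "local_delbar (\<lambda>w. vector_component (u w) (\<alpha> w) a) w = (\<lambda>vs. (- 1) ^ Suc CARD('n) * vector_component (u w) (local_delbar \<alpha> w) a vs)"
proof
  fix vs
  let ?W = "\<lambda>w. cov_wedge (dz a) (\<alpha> w)"
  have dW: "diff_family ?W w"
    by (rule diff_family_wedge[where l = "\<lambda>w. dz a", OF diff_family_const assms(2)])
  have dS: "diff_family (\<lambda>w. strip all_indices (?W w)) w"
    using dW by (rule diff_family_strip)
  have D: "cov_deriv \<i> b (\<lambda>w. vector_component (u w) (\<alpha> w) a) w
     = (\<lambda>vs. inverse (h w) * strip all_indices (cov_wedge (dz a) (cov_deriv \<i> b \<alpha> w)) vs)" for b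
    unfolding vector_component_def cov_deriv_mult[OF dS smooth_on_differentiable[OF inverse_h_smooth assms(1)]]
    by (simp add: wirt_inverse_h_bar[OF assms(1)] cov_deriv_strip[OF dW]
        cov_deriv_wedge[where l = "\<lambda>w. dz a", OF diff_family_const assms(2)])
  have sw: "cov_wedge (dzbar b) (strip all_indices (cov_wedge (dz a) \<eta>)) vs
      = (- 1) ^ Suc CARD('n) * strip all_indices (cov_wedge (dz a) (cov_wedge (dzbar b) \<eta>)) vs"
    for b :: 'n and \<eta> :: "'n covector"
    by (simp add: cov_wedge_anticommute[of "dz a"] strip_minus strip_wedge length_all_indices)
  show "local_delbar (\<lambda>w. vector_component (u w) (\<alpha> w) a) w vs = (- 1) ^ Suc CARD('n) * vector_component (u w) (local_delbar \<alpha> w) a vs"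
    unfolding local_d_def D
    by (simp add: vector_component_def cov_wedge_scale sw cov_wedge_sum strip_sum sum_distrib_left sum_negf mult_ac)
qed

lemma local_del_vcontract_top:
  assumes "z \<in> S" "\<And>a. diff_family (p a) z"
  shows "local_del (\<lambda>w. vcontract (\<lambda>a. p a w) (u w)) z =
    (\<lambda>vs. - cov_wedge (\<lambda>v. \<Sum>a\<in>UNIV. cov_deriv (- \<i>) a (p a) z v + wirt (- \<i>) a h z / h z * p a z v) (u z) vs)"
proof
  fix vs
  have zero: "vcontract l (\<lambda>vs. 0) = (\<lambda>vs. 0)" for l :: "'n \<Rightarrow> complex^'n \<Rightarrow> complex"
    by (simp add: vcontract_def)
  have "local_del (\<lambda>w. vcontract (\<lambda>a. p a w) (u w)) z vs
     = - (\<Sum>a\<in>UNIV. cov_wedge (cov_deriv (- \<i>) a (p a) z) (u z) vs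
          + wirt (- \<i>) a h z / h z * cov_wedge (p a z) (u z) vs)"
    unfolding local_del_vcontract[OF assms(2) u_diff[OF assms(1)]] dz_wedge_top[OF u_top[OF assms(1)]]
      local_del_u[OF assms(1)] cov_deriv_u[OF assms(1)] cov_wedge_scale zero by simp
  then show "local_del (\<lambda>w. vcontract (\<lambda>a. p a w) (u w)) z vs =
    - cov_wedge (\<lambda>v. \<Sum>a\<in>UNIV. cov_deriv (- \<i>) a (p a) z v + wirt (- \<i>) a h z / h z * p a z v) (u z) vs"
    by (simp only: cov_wedge_left_sum cov_wedge_left_add cov_wedge_left_scale)
qed

lemma dz_part_deriv:
  assumes "z \<in> S" "diff_family l z" "\<And>w. w \<in> S \<Longrightarrow> dz_part b (l w) = 0"
  shows "dz_part b (cov_deriv s a l z) = 0"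
proof -
  have d: "(\<lambda>w. l w v) differentiable at z" for v
    using assms(2) by (simp add: diff_family_def)
  have "0 = wirt s a (\<lambda>w. dz_part b (l w)) z"
    using wirt_cong_open[OF open_S assms(1), of "\<lambda>w. dz_part b (l w)" "\<lambda>w. 0" s a] assms(3) by simp
  also have "\<dots> = wirt s a (\<lambda>w. (1/2) * l w (axis b 1) + (- \<i>/2) * l w (axis b \<i>)) z"
    by (simp add: dz_part_def field_simps)
  also have "\<dots> = (1/2) * wirt s a (\<lambda>w. l w (axis b 1)) z + (- \<i>/2) * wirt s a (\<lambda>w. l w (axis b \<i>)) z"
    unfolding wirt_cmult[OF d, symmetric] by (intro wirt_add differentiable_mult differentiable_const d)
  also have "\<dots> = dz_part b (cov_deriv s a l z)"
    by (simp add: dz_part_def cov_deriv_def field_simps)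
  finally show ?thesis by simp
qed

text \<open>By \<open>local_del_vcontract_top\<close> the contraction of \<open>p\<close> with \<open>u\<close> is \<open>\<partial>\<close>-closed only if the divergence of \<open>p\<close> with respect
to the volume form \<open>u\<close>, a \<open>(0, 1)\<close>-covector, vanishes.\<close>

lemma divergence_zero:
  assumes "z \<in> S" "\<And>a. diff_family (p a) z" "\<And>a b w. w \<in> S \<Longrightarrow> dz_part b (p a w) = 0"
    and "local_del (\<lambda>w. vcontract (\<lambda>a. p a w) (u w)) z = (\<lambda>vs. 0)"
  shows "(\<lambda>v. \<Sum>a\<in>UNIV. cov_deriv (- \<i>) a (p a) z v + wirt (- \<i>) a h z / h z * p a z v) = (\<lambda>v. 0)"
    (is "?q = _")
proof
  fix v
  have "dz_part b ?q = (\<Sum>a\<in>UNIV. dz_part b (cov_deriv (- \<i>) a (p a) z) + wirt (- \<i>) a h z / h z * dz_part b (p a z))" for b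
    by (simp only: dz_part_sum[where c = "\<lambda>_. 1", unfolded mult_1_left] dz_part_add dz_part_scale)
  then have q: "dz_part b ?q = 0" for b
    using assms by (simp add: dz_part_deriv)
  have "cov_wedge ?q (u z) = (\<lambda>vs. 0)"
    using assms(4) local_del_vcontract_top[OF assms(1,2)] by (simp add: fun_eq_iff)
  then have "strip all_indices (cov_wedge ?q (u z)) [v] = 0" by simp
  then show "?q v = 0"
    using h_nonzero[OF assms(1)]
    unfolding strip_wedge_top[OF u_top[OF assms(1)] u_nonzero[OF assms(1)] q] wedge_unit_singleton
    by simp
qed

text \<open>Let \<open>\<eta>\<close> be the contraction of \<open>r\<close> with \<open>u\<close>. In the Leibniz rule for the contraction of \<open>p\<close> with \<open>\<eta>\<close> the term with \<open>\<partial>\<eta>\<close>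
vanishes by assumption. The derivative of \<open>\<eta>\<close> has a part in which \<open>u\<close> is differentiated; it is a multiple
of \<open>\<eta>\<close> and combines with the derivative of \<open>p\<close> to the divergence of \<open>p\<close>, which is zero. The remaining terms are
the two halves of the bracket, contracted with \<open>u\<close>.\<close>

theorem local_tian_todorov:
  assumes z: "z \<in> S"
    and p: "\<And>a. diff_family (p a) z" "\<And>a b w. w \<in> S \<Longrightarrow> dz_part b (p a w) = 0"
    and r: "\<And>a. diff_family (r a) z" "\<And>a b w. w \<in> S \<Longrightarrow> dz_part b (r a w) = 0"
    and p0: "local_del (\<lambda>w. vcontract (\<lambda>a. p a w) (u w)) z = (\<lambda>vs. 0)"
    and r0: "local_del (\<lambda>w. vcontract (\<lambda>a. r a w) (u w)) z = (\<lambda>vs. 0)"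
  shows "vector_component (u z) (local_del (\<lambda>w. vcontract (\<lambda>a. p a w) (vcontract (\<lambda>a. r a w) (u w))) z) c =
    (\<lambda>vs. - (\<Sum>a\<in>UNIV. cov_wedge (p a z) (cov_wedge (cov_deriv (- \<i>) a (r c) z) unit_covector) vs
        + cov_wedge (r a z) (cov_wedge (cov_deriv (- \<i>) a (p c) z) unit_covector) vs))"
proof -
  let ?D = "cov_deriv (- \<i>)"
  let ?\<eta> = "\<lambda>w. vcontract (\<lambda>a. r a w) (u w)"
  define g where "g a = wirt (- \<i>) a h z / h z" for a
  have Du: "?D a u z = (\<lambda>vs. g a * u z vs)" for a
    unfolding g_def by (rule cov_deriv_u[OF z])
  note uz = u_top[OF z]
  have d\<eta>: "diff_family ?\<eta> z"
    unfolding vcontract_def by (intro diff_family_sum diff_family_wedge r diff_family_interior u_diff z)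
  have D\<eta>: "?D a ?\<eta> z = (\<lambda>vs. (\<Sum>b\<in>UNIV. cov_wedge (?D a (r b) z) (interior_dz b (u z)) vs) + g a * ?\<eta> z vs)" for a
  proof -
    have "?D a ?\<eta> z = (\<lambda>vs. \<Sum>b\<in>UNIV. ?D a (\<lambda>w. cov_wedge (r b w) (interior_dz b (u w))) z vs)"
      unfolding vcontract_def by (intro cov_deriv_sum diff_family_wedge r diff_family_interior u_diff z)
    then show ?thesis
      by (simp add: cov_deriv_wedge[OF r(1) diff_family_interior[OF u_diff[OF z]]] cov_deriv_interior[OF u_diff[OF z]]
          Du interior_dz_scale cov_wedge_scale sum.distrib vcontract_def sum_distrib_left)
  qed
  have third: "cov_wedge (?D a (p b) z) (interior_dz b (cov_wedge (dz a) (?\<eta> z))) vs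
     = - cov_wedge (r a z) (cov_wedge (?D a (p b) z) (interior_dz b (u z))) vs" for a b vs
    by (simp add: dz_wedge_vcontract[OF uz] interior_dz_minus interior_dz_wedge r(2)[OF z] cov_wedge_anticommute[of "?D a (p b) z"])
  \<comment> \<open>Derivatives of \<open>p a\<close> and of \<open>u\<close> combine to the divergence of \<open>p\<close>.\<close>
  have q: "(\<Sum>a\<in>UNIV. cov_wedge (?D a (p a) z) (?\<eta> z) vs + g a * cov_wedge (p a z) (?\<eta> z) vs) = 0" for vs
  proof -
    have "cov_wedge (\<lambda>v. \<Sum>a\<in>UNIV. ?D a (p a) z v + g a * p a z v) (?\<eta> z) vs = 0"
      by (simp only: g_def divergence_zero[OF z p p0] cov_wedge_left_zero)
    then show ?thesis
      by (simp only: cov_wedge_left_sum cov_wedge_left_add cov_wedge_left_scale)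
  qed
  let ?B = "\<lambda>b vs. \<Sum>a\<in>UNIV. cov_wedge (p a z) (cov_wedge (?D a (r b) z) (interior_dz b (u z))) vs
      + cov_wedge (r a z) (cov_wedge (?D a (p b) z) (interior_dz b (u z))) vs"
  have main: "local_del (\<lambda>w. vcontract (\<lambda>a. p a w) (?\<eta> w)) z = (\<lambda>vs. - (\<Sum>b\<in>UNIV. ?B b vs))"
  proof
    fix vs
    have "(\<Sum>a\<in>UNIV. cov_wedge (?D a (p a) z) (?\<eta> z) vs + cov_wedge (p a z) (?D a ?\<eta> z) vs)
       = (\<Sum>a\<in>UNIV. cov_wedge (?D a (p a) z) (?\<eta> z) vs + g a * cov_wedge (p a z) (?\<eta> z) vs)
       + (\<Sum>a\<in>UNIV. \<Sum>b\<in>UNIV. cov_wedge (p a z) (cov_wedge (?D a (r b) z) (interior_dz b (u z))) vs)"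
      unfolding D\<eta> by (simp add: cov_wedge_add cov_wedge_sum cov_wedge_scale sum.distrib)
    then have "local_del (\<lambda>w. vcontract (\<lambda>a. p a w) (?\<eta> w)) z vs
       = - (\<Sum>a\<in>UNIV. \<Sum>b\<in>UNIV. cov_wedge (p a z) (cov_wedge (?D a (r b) z) (interior_dz b (u z))) vs)
         - (\<Sum>a\<in>UNIV. \<Sum>b\<in>UNIV. cov_wedge (r a z) (cov_wedge (?D a (p b) z) (interior_dz b (u z))) vs)"
      unfolding local_del_vcontract[OF p(1) d\<eta>] third r0 q by (simp add: vcontract_def sum_negf)
    moreover have "(\<Sum>b\<in>UNIV. ?B b vs)
       = (\<Sum>a\<in>UNIV. \<Sum>b\<in>UNIV. cov_wedge (p a z) (cov_wedge (?D a (r b) z) (interior_dz b (u z))) vs)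
         + (\<Sum>a\<in>UNIV. \<Sum>b\<in>UNIV. cov_wedge (r a z) (cov_wedge (?D a (p b) z) (interior_dz b (u z))) vs)"
      by (subst sum.swap) (simp only: sum.distrib)
    ultimately show "local_del (\<lambda>w. vcontract (\<lambda>a. p a w) (?\<eta> w)) z vs = - (\<Sum>b\<in>UNIV. ?B b vs)"
      by simp
  qed
  have dzw: "cov_wedge (dz c) (cov_wedge l (cov_wedge m (interior_dz b (u z)))) vs
     = (if b = c then cov_wedge l (cov_wedge m (u z)) vs else 0)" for l m b vs
    by (simp add: cov_wedge_anticommute[of "dz c"] cov_wedge_minus dz_wedge_interior_top[OF uz])
  have dzB: "cov_wedge (dz c) (local_del (\<lambda>w. vcontract (\<lambda>a. p a w) (?\<eta> w)) z)
     = (\<lambda>vs. - (\<Sum>a\<in>UNIV. cov_wedge (p a z) (cov_wedge (?D a (r c) z) (u z)) vs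
        + cov_wedge (r a z) (cov_wedge (?D a (p c) z) (u z)) vs))"
  proof
    fix vs
    have "cov_wedge (dz c) (local_del (\<lambda>w. vcontract (\<lambda>a. p a w) (?\<eta> w)) z) vs
       = - (\<Sum>b\<in>UNIV. \<Sum>a\<in>UNIV. cov_wedge (dz c) (cov_wedge (p a z) (cov_wedge (?D a (r b) z) (interior_dz b (u z)))) vs
      + cov_wedge (dz c) (cov_wedge (r a z) (cov_wedge (?D a (p b) z) (interior_dz b (u z)))) vs)"
      unfolding main by (simp add: cov_wedge_minus cov_wedge_sum cov_wedge_add)
    also have "\<dots> = - (\<Sum>b\<in>UNIV. if b = c then (\<Sum>a\<in>UNIV. cov_wedge (p a z) (cov_wedge (?D a (r b) z) (u z)) vs
        + cov_wedge (r a z) (cov_wedge (?D a (p b) z) (u z)) vs) else 0)"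
      unfolding dzw by (intro arg_cong[of _ _ uminus] sum.cong refl) auto
    finally show "cov_wedge (dz c) (local_del (\<lambda>w. vcontract (\<lambda>a. p a w) (?\<eta> w)) z) vs
       = - (\<Sum>a\<in>UNIV. cov_wedge (p a z) (cov_wedge (?D a (r c) z) (u z)) vs
        + cov_wedge (r a z) (cov_wedge (?D a (p c) z) (u z)) vs)" by simp
  qed
  have dp: "dz_part b (?D a (p c) z) = 0" "dz_part b (?D a (r c) z) = 0" for a b
    using dz_part_deriv[OF z p(1) p(2)] dz_part_deriv[OF z r(1) r(2)] by auto
  show ?thesis
    unfolding vector_component_def dzB
    using h_nonzero[OF z]
    by (simp add: strip_minus strip_sum strip_add p(2)[OF z] r(2)[OF z] dp
        strip_wedge_wedge_top[OF uz u_nonzero[OF z]] distrib_left[symmetric] sum_distrib_left[symmetric]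
        mult.assoc[symmetric])
qed

end

section \<open>Pullback along complex linear maps\<close>

definition pullback :: "('v \<Rightarrow> 'w) \<Rightarrow> ('w list \<Rightarrow> complex) \<Rightarrow> 'v list \<Rightarrow> complex" where
  "pullback L \<eta> vs = \<eta> (map L vs)"

lemma pullback_wedge: "pullback L (cov_wedge l \<eta>) = cov_wedge (\<lambda>v. l (L v)) (pullback L \<eta>)"
  by (simp add: fun_eq_iff pullback_def cov_wedge_def take_map drop_map)

lemma pullback_unit [simp]: "pullback L unit_covector = unit_covector"
  by (simp add: fun_eq_iff pullback_def unit_covector_def)

lemma pullback_add: "pullback L (\<lambda>ws. \<eta> ws + \<zeta> ws) = (\<lambda>vs. pullback L \<eta> vs + pullback L \<zeta> vs)"
  by (simp add: fun_eq_iff pullback_def)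

lemma pullback_scale: "pullback L (\<lambda>ws. c * \<eta> ws) = (\<lambda>vs. c * pullback L \<eta> vs)"
  by (simp add: fun_eq_iff pullback_def)

lemma pullback_sum: "pullback L (\<lambda>ws. \<Sum>i\<in>I. \<eta> i ws) = (\<lambda>vs. \<Sum>i\<in>I. pullback L (\<eta> i) vs)"
  by (simp add: fun_eq_iff pullback_def)

lemma pullback_zero [simp]: "pullback L (\<lambda>ws. 0) = (\<lambda>vs. 0)"
  by (simp add: fun_eq_iff pullback_def)

lemma pullback_wedges: "pullback L (wedges ls \<eta>) = wedges (map (\<lambda>l v. l (L v)) ls) (pullback L \<eta>)"
  by (induction ls) (simp_all add: pullback_wedge)

definition clinear_map :: "(complex^'n::finite \<Rightarrow> complex^'m::finite) \<Rightarrow> bool" where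
  "clinear_map L \<longleftrightarrow> (\<forall>v w. L (v + w) = L v + L w) \<and> (\<forall>k v. L (k *s v) = k *s L v)"

lemma axis_scale: "axis a (k :: complex) = k *s (axis a 1 :: complex^'n::finite)"
  by (simp add: vec_eq_iff axis_def)

lemma clinear_map_sum: "clinear_map L \<Longrightarrow> L (\<Sum>i\<in>I. f i) = (\<Sum>i\<in>I. L (f i))"
proof (induction I rule: infinite_finite_induct)
  case (infinite I)
  have "L (0 *s 0) = 0 *s L 0" using infinite(2) unfolding clinear_map_def by blast
  then show ?case using infinite(1) by simp
next
  case empty
  have "L (0 *s 0) = 0 *s L 0" using empty unfolding clinear_map_def by blast
  then show ?case by simp
qed (simp add: clinear_map_def)

lemma clinear_map_component:
  assumes "clinear_map L"
  shows "L v $ a = (\<Sum>b\<in>UNIV. L (axis b 1) $ a * dz b v)"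
proof -
  have "L v = L (\<Sum>b\<in>UNIV. v $ b *s axis b 1)"
    by (subst vec_eq_sum_axis[of v]) (simp add: axis_scale[symmetric])
  also have "\<dots> = (\<Sum>b\<in>UNIV. v $ b *s L (axis b 1))"
    using assms by (simp add: clinear_map_sum clinear_map_def)
  finally show ?thesis by (simp add: dz_def mult.commute)
qed

lemma clinear_dz:
  "clinear_map L \<Longrightarrow> (\<lambda>v. dz a (L v)) = (\<lambda>v. \<Sum>b\<in>UNIV. L (axis b 1) $ a * dz b v)"
  by (rule ext, subst dz_def, rule clinear_map_component)

lemma clinear_dzbar:
  "clinear_map L \<Longrightarrow> (\<lambda>v. dzbar a (L v)) = (\<lambda>v. \<Sum>b\<in>UNIV. cnj (L (axis b 1) $ a) * dzbar b v)"
  by (rule ext, subst dzbar_def, subst clinear_map_component) (simp_all add: dz_def dzbar_def)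

lemma pullback_dzbar_wedges_pq:
  assumes "clinear_map L" "\<eta> \<in> pq_covectors p q"
  shows "wedges (map (\<lambda>b v. dzbar b (L v)) bs) \<eta> \<in> pq_covectors p (q + int (length bs))"
proof (induction bs)
  case (Cons b bs)
  have "antilinear_form (\<lambda>v. dzbar b (L v))"
    unfolding antilinear_form_def clinear_dzbar[OF assms(1)] by (rule exI) (rule refl)
  note * = antilinear_wedge_pq[OF this Cons.IH]
  have eq: "q + int (length (b # bs)) = q + int (length bs) + 1" by simp
  show ?case unfolding eq using * by simp
qed (use assms in simp)

lemma pullback_dz_wedges_pq:
  assumes "clinear_map L" "\<eta> \<in> pq_covectors p q"
  shows "wedges (map (\<lambda>a v. dz a (L v)) as) \<eta> \<in> pq_covectors (p + int (length as)) q"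
proof (induction as)
  case (Cons a as)
  have "cov_wedge (dz b) (wedges (map (\<lambda>a v. dz a (L v)) as) \<eta>) \<in> pq_covectors (p + int (length (a # as))) q" for b
  proof -
    have eq: "p + int (length (a # as)) = p + int (length as) + 1" by simp
    show ?thesis unfolding eq by (rule dz_wedge_pq[OF Cons.IH])
  qed
  then show ?case
    by (simp add: clinear_dz[OF assms(1)] cov_wedge_left_sum cov_wedge_left_scale pq_covectors_sum pq_covectors_scale)
qed (use assms in simp)

lemma unit_pq: "unit_covector \<in> pq_covectors 0 0"
  using pq_monomial_in[of "[]" 0 "[]" 0] by (simp add: pq_monomial_eq)

lemma pullback_pq_monomial:
  "pullback L (pq_monomial as bs)
    = wedges (map (\<lambda>a v. dz a (L v)) as) (wedges (map (\<lambda>b v. dzbar b (L v)) bs) unit_covector)"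
  by (simp add: pq_monomial_eq pullback_wedges comp_def)

lemma pullback_pq:
  assumes "clinear_map L" "\<eta> \<in> pq_covectors p q"
  shows "pullback L \<eta> \<in> pq_covectors p q"
  using assms(2)
proof (induction rule: pq_covectors_induct)
  case (monomial as bs)
  show ?case
    using pullback_dz_wedges_pq[OF assms(1) pullback_dzbar_wedges_pq[OF assms(1) unit_pq], of as bs] monomial
    by (simp add: pullback_pq_monomial)
qed (simp_all add: pullback_add pullback_scale pq_covectors_add pq_covectors_scale)

text \<open>For a complex linear \<open>L\<close> the image of \<open>\<partial>/\<partial>z\<^sub>b\<close> is the combination of the \<open>\<partial>/\<partial>z\<^sub>a\<close> with the coefficients \<open>L\<^sub>a\<^sub>b\<close>, without
conjugate vectors. The identity is checked on products of 1-covectors, where it is the antiderivation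
rule.\<close>

lemma pullback_interior:
  fixes L :: "complex^'n::finite \<Rightarrow> complex^'n"
  assumes L: "clinear_map L" and "\<eta> \<in> pq_covectors p q"
  shows "(\<Sum>a\<in>UNIV. L (axis b 1) $ a * pullback L (interior_dz a \<eta>) vs) = interior_dz b (pullback L \<eta>) vs"
  using assms(2)
proof (induction arbitrary: vs rule: pq_covectors_induct)
  case (monomial as bs)
  have "(\<Sum>a\<in>UNIV. L (axis b 1) $ a * pullback L (interior_dz a (wedges ls unit_covector)) vs)
      = interior_dz b (pullback L (wedges ls unit_covector)) vs"
    if "set ls \<subseteq> range dz \<union> range dzbar" for ls :: "(complex^'n \<Rightarrow> complex) list" and vs
    using that
  proof (induction ls arbitrary: vs)
    case Nil
    then show ?case by simp
  next
    case (Cons l ls)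
    let ?\<eta> = "wedges ls unit_covector :: 'n covector"
    have scal: "L (axis b \<i>) = \<i> *s L (axis b 1)"
      using L unfolding clinear_map_def axis_scale[of b \<i>] by blast
    have l: "dz_part b (\<lambda>v. l (L v)) = (\<Sum>a\<in>UNIV. L (axis b 1) $ a * dz_part a l)"
    proof -
      consider c where "l = dz c" | c where "l = dzbar c" using Cons.prems by auto
      then show ?thesis
      proof cases
        case (1 c)
        have "(\<Sum>a\<in>UNIV. L (axis b 1) $ a * dz_part a l) = L (axis b 1) $ c"
          using sum_delta_times(1)[of c "\<lambda>a. L (axis b 1) $ a"] by (simp add: 1 dz_part_dz mult.commute)
        then show ?thesis by (simp add: 1 dz_part_def[of b] dz_def scal)
      next
        case (2 c)
        then show ?thesis by (simp add: dz_part_def[of b] dzbar_def scal)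
      qed
    qed
    have "(\<Sum>a\<in>UNIV. L (axis b 1) $ a * pullback L (interior_dz a (wedges (l # ls) unit_covector)) vs)
       = (\<Sum>a\<in>UNIV. L (axis b 1) $ a * (dz_part a l * pullback L ?\<eta> vs)
            - cov_wedge (\<lambda>v. l (L v)) (\<lambda>vs. L (axis b 1) $ a * pullback L (interior_dz a ?\<eta>) vs) vs)"
    proof (intro sum.cong refl)
      fix a
      have "pullback L (interior_dz a (cov_wedge l ?\<eta>)) vs
        = dz_part a l * pullback L ?\<eta> vs - pullback L (cov_wedge l (interior_dz a ?\<eta>)) vs"
        by (simp add: interior_dz_wedge pullback_def)
      then show "L (axis b 1) $ a * pullback L (interior_dz a (wedges (l # ls) unit_covector)) vs
        = L (axis b 1) $ a * (dz_part a l * pullback L ?\<eta> vs)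
            - cov_wedge (\<lambda>v. l (L v)) (\<lambda>vs. L (axis b 1) $ a * pullback L (interior_dz a ?\<eta>) vs) vs"
        by (simp add: pullback_wedge cov_wedge_scale right_diff_distrib)
    qed
    also have "\<dots> = dz_part b (\<lambda>v. l (L v)) * pullback L ?\<eta> vs
        - cov_wedge (\<lambda>v. l (L v)) (\<lambda>vs. \<Sum>a\<in>UNIV. L (axis b 1) $ a * pullback L (interior_dz a ?\<eta>) vs) vs"
      by (simp only: sum_subtractf l sum_distrib_right mult.assoc cov_wedge_sum)
    also have "\<dots> = interior_dz b (pullback L (wedges (l # ls) unit_covector)) vs"
      using Cons by (simp add: pullback_wedge interior_dz_wedge)
    finally show ?case .
  qed
  moreover have "set (map dz as @ map dzbar bs) \<subseteq> range dz \<union> range dzbar" by auto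
  ultimately have "(\<Sum>a\<in>UNIV. L (axis b 1) $ a * pullback L (interior_dz a (wedges (map dz as @ map dzbar bs) unit_covector)) vs)
      = interior_dz b (pullback L (wedges (map dz as @ map dzbar bs) unit_covector)) vs" by blast
  then show ?case
    by (simp add: pq_monomial_eq)
next
  case (add \<eta> \<zeta>)
  then show ?case
    by (simp add: interior_dz_add pullback_add distrib_left sum.distrib)
next
  case (scale c \<eta>)
  have "(\<Sum>a\<in>UNIV. L (axis b 1) $ a * pullback L (interior_dz a (\<lambda>vs. c * \<eta> vs)) vs)
     = c * (\<Sum>a\<in>UNIV. L (axis b 1) $ a * pullback L (interior_dz a \<eta>) vs)"
    by (simp add: interior_dz_scale pullback_scale sum_distrib_left mult_ac)
  then show ?case by (simp add: scale interior_dz_scale pullback_scale)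
qed simp

lemma strip_wedges:
  assumes "distinct as" "\<And>a. interior_dz a \<beta> = (\<lambda>vs. 0)"
  shows "strip as (wedges (map dz as) \<beta>) = \<beta>"
  using assms(1)
proof (induction as)
  case (Cons a as)
  have "interior_dz a (wedges (map dz bs) \<beta>) = (\<lambda>vs. 0)" if "a \<notin> set bs" for bs
    using that by (induction bs) (simp_all add: interior_dz_wedge dz_part_dz assms(2))
  then have "interior_dz a (wedges (map dz (a # as)) \<beta>) = wedges (map dz as) \<beta>"
    using Cons.prems by (simp add: interior_dz_wedge dz_part_dz)
  then show ?case using Cons by simp
qed simp

lemma interior_dz_0q: "\<beta> \<in> pq_covectors 0 q \<Longrightarrow> interior_dz a \<beta> = (\<lambda>vs. 0)"
proof (induction rule: pq_covectors_induct)
  case (monomial as bs)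
  then show ?case by (simp add: pq_monomial_eq interior_dz_wedges_dzbar)
qed (simp_all add: interior_dz_add interior_dz_scale)

lemma top_wedge_vector_component:
  fixes u :: "'n::finite covector"
  assumes "top_coeff u \<noteq> 0" "\<alpha> \<in> pq_covectors (int CARD('n) - 1) q"
  shows "(\<lambda>vs. top_coeff u * wedges (map dz all_indices) (vector_component u \<alpha> a) vs) = cov_wedge (dz a) \<alpha>"
proof -
  have mem: "cov_wedge (dz a) \<alpha> \<in> pq_covectors (int CARD('n)) q"
    using dz_wedge_pq[OF assms(2)] by simp
  show ?thesis
    unfolding vector_component_def wedges_scale wedges_strip_top[OF mem] using assms(1) by (simp add: mult.assoc[symmetric])
qed

text \<open>The Jacobian determinant enters only through the assumption that \<open>L\<close> pulls \<open>u'\<close> back to \<open>u\<close>: a \<open>(0, q)\<close>-monomial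
can be moved in front of the product of the \<open>dz\<close>, and what remains is a multiple of \<open>u'\<close>.\<close>

lemma pullback_top_wedge:
  fixes u u' :: "'n::finite covector"
  assumes u: "u \<in> pq_covectors (int CARD('n)) 0" and u': "u' \<in> pq_covectors (int CARD('n)) 0"
    and L: "pullback L u' = u" and "\<beta> \<in> pq_covectors 0 q"
  shows "top_coeff u' * pullback L (wedges (map dz all_indices) \<beta>) vs
       = top_coeff u * wedges (map dz all_indices) (pullback L \<beta>) vs"
  using assms(4)
proof (induction arbitrary: vs rule: pq_covectors_induct)
  case (monomial as bs)
  let ?M = "wedges (map dz (all_indices :: 'n list))" and ?N = "wedges (map dzbar bs)"
    and ?NL = "wedges (map (\<lambda>b v. dzbar b (L v)) bs)"
  let ?s = "(- 1) ^ (CARD('n) * length bs) :: complex"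
  have top: "\<zeta> = (\<lambda>vs. top_coeff \<zeta> * ?M unit_covector vs)" if "\<zeta> \<in> pq_covectors (int CARD('n)) 0" for \<zeta>
    using wedges_strip_top[OF that] unfolding strip_top[OF that] wedges_scale by (rule sym)
  have eq: "(\<lambda>vs. top_coeff u' * pullback L (?M (?N unit_covector)) vs) = (\<lambda>vs. ?s * ?NL (pullback L u') vs)"
  proof -
    have "?M (?N unit_covector) = (\<lambda>vs. ?s * ?N (?M unit_covector) vs)"
      by (subst wedges_wedges) (simp add: length_all_indices)
    then have "pullback L (?M (?N unit_covector)) = (\<lambda>vs. ?s * ?NL (pullback L (?M unit_covector)) vs)"
      by (simp add: pullback_scale pullback_wedges comp_def)
    then have "(\<lambda>vs. top_coeff u' * pullback L (?M (?N unit_covector)) vs)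
       = (\<lambda>vs. ?s * (top_coeff u' * ?NL (pullback L (?M unit_covector)) vs))"
      by (simp add: mult_ac)
    also have "\<dots> = (\<lambda>vs. ?s * ?NL (pullback L (\<lambda>vs. top_coeff u' * ?M unit_covector vs)) vs)"
      by (simp add: pullback_scale wedges_scale)
    also have "(\<lambda>vs. top_coeff u' * ?M unit_covector vs) = u'"
      by (rule top[OF u', symmetric])
    finally show ?thesis .
  qed
  have "?NL u = (\<lambda>vs. top_coeff u * ?NL (?M unit_covector) vs)"
    by (subst top[OF u]) (rule wedges_scale)
  moreover have "?M (?NL unit_covector) = (\<lambda>vs. ?s * ?NL (?M unit_covector) vs)"
    by (subst wedges_wedges) (simp add: length_all_indices)
  ultimately have "?s * ?NL u vs = top_coeff u * ?M (?NL unit_covector) vs"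
    by (simp add: mult_ac)
  then show ?case
    using fun_cong[OF eq, of vs] monomial
    by (simp add: L pq_monomial_eq pullback_wedges comp_def)
next
  case (add \<eta> \<zeta>)
  then show ?case by (simp add: wedges_add pullback_add distrib_left)
next
  case (scale c \<eta>)
  have "top_coeff u' * pullback L (wedges (map dz all_indices) (\<lambda>vs. c * \<eta> vs)) vs
    = c * (top_coeff u' * pullback L (wedges (map dz all_indices) \<eta>) vs)"
    by (simp add: wedges_scale pullback_scale)
  then show ?case by (simp add: scale wedges_scale pullback_scale)
qed simp

text \<open>Pulling back \<open>dz a \<and> \<alpha>'\<close> gives the combination of the \<open>dz b \<and> \<alpha>\<close> with coefficients \<open>L\<^sub>a\<^sub>b\<close>. Both sides are \<open>u\<close>
times a \<open>(0, q)\<close>-covector, which \<open>u\<close> determines.\<close>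

lemma pullback_vector_component:
  fixes u u' :: "'n::finite covector"
  assumes u: "u \<in> pq_covectors (int CARD('n)) 0" "u \<noteq> (\<lambda>vs. 0)"
    and u': "u' \<in> pq_covectors (int CARD('n)) 0" "u' \<noteq> (\<lambda>vs. 0)"
    and \<alpha>: "\<alpha> \<in> pq_covectors (int CARD('n) - 1) q" and \<alpha>': "\<alpha>' \<in> pq_covectors (int CARD('n) - 1) q"
    and L: "clinear_map L" "pullback L u' = u" "pullback L \<alpha>' = \<alpha>"
  shows "pullback L (vector_component u' \<alpha>' a) = (\<lambda>vs. \<Sum>b\<in>UNIV. L (axis b 1) $ a * vector_component u \<alpha> b vs)"
proof -
  note h = top_coeff_nonzero[OF u] and h' = top_coeff_nonzero[OF u']
  let ?M = "wedges (map dz (all_indices :: 'n list))"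
  let ?R = "\<lambda>vs. \<Sum>b\<in>UNIV. L (axis b 1) $ a * vector_component u \<alpha> b vs"
  have R: "?R \<in> pq_covectors 0 q"
    by (intro pq_covectors_sum pq_covectors_scale vector_component_pq \<alpha>)
  have Lp: "pullback L (vector_component u' \<alpha>' a) \<in> pq_covectors 0 q"
    by (intro pullback_pq L vector_component_pq \<alpha>')
  have M_sum: "?M (\<lambda>vs. \<Sum>i\<in>I. f i vs) = (\<lambda>vs. \<Sum>i\<in>I. ?M (f i) vs)" for I :: "'n set" and f
    by (induction I rule: infinite_finite_induct) (simp_all add: wedges_add)
  have "(\<lambda>vs. top_coeff u * ?M (pullback L (vector_component u' \<alpha>' a)) vs)
     = (\<lambda>vs. top_coeff u' * pullback L (?M (vector_component u' \<alpha>' a)) vs)"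
    using pullback_top_wedge[OF u(1) u'(1) L(2) vector_component_pq[OF \<alpha>']] by simp
  also have "\<dots> = pullback L (cov_wedge (dz a) \<alpha>')"
    using top_wedge_vector_component[OF h' \<alpha>', of a] by (simp add: pullback_scale[symmetric])
  also have "\<dots> = (\<lambda>vs. \<Sum>b\<in>UNIV. L (axis b 1) $ a * cov_wedge (dz b) \<alpha> vs)"
    by (simp add: pullback_wedge clinear_dz[OF L(1)] cov_wedge_left_sum cov_wedge_left_scale L(3))
  also have "\<dots> = (\<lambda>vs. \<Sum>b\<in>UNIV. L (axis b 1) $ a * (top_coeff u * ?M (vector_component u \<alpha> b) vs))"
    by (simp only: fun_cong[OF top_wedge_vector_component[OF h \<alpha>], symmetric])
  also have "\<dots> = (\<lambda>vs. top_coeff u * ?M ?R vs)"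
    by (simp only: M_sum wedges_scale sum_distrib_left mult.left_commute[of "top_coeff u"])
  finally have "?M (pullback L (vector_component u' \<alpha>' a)) = ?M ?R"
    using h by (simp add: fun_eq_iff)
  then have "strip all_indices (?M (pullback L (vector_component u' \<alpha>' a))) = strip all_indices (?M ?R)" by simp
  then show ?thesis
    unfolding strip_wedges[OF all_indices(1) interior_dz_0q[OF R]]
      strip_wedges[OF all_indices(1) interior_dz_0q[OF Lp]] .
qed

lemma pullback_vcontract:
  fixes u u' :: "'n::finite covector"
  assumes u': "u' \<in> pq_covectors p q" and L: "clinear_map L" "pullback L u' = u"
    and l: "\<And>a v. l' a (L v) = (\<Sum>b\<in>UNIV. L (axis b 1) $ a * l b v)"
  shows "pullback L (vcontract l' u') = vcontract l u"
proof
  fix vs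
  have "pullback L (vcontract l' u') vs = (\<Sum>a\<in>UNIV. \<Sum>b\<in>UNIV. L (axis b 1) $ a * cov_wedge (l b) (pullback L (interior_dz a u')) vs)"
    by (simp add: vcontract_def pullback_sum pullback_wedge l cov_wedge_left_sum cov_wedge_left_scale)
  also have "\<dots> = (\<Sum>b\<in>UNIV. cov_wedge (l b) (\<lambda>vs. \<Sum>a\<in>UNIV. L (axis b 1) $ a * pullback L (interior_dz a u') vs) vs)"
    by (subst sum.swap) (simp add: cov_wedge_sum cov_wedge_scale)
  also have "\<dots> = vcontract l u vs"
    by (simp add: pullback_interior[OF L(1) u'] L(2) vcontract_def)
  finally show "pullback L (vcontract l' u') vs = vcontract l u vs" .
qed

section \<open>Holomorphic maps commute with \<open>\<partial>\<close>\<close>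

text \<open>\<open>\<partial>l = 0\<close> at \<open>z\<close> for a family \<open>l\<close> of 1-covectors, in the form in which it is used inside products.\<close>

definition del_closed_at :: "(complex^'n::finite \<Rightarrow> complex^'n \<Rightarrow> complex) \<Rightarrow> complex^'n \<Rightarrow> bool" where
  "del_closed_at l z \<longleftrightarrow> diff_family l z \<and>
     (\<forall>\<zeta>. (\<lambda>vs. \<Sum>b\<in>UNIV. cov_wedge (dz b) (cov_wedge (cov_deriv (- \<i>) b l z) \<zeta>) vs) = (\<lambda>vs. 0))"

lemma wedges_del_closed:
  assumes "\<And>l. l \<in> set ls \<Longrightarrow> del_closed_at l z"
  shows "diff_family (\<lambda>w. wedges (map (\<lambda>l. l w) ls) unit_covector) z \<and>
    local_del (\<lambda>w. wedges (map (\<lambda>l. l w) ls) unit_covector) z = (\<lambda>vs. 0)"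
  using assms
proof (induction ls)
  case Nil
  then show ?case by (simp add: local_d_def)
next
  case (Cons l ls)
  let ?\<eta> = "\<lambda>w. wedges (map (\<lambda>l. l w) ls) unit_covector"
  have IH: "diff_family ?\<eta> z" "local_del ?\<eta> z = (\<lambda>vs. 0)" using Cons by auto
  have l: "diff_family l z"
    "(\<Sum>b\<in>UNIV. cov_wedge (dz b) (cov_wedge (cov_deriv (- \<i>) b l z) \<zeta>) vs) = 0" for \<zeta> vs
    using Cons.prems[of l] by (auto simp: del_closed_at_def fun_eq_iff)
  have "local_del (\<lambda>w. cov_wedge (l w) (?\<eta> w)) z vs = - cov_wedge (l z) (local_del ?\<eta> z) vs" for vs
    by (simp add: local_d_def cov_deriv_wedge[OF l(1) IH(1)] cov_wedge_add sum.distrib l(2)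
        cov_wedge_anticommute[of "dz _" "l z"] cov_wedge_sum sum_negf sum_subtractf)
  then show ?case
    using diff_family_wedge[OF l(1) IH(1)] IH(2) by (simp add: fun_eq_iff)
qed

locale holomorphic_change =
  fixes S :: "(complex^'n::finite) set" and T :: "complex^'n \<Rightarrow> complex^'n"
  assumes open_S: "open S" and hol: "holomorphic_map_on S T"
begin

abbreviation L where "L w \<equiv> frechet_derivative T (at w)"

lemma T_smooth: "smooth_on S T"
  using hol by (simp add: holomorphic_map_on_def)

lemma T_diff: "w \<in> S \<Longrightarrow> T differentiable at w"
  by (rule smooth_on_differentiable[OF T_smooth])

lemma L_clinear: "w \<in> S \<Longrightarrow> clinear_map (L w)"
  using hol linear_add[OF linear_frechet_derivative[OF T_diff]]
  by (auto simp: clinear_map_def holomorphic_map_on_def)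

lemma component_smooth: "smooth_on S (\<lambda>w. T w $ a)"
  using T_smooth smooth_on_vec_iff[OF open_S] by blast

lemma L_component: "w \<in> S \<Longrightarrow> L w v $ a = frechet_derivative (\<lambda>w. T w $ a) (at w) v"
  by (simp add: frechet_derivative_component[OF T_diff])

lemma L_component_smooth: "smooth_on S (\<lambda>w. L w v $ a)"
  using smooth_on_derivative[OF component_smooth[of a], of v]
  by (subst smooth_on_cong[OF open_S, of _ "\<lambda>w. frechet_derivative (\<lambda>w. T w $ a) (at w) v"]) (simp_all add: L_component)

lemma L_symmetric:
  assumes "z \<in> S"
  shows "frechet_derivative (\<lambda>w. L w v $ a) (at z) e = frechet_derivative (\<lambda>w. L w e $ a) (at z) v"
proof -
  have "frechet_derivative (\<lambda>w. L w v $ a) (at z)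
      = frechet_derivative (\<lambda>w. frechet_derivative (\<lambda>w. T w $ a) (at w) v) (at z)" for v
    by (rule frechet_derivative_cong_open[OF open_S assms]) (simp add: L_component)
  then show ?thesis
    using second_derivative_symmetric[OF open_S assms component_smooth] by simp
qed

text \<open>The Jacobian is complex linear in the vector inserted into it, and symmetry of second derivatives exchanges
this vector with the direction of differentiation.\<close>

lemma L_deriv_i:
  assumes "z \<in> S"
  shows "frechet_derivative (\<lambda>w. L w v $ a) (at z) (\<i> *s e) = \<i> * frechet_derivative (\<lambda>w. L w v $ a) (at z) e"
proof -
  have d: "(\<lambda>w. L w x $ a) differentiable at z" for x
    by (rule smooth_on_differentiable[OF L_component_smooth assms])
  have "frechet_derivative (\<lambda>w. L w (\<i> *s e) $ a) (at z) = frechet_derivative (\<lambda>w. \<i> * L w e $ a) (at z)"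
    by (rule frechet_derivative_cong_open[OF open_S assms])
       (use L_clinear in \<open>simp add: clinear_map_def\<close>)
  also have "\<dots> = (\<lambda>v. \<i> * frechet_derivative (\<lambda>w. L w e $ a) (at z) v)"
    by (rule frechet_derivative_bounded_linear[OF bounded_linear_mult_right d])
  finally show ?thesis
    by (simp add: L_symmetric[OF assms, of v] )
qed

lemma wirt_L:
  assumes "z \<in> S"
  shows "wirt (- \<i>) b (\<lambda>w. L w v $ a) z = frechet_derivative (\<lambda>w. L w v $ a) (at z) (axis b 1)"
    and "wirt \<i> b (\<lambda>w. L w v $ a) z = 0"
  using L_deriv_i[OF assms, of v a "axis b 1"]
  by (simp_all add: wirt_def axis_scale[of b \<i>])

text \<open>The second derivatives of a component of \<open>T\<close> are symmetric, hence \<open>\<partial>\<close> of its differential vanishes.\<close>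

lemma dz_closed:
  assumes "z \<in> S"
  shows "del_closed_at (\<lambda>w v. dz a (L w v)) z"
proof -
  have d: "diff_family (\<lambda>w v. dz a (L w v)) z"
    unfolding diff_family_def dz_def using smooth_on_differentiable[OF L_component_smooth assms] by blast
  let ?H = "\<lambda>b c. frechet_derivative (\<lambda>w. L w (axis c 1) $ a) (at z) (axis b 1)"
  have D: "cov_deriv (- \<i>) b (\<lambda>w v. dz a (L w v)) z = (\<lambda>v. \<Sum>c\<in>UNIV. ?H b c * dz c v)" for b
  proof
    fix v
    have lin: "(\<lambda>w. L w v $ a) differentiable at z" for v
      by (rule smooth_on_differentiable[OF L_component_smooth assms])
    have "cov_deriv (- \<i>) b (\<lambda>w v. dz a (L w v)) z v = wirt (- \<i>) b (\<lambda>w. L w v $ a) z"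
      by (simp add: cov_deriv_def dz_def)
    also have "\<dots> = wirt (- \<i>) b (\<lambda>w. \<Sum>c\<in>UNIV. dz c v * L w (axis c 1) $ a) z"
      by (rule wirt_cong_open[OF open_S assms]) (simp add: clinear_map_component[OF L_clinear, of _ v] mult.commute)
    also have "\<dots> = (\<Sum>c\<in>UNIV. wirt (- \<i>) b (\<lambda>w. dz c v * L w (axis c 1) $ a) z)"
      by (intro wirt_sum differentiable_mult differentiable_const lin)
    also have "\<dots> = (\<Sum>c\<in>UNIV. ?H b c * dz c v)"
      by (simp add: wirt_cmult[OF lin] wirt_L[OF assms] mult.commute)
    finally show "cov_deriv (- \<i>) b (\<lambda>w v. dz a (L w v)) z v = (\<Sum>c\<in>UNIV. ?H b c * dz c v)" .
  qed
  have "(\<Sum>b\<in>UNIV. cov_wedge (dz b) (cov_wedge (cov_deriv (- \<i>) b (\<lambda>w v. dz a (L w v)) z) \<zeta>) vs) = 0" for \<zeta> vs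
  proof -
    let ?s = "\<Sum>b\<in>UNIV. \<Sum>c\<in>UNIV. ?H b c * cov_wedge (dz b) (cov_wedge (dz c) \<zeta>) vs"
    have "?s = (\<Sum>b\<in>UNIV. \<Sum>c\<in>UNIV. - (?H c b * cov_wedge (dz c) (cov_wedge (dz b) \<zeta>) vs))"
    proof (intro sum.cong refl)
      fix b c
      show "?H b c * cov_wedge (dz b) (cov_wedge (dz c) \<zeta>) vs = - (?H c b * cov_wedge (dz c) (cov_wedge (dz b) \<zeta>) vs)"
        by (subst cov_wedge_anticommute) (simp add: L_symmetric[OF assms, of "axis c 1" a "axis b 1"])
    qed
    also have "\<dots> = - ?s"
      by (subst sum.swap) (simp add: sum_negf)
    finally have "?s = 0" by simp
    then show ?thesis
      by (simp add: D cov_wedge_left_sum cov_wedge_left_scale cov_wedge_sum cov_wedge_scale)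
  qed
  then show ?thesis using d by (simp add: del_closed_at_def)
qed

text \<open>The conjugate of the Jacobian is antiholomorphic, so \<open>\<partial>\<close> does not see it.\<close>

lemma dzbar_closed:
  assumes "z \<in> S"
  shows "del_closed_at (\<lambda>w v. dzbar a (L w v)) z"
proof -
  have lin: "(\<lambda>w. L w v $ a) differentiable at z" for v
    by (rule smooth_on_differentiable[OF L_component_smooth assms])
  have der: "((\<lambda>w. cnj (L w v $ a)) has_derivative (\<lambda>e. cnj (frechet_derivative (\<lambda>w. L w v $ a) (at z) e))) (at z)" for v
    by (intro bounded_linear.has_derivative[OF bounded_linear_cnj] has_frechet_derivative lin)
  have d: "diff_family (\<lambda>w v. dzbar a (L w v)) z"
    unfolding diff_family_def dzbar_def using der differentiableI by blast
  have "wirt (- \<i>) b (\<lambda>w. cnj (L w v $ a)) z = cnj (wirt \<i> b (\<lambda>w. L w v $ a) z)" for b v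
    by (simp add: wirt_def frechet_derivative_eqI[OF der])
  then have "cov_deriv (- \<i>) b (\<lambda>w v. dzbar a (L w v)) z = (\<lambda>v. 0)" for b
    by (simp add: cov_deriv_def dzbar_def wirt_L[OF assms])
  then show ?thesis using d by (simp add: del_closed_at_def)
qed

lemma wirt_compose:
  assumes "z \<in> S" "f differentiable at (T z)"
  shows "(\<lambda>w. f (T w)) differentiable at z"
    and "wirt (- \<i>) b (\<lambda>w. f (T w)) z = (\<Sum>a\<in>UNIV. L z (axis b 1) $ a * wirt (- \<i>) a f (T z))"
proof -
  let ?D = "frechet_derivative f (at (T z))"
  have der: "((\<lambda>w. f (T w)) has_derivative (\<lambda>v. ?D (L z v))) (at z)"
    using has_derivative_compose[OF has_frechet_derivative[OF T_diff[OF assms(1)]] has_frechet_derivative[OF assms(2)]] .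
  then show "(\<lambda>w. f (T w)) differentiable at z" by (rule differentiableI)
  have lin: "linear ?D" by (rule linear_frechet_derivative[OF assms(2)])
  have D: "?D x = (\<Sum>a\<in>UNIV. Re (x $ a) *\<^sub>R ?D (axis a 1) + Im (x $ a) *\<^sub>R ?D (axis a \<i>))" for x
  proof -
    have "axis a (x $ a) = Re (x $ a) *\<^sub>R axis a 1 + Im (x $ a) *\<^sub>R axis a \<i>" for a
      by (simp add: vec_eq_iff axis_def complex_eq_iff)
    then have "?D x = ?D (\<Sum>a\<in>UNIV. Re (x $ a) *\<^sub>R axis a 1 + Im (x $ a) *\<^sub>R axis a \<i>)"
      by (subst vec_eq_sum_axis[of x]) simp
    then show ?thesis
      by (simp add: linear_sum[OF lin] linear_add[OF lin] linear_scale[OF lin])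
  qed
  have scal: "L z (axis b \<i>) = \<i> *s L z (axis b 1)"
    using L_clinear[OF assms(1)] unfolding clinear_map_def axis_scale[of b \<i>] by blast
  have "wirt (- \<i>) b (\<lambda>w. f (T w)) z = (?D (L z (axis b 1)) - \<i> * ?D (\<i> *s L z (axis b 1))) / 2"
    by (simp add: wirt_def frechet_derivative_eqI[OF der] scal)
  also have "\<dots> = (\<Sum>a\<in>UNIV. L z (axis b 1) $ a * wirt (- \<i>) a f (T z))"
    unfolding D[of "L z (axis b 1)"] D[of "\<i> *s L z (axis b 1)"]
    by (simp add: sum_distrib_left sum_subtractf[symmetric] sum_divide_distrib wirt_def,
        intro sum.cong refl, simp add: complex_eq_iff algebra_simps add_divide_distrib diff_divide_distrib)
  finally show "wirt (- \<i>) b (\<lambda>w. f (T w)) z = (\<Sum>a\<in>UNIV. L z (axis b 1) $ a * wirt (- \<i>) a f (T z))" .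
qed

lemma local_del_mult_closed:
  assumes "f differentiable at z" "diff_family G z" "local_del G z = (\<lambda>vs. 0)"
  shows "local_del (\<lambda>w vs. f w * G w vs) z = (\<lambda>vs. \<Sum>b\<in>UNIV. wirt (- \<i>) b f z * cov_wedge (dz b) (G z) vs)"
proof
  fix vs
  have "local_del (\<lambda>w vs. f w * G w vs) z vs = (\<Sum>b\<in>UNIV. wirt (- \<i>) b f z * cov_wedge (dz b) (G z) vs) + f z * local_del G z vs"
    by (simp add: local_d_def cov_deriv_mult[OF assms(2,1)] cov_wedge_add cov_wedge_scale sum.distrib sum_distrib_left)
  then show "local_del (\<lambda>w vs. f w * G w vs) z vs = (\<Sum>b\<in>UNIV. wirt (- \<i>) b f z * cov_wedge (dz b) (G z) vs)"
    by (simp add: assms(3))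
qed

text \<open>Written in monomials, the pullback of \<open>F\<close> is a combination of products of pulled back \<open>dz\<close> and \<open>dzbar\<close>, which
are \<open>\<partial>\<close>-closed. So \<open>\<partial>\<close> acts on the coefficients only, and there it is the chain rule for holomorphic maps.\<close>

theorem local_del_pullback:
  assumes z: "z \<in> S" and T: "T ` S \<subseteq> S'" and S': "open S'"
    and F: "smooth_family S' F" "\<And>y. y \<in> S' \<Longrightarrow> F y \<in> pq_covectors p q"
  shows "local_del (\<lambda>w. pullback (L w) (F (T w))) z = pullback (L z) (local_del F (T z))"
proof
  fix vs
  obtain \<phi> :: "'n list \<times> 'n list \<Rightarrow> ('n covector) \<Rightarrow> complex" where \<phi>: "\<And>i. \<phi> i \<in> eval_span"
    "\<And>\<eta>. \<eta> \<in> pq_covectors p q \<Longrightarrow> \<eta> = (\<lambda>vs. \<Sum>i\<in>pq_indices p q. \<phi> i \<eta> * pq_monomial (fst i) (snd i) vs)"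
    using pq_coordinates by blast
  have Tz: "T z \<in> S'" using z T by blast
  have dF: "diff_family F (T z)" by (rule smooth_diff_family[OF F(1) Tz])
  let ?f = "\<lambda>i y. \<phi> i (F y)"
  let ?m = "\<lambda>i. pq_monomial (fst i) (snd i) :: 'n covector"
  let ?G = "\<lambda>i w. pullback (L w) (?m i)"
  let ?I = "pq_indices p q :: ('n list \<times> 'n list) set"
  have f: "?f i differentiable at (T z)" for i
    using eval_span_deriv[OF \<phi>(1) dF] by simp
  have G: "diff_family (?G i) z \<and> local_del (?G i) z = (\<lambda>vs. 0)" for i
  proof -
    let ?ls = "map (\<lambda>a w v. dz a (L w v)) (fst i) @ map (\<lambda>b w v. dzbar b (L w v)) (snd i)"
    have "?G i = (\<lambda>w. wedges (map (\<lambda>l. l w) ?ls) unit_covector)"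
      by (simp add: pullback_pq_monomial comp_def)
    then show ?thesis
      using wedges_del_closed[of ?ls z] dz_closed[OF z] dzbar_closed[OF z] by auto
  qed
  note G = conjunct1[OF G] conjunct2[OF G]
  have fG: "diff_family (\<lambda>w vs. ?f i (T w) * ?G i w vs) z" for i
    by (intro diff_family_mult G wirt_compose(1)[OF z f])
  have "local_del (\<lambda>w. pullback (L w) (F (T w))) z = local_del (\<lambda>w vs. \<Sum>i\<in>?I. ?f i (T w) * ?G i w vs) z"
  proof (rule local_d_cong_open[OF open_S z])
    fix w assume "w \<in> S"
    then have "F (T w) \<in> pq_covectors p q" using T F(2) by blast
    from \<phi>(2)[OF this]
    have "pullback (L w) (F (T w)) = pullback (L w) (\<lambda>vs. \<Sum>i\<in>?I. ?f i (T w) * ?m i vs)" by (rule arg_cong)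
    then show "pullback (L w) (F (T w)) = (\<lambda>vs. \<Sum>i\<in>?I. ?f i (T w) * ?G i w vs)"
      by (simp only: pullback_sum pullback_scale)
  qed
  also have "\<dots> = (\<lambda>vs. \<Sum>i\<in>?I. local_del (\<lambda>w vs. ?f i (T w) * ?G i w vs) z vs)"
    unfolding local_d_def cov_deriv_sum[OF fG] cov_wedge_sum by (rule ext, rule sum.swap)
  also have "\<dots> = (\<lambda>vs. \<Sum>i\<in>?I. \<Sum>b\<in>UNIV. (\<Sum>a\<in>UNIV. L z (axis b 1) $ a * wirt (- \<i>) a (?f i) (T z)) * cov_wedge (dz b) (?G i z) vs)"
    unfolding local_del_mult_closed[OF wirt_compose(1)[OF z f] G] wirt_compose(2)[OF z f] ..
  finally have lhs: "local_del (\<lambda>w. pullback (L w) (F (T w))) z vs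
     = (\<Sum>i\<in>?I. \<Sum>b\<in>UNIV. (\<Sum>a\<in>UNIV. L z (axis b 1) $ a * wirt (- \<i>) a (?f i) (T z)) * cov_wedge (dz b) (?G i z) vs)"
    by (rule fun_cong)
  have dm: "diff_family (\<lambda>y vs. ?f i y * ?m i vs) (T z)" for i
    by (intro diff_family_mult diff_family_const f)
  have zero: "local_del (\<lambda>y. ?m i) y = (\<lambda>vs. 0)" for i y
    by (simp add: local_d_def)
  have "local_del F (T z) = local_del (\<lambda>y vs. \<Sum>i\<in>?I. ?f i y * ?m i vs) (T z)"
    by (rule local_d_cong_open[OF S' Tz]) (rule \<phi>(2)[OF F(2)])
  also have "\<dots> = (\<lambda>vs. \<Sum>i\<in>?I. local_del (\<lambda>y vs. ?f i y * ?m i vs) (T z) vs)"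
    unfolding local_d_def cov_deriv_sum[OF dm] cov_wedge_sum by (rule ext, rule sum.swap)
  also have "\<dots> = (\<lambda>vs. \<Sum>i\<in>?I. \<Sum>a\<in>UNIV. wirt (- \<i>) a (?f i) (T z) * cov_wedge (dz a) (?m i) vs)"
    unfolding local_del_mult_closed[OF f diff_family_const zero] ..
  finally have "pullback (L z) (local_del F (T z)) vs
     = (\<Sum>i\<in>?I. \<Sum>a\<in>UNIV. wirt (- \<i>) a (?f i) (T z) * cov_wedge (\<lambda>v. dz a (L z v)) (?G i z) vs)"
    by (simp only: pullback_sum pullback_scale pullback_wedge)
  also have "\<dots> = (\<Sum>i\<in>?I. \<Sum>a\<in>UNIV. \<Sum>b\<in>UNIV. L z (axis b 1) $ a * wirt (- \<i>) a (?f i) (T z) * cov_wedge (dz b) (?G i z) vs)"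
    by (simp only: clinear_dz[OF L_clinear[OF z]] cov_wedge_left_sum cov_wedge_left_scale sum_distrib_left
        mult.assoc mult.left_commute[of "wirt _ _ _ _"])
  also have "\<dots> = local_del (\<lambda>w. pullback (L w) (F (T w))) z vs"
    unfolding lhs sum_distrib_right by (intro sum.cong refl sum.swap)
  finally show "local_del (\<lambda>w. pullback (L w) (F (T w))) z vs = pullback (L z) (local_del F (T z)) vs" by (rule sym)
qed

end

section \<open>Forms on a complex manifold\<close>

abbreviation jacobian ::
    "('a, 'n::finite) chart \<Rightarrow> ('a, 'n) chart \<Rightarrow> complex^'n \<Rightarrow> complex^'n \<Rightarrow> complex^'n" where
  "jacobian c c' z \<equiv> frechet_derivative (transition c c') (at z)"

lemma formsD:
  assumes "\<omega> \<in> forms A p q"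
  shows "c \<notin> A \<or> z \<notin> cimg c \<Longrightarrow> \<omega> c z = (\<lambda>vs. 0)"
    and "c \<in> A \<Longrightarrow> z \<in> cimg c \<Longrightarrow> \<omega> c z \<in> pq_covectors p q"
    and "c \<in> A \<Longrightarrow> smooth_family (cimg c) (\<omega> c)"
    and "c \<in> A \<Longrightarrow> c' \<in> A \<Longrightarrow> z \<in> overlap c c' \<Longrightarrow>
      \<omega> c z = pullback (jacobian c c' z) (\<omega> c' (transition c c' z))"
proof -
  note * = assms[unfolded forms_def mem_Collect_eq]
  show "\<omega> c z = (\<lambda>vs. 0)" if "c \<notin> A \<or> z \<notin> cimg c"
    using conjunct1[OF *] that by (intro ext) blast
  show "\<omega> c z \<in> pq_covectors p q" if "c \<in> A" "z \<in> cimg c"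
    using * that by blast
  show "smooth_family (cimg c) (\<omega> c)" if "c \<in> A"
    using * that unfolding smooth_family_def by blast
  show "\<omega> c z = pullback (jacobian c c' z) (\<omega> c' (transition c c' z))"
    if "c \<in> A" "c' \<in> A" "z \<in> overlap c c'"
    using conjunct2[OF conjunct2[OF conjunct2[OF *]]] that unfolding pullback_def by (intro ext) blast
qed

lemma formsI:
  assumes "\<And>c z. c \<notin> A \<or> z \<notin> cimg c \<Longrightarrow> \<omega> c z = (\<lambda>vs. 0)"
    and "\<And>c z. c \<in> A \<Longrightarrow> z \<in> cimg c \<Longrightarrow> \<omega> c z \<in> pq_covectors p q"
    and "\<And>c. c \<in> A \<Longrightarrow> smooth_family (cimg c) (\<omega> c)"
    and "\<And>c c' z. c \<in> A \<Longrightarrow> c' \<in> A \<Longrightarrow> z \<in> overlap c c' \<Longrightarrow>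
      \<omega> c z = pullback (jacobian c c' z) (\<omega> c' (transition c c' z))"
  shows "\<omega> \<in> forms A p q"
  unfolding forms_def mem_Collect_eq
proof (intro conjI allI ballI impI)
  show "\<omega> c z vs = 0" if "c \<notin> A \<or> z \<notin> cimg c" for c z vs
    using assms(1)[OF that] by simp
  show "\<omega> c z \<in> pq_covectors p q" if "c \<in> A" "z \<in> cimg c" for c z
    by (rule assms(2)[OF that])
  show "smooth_on (cimg c) (\<lambda>z. \<omega> c z vs)" if "c \<in> A" for c vs
    using assms(3)[OF that] by (simp add: smooth_family_def)
  show "\<omega> c z vs = \<omega> c' (transition c c' z) (map (jacobian c c' z) vs)"
    if "c \<in> A" "c' \<in> A" "z \<in> overlap c c'" for c c' z vs
    by (subst assms(4)[OF that]) (rule pullback_def)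
qed

definition vform_component :: "('a, 'n::finite) vform \<Rightarrow> ('a, 'n) chart \<Rightarrow> 'n \<Rightarrow> complex^'n \<Rightarrow> complex^'n \<Rightarrow> complex" where
  "vform_component \<theta> c a z v = \<theta> c z [v] $ a"

lemma contract_eq: "contract \<theta> \<omega> c z = vcontract (\<lambda>a. vform_component \<theta> c a z) (\<omega> c z)"
  by (simp add: contract_def vcontract_def vform_component_def[abs_def])

text \<open>The inverse of \<open>\<theta> \<mapsto> contract \<theta> u\<close> up to the sign in \<open>vform_of_form_contract\<close>. It is needed for \<open>(n - 1, q)\<close>-forms with
\<open>q \<le> 2\<close>, whereas \<open>contract\<close> accepts \<open>(0, 1)\<close>-forms only.\<close>

definition vform_of_form :: "('a, 'n::finite) form \<Rightarrow> ('a, 'n) form \<Rightarrow> ('a, 'n) vform" where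
  "vform_of_form u \<alpha> = (\<lambda>c z vs. \<chi> a. vector_component (u c z) (\<alpha> c z) a vs)"

lemma vform_of_form_add: "vform_of_form u (\<alpha> + \<beta>) = vform_of_form u \<alpha> + vform_of_form u \<beta>"
  by (simp add: vform_of_form_def fun_eq_iff vec_eq_iff plus_fun_def vector_component_add)

definition fscale :: "complex \<Rightarrow> ('a, 'n::finite) form \<Rightarrow> ('a, 'n) form" where
  "fscale t \<omega> = (\<lambda>c z vs. t * \<omega> c z vs)"

lemma vform_of_form_scale: "vform_of_form u (fscale t \<alpha>) = vscale t (vform_of_form u \<alpha>)"
  by (simp add: vform_of_form_def fscale_def vscale_def vec_eq_iff fun_eq_iff vector_component_scale)

lemma vform_of_form_at_zero:
  assumes "\<alpha> c z = (\<lambda>vs. 0)"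
  shows "vform_of_form u \<alpha> c z = (\<lambda>vs. 0)"
  unfolding vform_of_form_def vector_component_def assms by (rule ext) (simp add: vec_eq_iff)

interpretation vform_space: vector_space "vscale :: complex \<Rightarrow> ('a, 'n::finite) vform \<Rightarrow> ('a, 'n) vform"
  by unfold_locales (auto simp: vscale_def fun_eq_iff vec_eq_iff algebra_simps)

context compact_complex_manifold
begin

lemma topspace_chart: "c \<in> A \<Longrightarrow> topspace (subtopology X (cdom c)) = cdom c"
  using openin_subset[OF openin_cdom] by (simp add: Int_absorb1)

lemma inj_chart: "c \<in> A \<Longrightarrow> inj_on (cmap c) (cdom c)"
  using homeomorphic_imp_injective_map[OF homeomorphic] by (simp only: topspace_chart)

lemma overlap_open:
  assumes "c \<in> A" "c' \<in> A"
  shows "open (overlap c c')"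
proof -
  have "openin (subtopology X (cdom c)) (cdom c \<inter> cdom c')"
    using openin_cdom[OF assms(1)] openin_cdom[OF assms(2)]
    by (simp add: openin_open_subtopology openin_Int)
  then have "openin (top_of_set (cimg c)) (cmap c ` (cdom c \<inter> cdom c'))"
    using homeomorphic_map_openness_eq[OF homeomorphic[OF assms(1)]] by blast
  then show ?thesis
    using openin_open_eq[OF open_cimg[OF assms(1)]] by (simp add: overlap_def)
qed

lemma overlap_subset: "overlap c c' \<subseteq> cimg c"
  by (auto simp: overlap_def cimg_def)

lemma transition_mem:
  assumes "c \<in> A" "z \<in> overlap c c'"
  shows "transition c c' z \<in> cimg c'"
  using assms inv_into_f_f[OF inj_chart[OF assms(1)]]
  by (auto simp: overlap_def transition_def cimg_def)

lemma transition_change: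
  assumes "c \<in> A" "c' \<in> A"
  shows "holomorphic_change (overlap c c') (transition c c')"
  using overlap_open[OF assms] holomorphic_transition[OF assms] by unfold_locales

lemma transition_clinear:
  assumes "c \<in> A" "c' \<in> A" "z \<in> overlap c c'"
  shows "clinear_map (jacobian c c' z)"
  using holomorphic_change.L_clinear[OF transition_change[OF assms(1,2)] assms(3)] .

lemma forms_diff_family: "\<omega> \<in> forms A p q \<Longrightarrow> c \<in> A \<Longrightarrow> z \<in> cimg c \<Longrightarrow> diff_family (\<omega> c) z"
  by (rule smooth_diff_family[OF formsD(3)])

lemma forms_add:
  assumes "\<omega> \<in> forms A p q" "\<eta> \<in> forms A p q"
  shows "\<omega> + \<eta> \<in> forms A p q"
proof (rule formsI)
  fix c c' z
  show "(\<omega> + \<eta>) c z = (\<lambda>vs. 0)" if "c \<notin> A \<or> z \<notin> cimg c"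
    using formsD(1)[OF assms(1) that] formsD(1)[OF assms(2) that] by (simp add: fun_eq_iff)
  show "(\<omega> + \<eta>) c z \<in> pq_covectors p q" if "c \<in> A" "z \<in> cimg c"
    using pq_covectors_add[OF formsD(2)[OF assms(1) that] formsD(2)[OF assms(2) that]]
    by (simp add: plus_fun_def)
  show "smooth_family (cimg c) ((\<omega> + \<eta>) c)" if "c \<in> A"
    using formsD(3)[OF assms(1) that] formsD(3)[OF assms(2) that]
    by (simp add: smooth_family_def smooth_on_add[OF open_cimg[OF that]])
  show "(\<omega> + \<eta>) c z = pullback (jacobian c c' z) ((\<omega> + \<eta>) c' (transition c c' z))"
    if "c \<in> A" "c' \<in> A" "z \<in> overlap c c'"
    using fun_cong[OF formsD(4)[OF assms(1) that]] fun_cong[OF formsD(4)[OF assms(2) that]]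
    by (simp add: pullback_def fun_eq_iff)
qed

lemma forms_scale:
  assumes "\<omega> \<in> forms A p q"
  shows "fscale t \<omega> \<in> forms A p q"
proof (rule formsI)
  fix c c' z
  show "fscale t \<omega> c z = (\<lambda>vs. 0)" if "c \<notin> A \<or> z \<notin> cimg c"
    using formsD(1)[OF assms(1) that] by (simp add: fun_eq_iff fscale_def)
  show "fscale t \<omega> c z \<in> pq_covectors p q" if "c \<in> A" "z \<in> cimg c"
    using pq_covectors_scale[OF formsD(2)[OF assms(1) that]] by (simp add: fscale_def)
  show "smooth_family (cimg c) (fscale t \<omega> c)" if "c \<in> A"
    using formsD(3)[OF assms(1) that]
    by (simp add: smooth_family_def smooth_on_cmult[OF open_cimg[OF that]] fscale_def)
  show "fscale t \<omega> c z = pullback (jacobian c c' z) (fscale t \<omega> c' (transition c c' z))"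
    if "c \<in> A" "c' \<in> A" "z \<in> overlap c c'"
    using fun_cong[OF formsD(4)[OF assms(1) that]]
    by (simp add: pullback_def fun_eq_iff fscale_def)
qed

lemma forms_zero: "0 \<in> forms A p q"
proof -
  have "(\<lambda>c z vs. 0) \<in> forms A p q"
    by (rule formsI) (simp_all add: smooth_family_const open_cimg)
  then show ?thesis by (simp only: zero_fun_def)
qed

lemma del_form_at: "c \<in> A \<Longrightarrow> z \<in> cimg c \<Longrightarrow> del_form \<omega> c z = local_del (\<omega> c) z"
  and delbar_form_at: "c \<in> A \<Longrightarrow> z \<in> cimg c \<Longrightarrow> delbar_form \<omega> c z = local_delbar (\<omega> c) z"
  by (simp_all add: del_form_eq delbar_form_eq)

lemma local_form_outside:
  assumes "\<omega> \<in> forms A p q" "c \<notin> A \<or> z \<notin> cimg c"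
  shows "del_form \<omega> c z = (\<lambda>vs. 0)" "delbar_form \<omega> c z = (\<lambda>vs. 0)"
proof -
  have "\<omega> c = (\<lambda>w vs. 0)" if "c \<notin> A"
    using formsD(1)[OF assms(1)] that by blast
  then show "del_form \<omega> c z = (\<lambda>vs. 0)" "delbar_form \<omega> c z = (\<lambda>vs. 0)"
    using assms(2) by (auto simp: del_form_eq delbar_form_eq local_d_def)
qed

lemma del_form_add:
  assumes "\<omega> \<in> forms A p q" "\<eta> \<in> forms A p' q'"
  shows "del_form (\<omega> + \<eta>) = del_form \<omega> + del_form \<eta>" "delbar_form (\<omega> + \<eta>) = delbar_form \<omega> + delbar_form \<eta>"
proof -
  have sum: "(\<omega> + \<eta>) c = (\<lambda>w vs. \<omega> c w vs + \<eta> c w vs)" for c by (simp add: fun_eq_iff)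
  have "del_form (\<omega> + \<eta>) c z vs = del_form \<omega> c z vs + del_form \<eta> c z vs
     \<and> delbar_form (\<omega> + \<eta>) c z vs = delbar_form \<omega> c z vs + delbar_form \<eta> c z vs" for c z vs
  proof (cases "c \<in> A \<and> z \<in> cimg c")
    case True
    then have c: "c \<in> A" "z \<in> cimg c" by auto
    show ?thesis
      unfolding del_form_at[OF c] delbar_form_at[OF c] sum
        local_d_add[OF forms_diff_family[OF assms(1) c] forms_diff_family[OF assms(2) c]] by simp
  next
    case False
    then have o: "c \<notin> A \<or> z \<notin> cimg c" by blast
    have "(\<omega> + \<eta>) c = (\<lambda>w vs. 0)" if "c \<notin> A"
      using formsD(1)[OF assms(1)] formsD(1)[OF assms(2)] that by (simp add: fun_eq_iff)
    then have "del_form (\<omega> + \<eta>) c z = (\<lambda>vs. 0)" "delbar_form (\<omega> + \<eta>) c z = (\<lambda>vs. 0)"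
      using o by (auto simp: del_form_eq delbar_form_eq local_d_def)
    then show ?thesis
      by (simp add: local_form_outside[OF assms(1) o] local_form_outside[OF assms(2) o])
  qed
  then show "del_form (\<omega> + \<eta>) = del_form \<omega> + del_form \<eta>" "delbar_form (\<omega> + \<eta>) = delbar_form \<omega> + delbar_form \<eta>"
    by (simp_all add: fun_eq_iff)
qed

lemma del_form_scale:
  assumes "\<omega> \<in> forms A p q"
  shows "del_form (fscale t \<omega>) = fscale t (del_form \<omega>)" "delbar_form (fscale t \<omega>) = fscale t (delbar_form \<omega>)"
proof -
  have "del_form (fscale t \<omega>) c z vs = t * del_form \<omega> c z vs
     \<and> delbar_form (fscale t \<omega>) c z vs = t * delbar_form \<omega> c z vs" for c z vs
  proof (cases "c \<in> A \<and> z \<in> cimg c")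
    case True
    have "fscale t \<omega> c = (\<lambda>w vs. t * \<omega> c w vs)" by (simp add: fscale_def)
    then show ?thesis
      using True by (simp add: del_form_at delbar_form_at local_d_cmult forms_diff_family[OF assms(1)])
  next
    case False
    then have o: "c \<notin> A \<or> z \<notin> cimg c" by blast
    show ?thesis
      by (simp add: local_form_outside[OF assms(1) o] local_form_outside[OF forms_scale[OF assms(1)] o])
  qed
  then show "del_form (fscale t \<omega>) = fscale t (del_form \<omega>)" "delbar_form (fscale t \<omega>) = fscale t (delbar_form \<omega>)"
    by (simp_all add: fun_eq_iff fscale_def)
qed

text \<open>The transformation law of \<open>\<partial>\<omega>\<close> is \<open>local_del_pullback\<close>, applied to the transformation law of \<open>\<omega>\<close> on the open
set of coordinates of the overlap.\<close>

lemma del_form_forms: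
  assumes "\<omega> \<in> forms A p q"
  shows "del_form \<omega> \<in> forms A (p + 1) q"
proof (rule formsI)
  fix c c' z
  show "del_form \<omega> c z = (\<lambda>vs. 0)" if "c \<notin> A \<or> z \<notin> cimg c"
    by (rule local_form_outside[OF assms that])
  show "del_form \<omega> c z \<in> pq_covectors (p + 1) q" if c: "c \<in> A" "z \<in> cimg c"
    unfolding del_form_at[OF c] local_d_def
    by (intro pq_covectors_sum dz_wedge_pq cov_deriv_pq[OF open_cimg[OF c(1)] c(2)] formsD(2)[OF assms c(1)]
        forms_diff_family[OF assms c])
  show "smooth_family (cimg c) (del_form \<omega> c)" if c: "c \<in> A"
  proof -
    have "smooth_on (cimg c) (\<lambda>z. local_del (\<omega> c) z vs)" for vs
      using smooth_family_local_d[OF open_cimg[OF c] formsD(3)[OF assms c]] by (simp add: smooth_family_def)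
    then have "smooth_on (cimg c) (\<lambda>z. del_form \<omega> c z vs)" for vs
      by (subst smooth_on_cong[OF open_cimg[OF c], of _ "\<lambda>z. local_del (\<omega> c) z vs"]) (simp_all add: del_form_eq)
    then show ?thesis by (simp add: smooth_family_def)
  qed
  show "del_form \<omega> c z = pullback (jacobian c c' z) (del_form \<omega> c' (transition c c' z))"
    if c: "c \<in> A" "c' \<in> A" "z \<in> overlap c c'"
  proof -
    interpret holomorphic_change "overlap c c'" "transition c c'" by (rule transition_change[OF c(1,2)])
    have z: "z \<in> cimg c" "transition c c' z \<in> cimg c'"
      using c overlap_subset transition_mem by blast+
    have T: "transition c c' ` overlap c c' \<subseteq> cimg c'"
      by (rule image_subsetI) (rule transition_mem[OF c(1)])
    have "local_del (\<omega> c) z = local_del (\<lambda>w. pullback (L w) (\<omega> c' (transition c c' w))) z"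
      by (rule local_d_cong_open[OF open_S c(3)]) (rule formsD(4)[OF assms c(1,2)])
    also have "\<dots> = pullback (L z) (local_del (\<omega> c') (transition c c' z))"
      by (rule local_del_pullback[OF c(3) T open_cimg[OF c(2)] formsD(3)[OF assms c(2)] formsD(2)[OF assms c(2)]])
    finally show ?thesis
      unfolding del_form_at[OF c(1) z(1)] del_form_at[OF c(2) z(2)] .
  qed
qed

lemma del_form_relations:
  assumes "\<omega> \<in> forms A p q"
  shows "del_form (del_form \<omega>) = 0" and "del_form (delbar_form \<omega>) = fscale (- 1) (delbar_form (del_form \<omega>))"
proof -
  have "del_form (del_form \<omega>) c z = (\<lambda>vs. 0) \<and> del_form (delbar_form \<omega>) c z = (\<lambda>vs. - delbar_form (del_form \<omega>) c z vs)" for c z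
  proof (cases "c \<in> A \<and> z \<in> cimg c")
    case True
    then have c: "c \<in> A" "z \<in> cimg c" by auto
    note o = open_cimg[OF c(1)] and sm = formsD(3)[OF assms c(1)]
    have "local_del (del_form \<omega> c) z = local_del (local_del (\<omega> c)) z" "local_del (delbar_form \<omega> c) z = local_del (local_delbar (\<omega> c)) z"
      "local_delbar (del_form \<omega> c) z = local_delbar (local_del (\<omega> c)) z"
      by (rule local_d_cong_open[OF o c(2)], simp add: del_form_eq delbar_form_eq)+
    then show ?thesis
      by (simp add: del_form_at[OF c] delbar_form_at[OF c] local_d_squared[OF o c(2) sm]
          local_d_anticommute[OF o c(2) sm, of "- \<i>" dz \<i> dzbar])
  next
    case False
    have "\<omega> c = (\<lambda>w vs. 0)" if "c \<notin> A"
      using formsD(1)[OF assms(1)] that by blast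
    then have "del_form \<omega> c = (\<lambda>w vs. 0)" "delbar_form \<omega> c = (\<lambda>w vs. 0)" if "c \<notin> A"
      using that by (intro ext; simp add: del_form_eq delbar_form_eq local_d_def)+
    then show ?thesis
      using False by (auto simp: del_form_eq[of _ c z] delbar_form_eq[of _ c z] local_d_def)
  qed
  then show "del_form (del_form \<omega>) = 0" "del_form (delbar_form \<omega>) = fscale (- 1) (delbar_form (del_form \<omega>))"
    by (simp_all add: fun_eq_iff fscale_def)
qed

section \<open>Forms with values in the tangent bundle\<close>

lemma vformsD:
  assumes "\<theta> \<in> vforms A q"
  shows "c \<notin> A \<or> z \<notin> cimg c \<Longrightarrow> \<theta> c z = (\<lambda>vs. 0)"
    and "c \<in> A \<Longrightarrow> z \<in> cimg c \<Longrightarrow> (\<lambda>vs. \<theta> c z vs $ a) \<in> pq_covectors 0 q"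
    and "c \<in> A \<Longrightarrow> smooth_family (cimg c) (\<lambda>z vs. \<theta> c z vs $ a)"
    and "c \<in> A \<Longrightarrow> c' \<in> A \<Longrightarrow> z \<in> overlap c c' \<Longrightarrow>
      jacobian c c' z (\<theta> c z vs)
        = \<theta> c' (transition c c' z) (map (jacobian c c' z) vs)"
proof -
  show "c \<notin> A \<or> z \<notin> cimg c \<Longrightarrow> \<theta> c z = (\<lambda>vs. 0)"
    and "c \<in> A \<Longrightarrow> z \<in> cimg c \<Longrightarrow> (\<lambda>vs. \<theta> c z vs $ a) \<in> pq_covectors 0 q"
    and "c \<in> A \<Longrightarrow> c' \<in> A \<Longrightarrow> z \<in> overlap c c' \<Longrightarrow>
      jacobian c c' z (\<theta> c z vs)
        = \<theta> c' (transition c c' z) (map (jacobian c c' z) vs)"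
  proof -
    note * = assms[unfolded vforms_def mem_Collect_eq]
    show "\<theta> c z = (\<lambda>vs. 0)" if "c \<notin> A \<or> z \<notin> cimg c"
      using conjunct1[OF *] that by (intro ext) blast
    show "(\<lambda>vs. \<theta> c z vs $ a) \<in> pq_covectors 0 q" if "c \<in> A" "z \<in> cimg c"
      using * that by blast
    show "jacobian c c' z (\<theta> c z vs)
        = \<theta> c' (transition c c' z) (map (jacobian c c' z) vs)"
      if "c \<in> A" "c' \<in> A" "z \<in> overlap c c'"
      using conjunct2[OF conjunct2[OF conjunct2[OF *]]] that by blast
  qed
  show "smooth_family (cimg c) (\<lambda>z vs. \<theta> c z vs $ a)" if c: "c \<in> A"
  proof -
    have "smooth_on (cimg c) (\<lambda>z. \<theta> c z vs)" for vs
      using assms c unfolding vforms_def mem_Collect_eq by blast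
    then show ?thesis
      using smooth_on_vec_iff[OF open_cimg[OF c], THEN iffD1] unfolding smooth_family_def by blast
  qed
qed

lemma vformsI:
  assumes "\<And>c z. c \<notin> A \<or> z \<notin> cimg c \<Longrightarrow> \<theta> c z = (\<lambda>vs. 0)"
    and "\<And>c z a. c \<in> A \<Longrightarrow> z \<in> cimg c \<Longrightarrow> (\<lambda>vs. \<theta> c z vs $ a) \<in> pq_covectors 0 q"
    and "\<And>c a. c \<in> A \<Longrightarrow> smooth_family (cimg c) (\<lambda>z vs. \<theta> c z vs $ a)"
    and "\<And>c c' z vs. c \<in> A \<Longrightarrow> c' \<in> A \<Longrightarrow> z \<in> overlap c c' \<Longrightarrow>
      jacobian c c' z (\<theta> c z vs)
        = \<theta> c' (transition c c' z) (map (jacobian c c' z) vs)"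
  shows "\<theta> \<in> vforms A q"
  unfolding vforms_def mem_Collect_eq
proof (intro conjI allI ballI impI)
  show "\<theta> c z vs = 0" if "c \<notin> A \<or> z \<notin> cimg c" for c z vs
    using assms(1)[OF that] by simp
  show "smooth_on (cimg c) (\<lambda>z. \<theta> c z vs)" if "c \<in> A" for c vs
    using assms(3)[OF that] by (subst smooth_on_vec_iff[OF open_cimg[OF that]]) (simp add: smooth_family_def)
qed (use assms(2,4) in auto)

lemma vforms_add:
  assumes "\<theta> \<in> vforms A q" "\<theta>' \<in> vforms A q"
  shows "\<theta> + \<theta>' \<in> vforms A q"
proof (rule vformsI)
  fix c c' z a vs
  show "(\<theta> + \<theta>') c z = (\<lambda>vs. 0)" if "c \<notin> A \<or> z \<notin> cimg c"
    using vformsD(1)[OF assms(1) that] vformsD(1)[OF assms(2) that] by (simp add: fun_eq_iff)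
  show "(\<lambda>vs. (\<theta> + \<theta>') c z vs $ a) \<in> pq_covectors 0 q" if "c \<in> A" "z \<in> cimg c"
    using pq_covectors_add[OF vformsD(2)[OF assms(1) that] vformsD(2)[OF assms(2) that]] by simp
  show "smooth_family (cimg c) (\<lambda>z vs. (\<theta> + \<theta>') c z vs $ a)" if "c \<in> A"
    using vformsD(3)[OF assms(1) that, of a] vformsD(3)[OF assms(2) that, of a]
    by (simp add: smooth_family_def smooth_on_add[OF open_cimg[OF that]])
  show "jacobian c c' z ((\<theta> + \<theta>') c z vs)
      = (\<theta> + \<theta>') c' (transition c c' z) (map (jacobian c c' z) vs)"
    if "c \<in> A" "c' \<in> A" "z \<in> overlap c c'"
    using vformsD(4)[OF assms(1) that] vformsD(4)[OF assms(2) that] transition_clinear[OF that]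
    by (simp add: clinear_map_def)
qed

lemma vforms_scale:
  assumes "\<theta> \<in> vforms A q"
  shows "vscale t \<theta> \<in> vforms A q"
proof (rule vformsI)
  fix c c' z a vs
  show "vscale t \<theta> c z = (\<lambda>vs. 0)" if "c \<notin> A \<or> z \<notin> cimg c"
    using vformsD(1)[OF assms(1) that] by (simp add: fun_eq_iff vscale_def)
  show "(\<lambda>vs. vscale t \<theta> c z vs $ a) \<in> pq_covectors 0 q" if "c \<in> A" "z \<in> cimg c"
    using pq_covectors_scale[OF vformsD(2)[OF assms(1) that]] by (simp add: vscale_def)
  show "smooth_family (cimg c) (\<lambda>z vs. vscale t \<theta> c z vs $ a)" if "c \<in> A"
    using vformsD(3)[OF assms(1) that, of a]
    by (simp add: smooth_family_def smooth_on_cmult[OF open_cimg[OF that]] vscale_def)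
  show "jacobian c c' z (vscale t \<theta> c z vs)
      = vscale t \<theta> c' (transition c c' z) (map (jacobian c c' z) vs)"
    if "c \<in> A" "c' \<in> A" "z \<in> overlap c c'"
    using vformsD(4)[OF assms(1) that] transition_clinear[OF that]
    by (simp add: clinear_map_def vscale_def)
qed

lemma vforms_zero: "0 \<in> vforms A q"
proof (rule vformsI)
  fix c c' z vs
  show "jacobian c c' z ((0 :: ('a, 'n) vform) c z vs)
      = (0 :: ('a, 'n) vform) c' (transition c c' z) (map (jacobian c c' z) vs)"
    if "c \<in> A" "c' \<in> A" "z \<in> overlap c c'"
    using clinear_map_sum[OF transition_clinear[OF that], of "\<lambda>_. 0" "{}"] by simp
qed (simp_all add: fun_eq_iff smooth_family_const open_cimg)

lemma delbar_vform_at: "c \<in> A \<Longrightarrow> z \<in> cimg c \<Longrightarrow>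
  delbar_vform \<theta> c z = (\<lambda>vs. \<chi> b. local_delbar (\<lambda>z vs. \<theta> c z vs $ b) z vs)"
  by (simp add: delbar_vform_def delbar_form_eq)

lemma delbar_vform_outside:
  assumes "\<theta> \<in> vforms A q" "c \<notin> A \<or> z \<notin> cimg c"
  shows "delbar_vform \<theta> c z = (\<lambda>vs. 0)"
proof -
  have "\<theta> c = (\<lambda>w vs. 0)" if "c \<notin> A"
    using vformsD(1)[OF assms(1)] that by blast
  then show ?thesis
    using assms(2) by (auto simp: delbar_vform_def delbar_form_eq local_d_def fun_eq_iff vec_eq_iff)
qed

lemma vforms_diff_family: "\<theta> \<in> vforms A q \<Longrightarrow> c \<in> A \<Longrightarrow> z \<in> cimg c \<Longrightarrow> diff_family (\<lambda>z vs. \<theta> c z vs $ a) z"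
  by (rule smooth_diff_family[OF vformsD(3)])

lemma delbar_vform_add:
  assumes "\<theta> \<in> vforms A q" "\<theta>' \<in> vforms A q"
  shows "delbar_vform (\<theta> + \<theta>') = delbar_vform \<theta> + delbar_vform \<theta>'"
proof -
  have "delbar_vform (\<theta> + \<theta>') c z vs = delbar_vform \<theta> c z vs + delbar_vform \<theta>' c z vs" for c z vs
  proof (cases "c \<in> A \<and> z \<in> cimg c")
    case True
    then show ?thesis
      by (simp add: delbar_vform_at local_d_add vforms_diff_family[OF assms(1)] vforms_diff_family[OF assms(2)] vec_eq_iff)
  next
    case False
    then have o: "c \<notin> A \<or> z \<notin> cimg c" by blast
    then show ?thesis
      by (simp add: delbar_vform_outside[OF assms(1) o] delbar_vform_outside[OF assms(2) o]
          delbar_vform_outside[OF vforms_add[OF assms] o])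
  qed
  then show ?thesis by (simp add: fun_eq_iff)
qed

lemma delbar_vform_scale:
  assumes "\<theta> \<in> vforms A q"
  shows "delbar_vform (vscale t \<theta>) = vscale t (delbar_vform \<theta>)"
proof -
  have "delbar_vform (vscale t \<theta>) c z vs = t *s delbar_vform \<theta> c z vs" for c z vs
  proof (cases "c \<in> A \<and> z \<in> cimg c")
    case True
    have "(\<lambda>z vs. vscale t \<theta> c z vs $ b) = (\<lambda>z vs. t * \<theta> c z vs $ b)" for b
      by (simp add: vscale_def)
    then show ?thesis
      using True by (simp add: delbar_vform_at local_d_cmult vforms_diff_family[OF assms(1)] vec_eq_iff)
  next
    case False
    then have o: "c \<notin> A \<or> z \<notin> cimg c" by blast
    then show ?thesis
      by (simp add: delbar_vform_outside[OF assms(1) o] delbar_vform_outside[OF vforms_scale[OF assms] o])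
  qed
  then show ?thesis by (simp add: fun_eq_iff vscale_def)
qed

lemma delbar_vform_zero: "delbar_vform (0 :: ('a, 'n) vform) = 0"
  using delbar_vform_scale[OF vforms_zero, of 0] by simp

lemma delbar_image_subspace: "vform_space.subspace (delbar_vform ` vforms A q)"
proof (rule vform_space.subspaceI)
  show "0 \<in> delbar_vform ` vforms A q"
    using imageI[OF vforms_zero, of delbar_vform q] by (simp only: delbar_vform_zero)
  show "x + y \<in> delbar_vform ` vforms A q" if xy: "x \<in> delbar_vform ` vforms A q" "y \<in> delbar_vform ` vforms A q" for x y
  proof -
    obtain \<theta> \<theta>' where "\<theta> \<in> vforms A q" "\<theta>' \<in> vforms A q" "x = delbar_vform \<theta>" "y = delbar_vform \<theta>'"
      using xy by blast
    then show ?thesis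
      using imageI[OF vforms_add, of \<theta> q \<theta>' delbar_vform] by (simp only: delbar_vform_add)
  qed
  show "vscale t x \<in> delbar_vform ` vforms A q" if xy: "x \<in> delbar_vform ` vforms A q" for x t
  proof -
    obtain \<theta> where "\<theta> \<in> vforms A q" "x = delbar_vform \<theta>"
      using xy by blast
    then show ?thesis
      using imageI[OF vforms_scale, of \<theta> q delbar_vform t] by (simp only: delbar_vform_scale)
  qed
qed

lemma vform_component_dz_part:
  assumes "\<theta> \<in> vforms A 1"
  shows "dz_part b (vform_component \<theta> c a z) = 0"
proof (cases "c \<in> A \<and> z \<in> cimg c")
  case True
  then show ?thesis
    using antilinear_dz_part[OF covector_01(2)[OF vformsD(2)[OF assms]]] by (simp add: vform_component_def[abs_def])
next
  case False
  then have "\<theta> c z = (\<lambda>vs. 0)" using vformsD(1)[OF assms] by blast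
  then show ?thesis by (simp add: vform_component_def dz_part_def)
qed

lemma vform_component_smooth:
  assumes "\<theta> \<in> vforms A 1" "c \<in> A"
  shows "smooth_family (cimg c) (vform_component \<theta> c a)"
  using vformsD(3)[OF assms] unfolding smooth_family_def vform_component_def by blast

lemma contract_forms:
  assumes \<theta>: "\<theta> \<in> vforms A 1" and \<omega>: "\<omega> \<in> forms A p q"
  shows "contract \<theta> \<omega> \<in> forms A (p - 1) (q + 1)"
proof (rule formsI)
  fix c c' z
  show "contract \<theta> \<omega> c z = (\<lambda>vs. 0)" if "c \<notin> A \<or> z \<notin> cimg c"
    by (simp add: contract_eq vcontract_def formsD(1)[OF \<omega> that])
  show "contract \<theta> \<omega> c z \<in> pq_covectors (p - 1) (q + 1)" if c: "c \<in> A" "z \<in> cimg c"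
    unfolding contract_def
    by (intro pq_covectors_sum antilinear_wedge_pq interior_dz_pq formsD(2)[OF \<omega> c] covector_01(2)[OF vformsD(2)[OF \<theta> c]])
  show "smooth_family (cimg c) (contract \<theta> \<omega> c)" if c: "c \<in> A"
    unfolding contract_eq[abs_def] vcontract_def
    by (intro smooth_family_sum smooth_family_wedge smooth_family_interior vform_component_smooth[OF \<theta> c] formsD(3)[OF \<omega> c] open_cimg[OF c])
  show "contract \<theta> \<omega> c z = pullback (jacobian c c' z) (contract \<theta> \<omega> c' (transition c c' z))"
    if c: "c \<in> A" "c' \<in> A" "z \<in> overlap c c'"
  proof -
    let ?L = "jacobian c c' z"
    have L: "clinear_map ?L" by (rule transition_clinear[OF c])
    have "vform_component \<theta> c' a (transition c c' z) (?L v) = (\<Sum>b\<in>UNIV. ?L (axis b 1) $ a * vform_component \<theta> c b z v)" for a v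
      using vformsD(4)[OF \<theta> c, of "[v]"] clinear_map_component[OF L, of "\<theta> c z [v]" a]
      by (simp add: vform_component_def dz_def)
    then show ?thesis
      unfolding contract_eq using formsD(4)[OF \<omega> c] formsD(2)[OF \<omega> c(2) transition_mem[OF c(1,3)]]
      by (intro pullback_vcontract[OF _ L, symmetric]) auto
  qed
qed

end

section \<open>Vector forms and forms on a Calabi-Yau manifold\<close>

locale calabi_yau_manifold = compact_complex_manifold X A
  for X :: "'a topology" and A :: "('a, 'n::finite) chart set" +
  fixes u :: "('a, 'n) form"
  assumes volume: "nonvanishing_holomorphic_top_form A u"
begin

lemma u_form: "u \<in> forms A (int CARD('n)) 0"
  using volume by (simp add: nonvanishing_holomorphic_top_form_def)

lemma u_nz: "c \<in> A \<Longrightarrow> z \<in> cimg c \<Longrightarrow> u c z \<noteq> (\<lambda>vs. 0)"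
  using volume by (simp add: nonvanishing_holomorphic_top_form_def zero_fun_def)

lemma local_volume_chart:
  assumes "c \<in> A"
  shows "local_volume (cimg c) (u c)"
proof
  show "open (cimg c)" by (rule open_cimg[OF assms])
  show "u c w \<in> pq_covectors (int CARD('n)) 0" if "w \<in> cimg c" for w
    by (rule formsD(2)[OF u_form assms that])
  show "smooth_family (cimg c) (u c)" by (rule formsD(3)[OF u_form assms])
  show "u c w \<noteq> (\<lambda>vs. 0)" if "w \<in> cimg c" for w by (rule u_nz[OF assms that])
  show "local_delbar (u c) w = (\<lambda>vs. 0)" if "w \<in> cimg c" for w
    using volume delbar_form_at[OF assms that, of u]
    by (simp add: nonvanishing_holomorphic_top_form_def zero_fun_def)
qed

lemma vform_of_form_outside:
  assumes "\<alpha> \<in> forms A p q" "c \<notin> A \<or> z \<notin> cimg c"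
  shows "vform_of_form u \<alpha> c z = (\<lambda>vs. 0)"
  by (rule vform_of_form_at_zero) (rule formsD(1)[OF assms])

lemma vform_of_form_vforms:
  assumes \<alpha>: "\<alpha> \<in> forms A (int CARD('n) - 1) q"
  shows "vform_of_form u \<alpha> \<in> vforms A q"
proof (rule vformsI)
  fix c c' z a vs
  show "vform_of_form u \<alpha> c z = (\<lambda>vs. 0)" if "c \<notin> A \<or> z \<notin> cimg c"
    by (rule vform_of_form_outside[OF \<alpha> that])
  show "(\<lambda>vs. vform_of_form u \<alpha> c z vs $ a) \<in> pq_covectors 0 q" if c: "c \<in> A" "z \<in> cimg c"
    using vector_component_pq[OF formsD(2)[OF \<alpha> c]] by (simp add: vform_of_form_def)
  show "smooth_family (cimg c) (\<lambda>z vs. vform_of_form u \<alpha> c z vs $ a)" if c: "c \<in> A"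
    using local_volume.smooth_vector_component[OF local_volume_chart[OF c] formsD(3)[OF \<alpha> c], of a] by (simp add: vform_of_form_def)
  show "jacobian c c' z (vform_of_form u \<alpha> c z vs)
      = vform_of_form u \<alpha> c' (transition c c' z) (map (jacobian c c' z) vs)"
    if c: "c \<in> A" "c' \<in> A" "z \<in> overlap c c'"
  proof -
    let ?L = "jacobian c c' z" and ?z = "transition c c' z"
    have z: "z \<in> cimg c" "?z \<in> cimg c'"
      using c overlap_subset transition_mem by blast+
    have L: "clinear_map ?L" by (rule transition_clinear[OF c])
    have "pullback ?L (vector_component (u c' ?z) (\<alpha> c' ?z) a) = (\<lambda>vs. \<Sum>b\<in>UNIV. ?L (axis b 1) $ a * vector_component (u c z) (\<alpha> c z) b vs)" for a
      using formsD(2)[OF u_form c(1) z(1)] u_nz[OF c(1) z(1)] formsD(2)[OF u_form c(2) z(2)] u_nz[OF c(2) z(2)]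
        formsD(2)[OF \<alpha> c(1) z(1)] formsD(2)[OF \<alpha> c(2) z(2)] L
        formsD(4)[OF u_form c, symmetric] formsD(4)[OF \<alpha> c, symmetric]
      by (rule pullback_vector_component)
    then have "vector_component (u c' ?z) (\<alpha> c' ?z) a (map ?L vs) = (\<Sum>b\<in>UNIV. ?L (axis b 1) $ a * vector_component (u c z) (\<alpha> c z) b vs)" for a
      by (simp add: pullback_def fun_eq_iff)
    then show ?thesis
      by (simp add: vec_eq_iff vform_of_form_def clinear_map_component[OF L, of "\<chi> a. _ a"] dz_def)
  qed
qed

lemma contract_vform_of_form:
  assumes \<alpha>: "\<alpha> \<in> forms A (int CARD('n) - 1) 1"
  shows "contract (vform_of_form u \<alpha>) u = fscale ((- 1) ^ Suc CARD('n)) \<alpha>"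
proof -
  have "contract (vform_of_form u \<alpha>) u c z = (\<lambda>vs. (- 1) ^ Suc CARD('n) * \<alpha> c z vs)" for c z
  proof (cases "c \<in> A \<and> z \<in> cimg c")
    case True
    then have c: "c \<in> A" "z \<in> cimg c" by auto
    have "(\<lambda>a. vform_component (vform_of_form u \<alpha>) c a z) = (\<lambda>a v. vector_component (u c z) (\<alpha> c z) a [v])"
      by (simp add: fun_eq_iff vform_component_def vform_of_form_def)
    then show ?thesis
      using vcontract_vector_component[OF formsD(2)[OF u_form c] u_nz[OF c] formsD(2)[OF \<alpha> c]] by (simp add: contract_eq)
  next
    case False
    then have o: "c \<notin> A \<or> z \<notin> cimg c" by blast
    show ?thesis
      using formsD(1)[OF u_form o] formsD(1)[OF \<alpha> o] by (simp add: contract_eq vcontract_def)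
  qed
  then show ?thesis by (simp add: fscale_def fun_eq_iff)
qed

lemma vform_of_form_contract:
  assumes \<theta>: "\<theta> \<in> vforms A 1"
  shows "vform_of_form u (contract \<theta> u) = vscale ((- 1) ^ Suc CARD('n)) \<theta>"
proof -
  have "vform_of_form u (contract \<theta> u) c z vs $ a = (- 1) ^ Suc CARD('n) * \<theta> c z vs $ a" for c z vs a
  proof (cases "c \<in> A \<and> z \<in> cimg c")
    case True
    then have c: "c \<in> A" "z \<in> cimg c" by auto
    have "vform_of_form u (contract \<theta> u) c z vs $ a = (- 1) ^ Suc CARD('n) * cov_wedge (vform_component \<theta> c a z) unit_covector vs"
      unfolding vform_of_form_def contract_eq
      using vector_component_vcontract[OF formsD(2)[OF u_form c] u_nz[OF c] vform_component_dz_part[OF \<theta>]] by simp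
    also have "cov_wedge (vform_component \<theta> c a z) unit_covector = (\<lambda>vs. \<theta> c z vs $ a)"
      using covector_01(1)[OF vformsD(2)[OF \<theta> c, of a]] by (simp add: vform_component_def[abs_def])
    finally show ?thesis .
  next
    case False
    then have o: "c \<notin> A \<or> z \<notin> cimg c" by blast
    show ?thesis
      using vform_of_form_outside[OF contract_forms[OF \<theta> u_form] o] vformsD(1)[OF \<theta> o] by simp
  qed
  then show ?thesis by (simp add: fun_eq_iff vec_eq_iff vscale_def)
qed

lemma vform_of_form_delbar_outside:
  assumes "\<alpha> \<in> forms A p q" "c \<notin> A \<or> z \<notin> cimg c"
  shows "vform_of_form u (delbar_form \<alpha>) c z = (\<lambda>vs. 0)"
  by (rule vform_of_form_at_zero) (rule local_form_outside(2)[OF assms])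

lemma delbar_vform_of_form:
  assumes \<alpha>: "\<alpha> \<in> forms A (int CARD('n) - 1) q"
  shows "delbar_vform (vform_of_form u \<alpha>) = vscale ((- 1) ^ Suc CARD('n)) (vform_of_form u (delbar_form \<alpha>))"
proof -
  have "delbar_vform (vform_of_form u \<alpha>) c z vs = (- 1) ^ Suc CARD('n) *s vform_of_form u (delbar_form \<alpha>) c z vs" for c z vs
  proof (cases "c \<in> A \<and> z \<in> cimg c")
    case True
    then have c: "c \<in> A" "z \<in> cimg c" by auto
    have "local_delbar (\<lambda>z vs. vform_of_form u \<alpha> c z vs $ b) z = (\<lambda>vs. (- 1) ^ Suc CARD('n) * vector_component (u c z) (local_delbar (\<alpha> c) z) b vs)" for b
      using local_volume.local_delbar_vector_component[OF local_volume_chart[OF c(1)] c(2) forms_diff_family[OF \<alpha> c], of b] by (simp add: vform_of_form_def)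
    then show ?thesis
      by (simp add: delbar_vform_at[OF c] vec_eq_iff vform_of_form_def delbar_form_at[OF c])
  next
    case False
    then have o: "c \<notin> A \<or> z \<notin> cimg c" by blast
    show ?thesis
      by (simp add: delbar_vform_outside[OF vform_of_form_vforms[OF \<alpha>] o] vform_of_form_delbar_outside[OF \<alpha> o])
  qed
  then show ?thesis by (simp add: fun_eq_iff vscale_def)
qed

text \<open>The form \<open>\<partial>-bar (contract \<theta> u)\<close> is of type \<open>(n - 1, 2)\<close>, and its vector components are those of \<open>\<partial>-bar \<theta>\<close> up to sign.\<close>

lemma delbar_contract_zero:
  assumes \<theta>: "\<theta> \<in> vforms A 1" and "delbar_vform \<theta> = 0"
  shows "delbar_form (contract \<theta> u) = 0"
proof -
  let ?\<alpha> = "contract \<theta> u"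
  have \<alpha>: "?\<alpha> \<in> forms A (int CARD('n) - 1) 1" using contract_forms[OF \<theta> u_form] by simp
  have "vscale ((- 1) ^ Suc CARD('n)) (vform_of_form u (delbar_form ?\<alpha>)) = 0"
    unfolding delbar_vform_of_form[OF \<alpha>, symmetric] vform_of_form_contract[OF \<theta>] delbar_vform_scale[OF \<theta>] assms(2)
    by (rule vform_space.scale_zero_right)
  then have lift0: "vform_of_form u (delbar_form ?\<alpha>) = 0"
    unfolding vform_space.scale_eq_0_iff by simp
  have "delbar_form ?\<alpha> c z = (\<lambda>vs. 0)" for c z
  proof (cases "c \<in> A \<and> z \<in> cimg c")
    case True
    then have c: "c \<in> A" "z \<in> cimg c" by auto
    have "delbar_form ?\<alpha> c z \<in> pq_covectors (int CARD('n) - 1) (1 + 1)"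
      unfolding delbar_form_at[OF c] local_d_def
      by (intro pq_covectors_sum dzbar_wedge_pq cov_deriv_pq[OF open_cimg[OF c(1)] c(2)] formsD(2)[OF \<alpha> c(1)]
          forms_diff_family[OF \<alpha> c])
    moreover have "vector_component (u c z) (delbar_form ?\<alpha> c z) a = (\<lambda>vs. 0)" for a
      using fun_cong[OF fun_cong[OF fun_cong[OF lift0, of c], of z]]
      by (simp add: vform_of_form_def vec_eq_iff fun_eq_iff)
    ultimately show ?thesis
      by (rule vector_component_injective[OF formsD(2)[OF u_form c] u_nz[OF c]])
  next
    case False
    then show ?thesis using local_form_outside(2)[OF \<alpha>] by blast
  qed
  then show ?thesis by (simp add: fun_eq_iff)
qed

lemma tian_todorov:
  assumes \<psi>: "\<psi> \<in> vforms A 1" and \<rho>: "\<rho> \<in> vforms A 1"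
    and \<psi>0: "del_form (contract \<psi> u) = 0" and \<rho>0: "del_form (contract \<rho> u) = 0"
  shows "vform_of_form u (del_form (contract \<psi> (contract \<rho> u))) = vscale (- 1) (bracket \<psi> \<rho>)"
proof -
  let ?\<gamma> = "contract \<psi> (contract \<rho> u)"
  have \<gamma>: "?\<gamma> \<in> forms A (int CARD('n) - 1 - 1) (0 + 1 + 1)"
    by (intro contract_forms \<psi> \<rho> u_form)
  have "vform_of_form u (del_form ?\<gamma>) c z vs $ b = - (bracket \<psi> \<rho> c z vs $ b)" for c z vs b
  proof (cases "c \<in> A \<and> z \<in> cimg c")
    case True
    then have c: "c \<in> A" "z \<in> cimg c" by auto
    have D: "(\<lambda>ws. dz_deriv a (\<lambda>w. \<theta> c w ws $ b) z) = cov_wedge (cov_deriv (- \<i>) a (vform_component \<theta> c b) z) unit_covector"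
      if \<theta>: "\<theta> \<in> vforms A 1" for \<theta> a
    proof -
      have "cov_deriv (- \<i>) a (\<lambda>w ws. \<theta> c w ws $ b) z \<in> pq_covectors 0 1"
        by (rule cov_deriv_pq[OF open_cimg[OF c(1)] c(2) vformsD(2)[OF \<theta> c(1)] vforms_diff_family[OF \<theta> c]])
      from covector_01(1)[OF this] show ?thesis
        by (simp add: cov_deriv_def dz_deriv_eq vform_component_def)
    qed
    have zero: "local_del (\<lambda>w. vcontract (\<lambda>a. vform_component \<theta> c a w) (u c w)) z = (\<lambda>vs. 0)"
      if "del_form (contract \<theta> u) = 0" for \<theta>
      using fun_cong[OF fun_cong[OF that, of c], of z]
      by (simp add: del_form_at[OF c] contract_eq[abs_def] zero_fun_def)
    have d: "diff_family (vform_component \<theta> c a) z" if "\<theta> \<in> vforms A 1" for \<theta> a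
      by (rule smooth_diff_family[OF vform_component_smooth[OF that c(1)] c(2)])
    have "vector_component (u c z) (local_del (?\<gamma> c) z) b = (\<lambda>vs. - (\<Sum>a\<in>UNIV.
          cov_wedge (vform_component \<psi> c a z) (cov_wedge (cov_deriv (- \<i>) a (vform_component \<rho> c b) z) unit_covector) vs
        + cov_wedge (vform_component \<rho> c a z) (cov_wedge (cov_deriv (- \<i>) a (vform_component \<psi> c b) z) unit_covector) vs))"
      using local_volume.local_tian_todorov[OF local_volume_chart[OF c(1)] c(2) d[OF \<psi>] vform_component_dz_part[OF \<psi>]
          d[OF \<rho>] vform_component_dz_part[OF \<rho>] zero[OF \<psi>0] zero[OF \<rho>0], of b]
      by (simp add: contract_eq[abs_def])
    then show ?thesis
      by (simp add: vform_of_form_def del_form_at[OF c] bracket_def D[OF \<psi>] D[OF \<rho>] vform_component_def[abs_def])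
  next
    case False
    then have o: "c \<notin> A \<or> z \<notin> cimg c" by blast
    have "vform_of_form u (del_form ?\<gamma>) c z vs = 0"
      using vform_of_form_outside[OF del_form_forms[OF \<gamma>] o] by simp
    moreover have "bracket \<psi> \<rho> c z vs = 0"
      using vformsD(1)[OF \<psi> o] vformsD(1)[OF \<rho> o] by (simp add: bracket_def vec_eq_iff)
    ultimately show ?thesis by simp
  qed
  then show ?thesis by (simp add: fun_eq_iff vec_eq_iff vscale_def)
qed

end

section \<open>Solving the integrability equations\<close>

lemma vform_of_form_zero: "vform_of_form u 0 = 0"
proof -
  have "vform_of_form u 0 c z = (\<lambda>vs. 0)" for c z
    by (rule vform_of_form_at_zero) (simp add: fun_eq_iff)
  then show ?thesis by (simp add: fun_eq_iff)
qed

context compact_complex_manifold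
begin

lemma del_form_zero: "del_form (0 :: ('a, 'n) form) = 0" "delbar_form (0 :: ('a, 'n) form) = 0"
proof -
  have "fscale 0 \<omega> = 0" for \<omega> :: "('a, 'n) form" by (simp add: fscale_def fun_eq_iff)
  then show "del_form (0 :: ('a, 'n) form) = 0" "delbar_form (0 :: ('a, 'n) form) = 0"
    using del_form_scale[OF forms_zero, of 0] by simp_all
qed

text \<open>A \<open>d\<close>-closed \<open>\<alpha>\<close> in the class of \<open>\<gamma>\<close> satisfies \<open>\<alpha> - \<gamma> = \<partial>\<zeta> + \<partial>-bar \<xi>\<close>, and \<open>\<partial>\<close> annihilates \<open>\<alpha>\<close> and \<open>\<partial>\<zeta>\<close>.\<close>

lemma Z2_del_ddbar_exact:
  assumes page1: "page1_ddbar A" and \<gamma>: "\<gamma> \<in> Z2 A p q"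
  shows "\<exists>\<xi>\<in>forms A p (q - 1). del_form \<gamma> = delbar_form (del_form \<xi>)"
proof -
  have "E2_class A p q \<gamma> \<in> E2 A p q" using \<gamma> by (simp add: E2_def)
  then obtain \<alpha> where \<alpha>: "\<alpha> \<in> E2_class A p q \<gamma>" "d_form \<alpha> = 0"
    using page1 unfolding page1_ddbar_def by blast
  then obtain \<zeta> \<xi> where \<zeta>: "\<zeta> \<in> forms A (p - 1) q" and \<xi>: "\<xi> \<in> forms A p (q - 1)"
    and eq: "\<alpha> - \<gamma> = del_form \<zeta> + delbar_form \<xi>"
    and \<alpha>_Z2: "\<alpha> \<in> Z2 A p q"
    by (auto simp: E2_class_def C2_def)
  have \<alpha>_form: "\<alpha> \<in> forms A p q" and \<gamma>_form: "\<gamma> \<in> forms A p q"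
    using \<alpha>_Z2 \<gamma> by (simp_all add: Z2_def)
  have del_\<alpha>: "del_form \<alpha> = 0"
    using \<alpha>(2) \<alpha>_Z2 by (simp add: d_form_def Z2_def)
  have \<zeta>': "del_form \<zeta> \<in> forms A p q"
    using del_form_forms[OF \<zeta>] by simp
  have "delbar_form \<xi> = (\<alpha> + fscale (- 1) \<gamma>) + fscale (- 1) (del_form \<zeta>)"
    using eq by (simp add: fscale_def fun_eq_iff algebra_simps)
  then have "del_form (delbar_form \<xi>) = (del_form \<alpha> + fscale (- 1) (del_form \<gamma>)) + fscale (- 1) (del_form (del_form \<zeta>))"
    by (simp only: del_form_add(1)[OF forms_add[OF \<alpha>_form forms_scale[OF \<gamma>_form]] forms_scale[OF \<zeta>']]
        del_form_add(1)[OF \<alpha>_form forms_scale[OF \<gamma>_form]] del_form_scale(1)[OF \<gamma>_form] del_form_scale(1)[OF \<zeta>'])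
  then have "fscale (- 1) (del_form \<gamma>) = fscale (- 1) (delbar_form (del_form \<xi>))"
    unfolding del_\<alpha> del_form_relations[OF \<zeta>] del_form_relations(2)[OF \<xi>]
    by (simp add: fscale_def fun_eq_iff)
  then have "del_form \<gamma> = delbar_form (del_form \<xi>)"
    by (simp add: fscale_def fun_eq_iff)
  with \<xi> show ?thesis by blast
qed

end

context calabi_yau_manifold
begin

text \<open>The invariant of the recursion. Vanishing of \<open>\<partial> (contract \<theta> u)\<close> is what the Tian-Todorov identity needs; the
last condition is that of the hypothesis on iterated contractions.\<close>

definition admissible :: "('a, 'n) vform \<Rightarrow> bool" where
  "admissible \<theta> \<longleftrightarrow> \<theta> \<in> vforms A 1 \<and> del_form (contract \<theta> u) = 0 \<and>
     contract \<theta> u \<in> {\<alpha>. d_form \<alpha> = 0} \<union> del_form ` forms A (int CARD('n) - 2) 1"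

text \<open>What the hypothesis on iterated contractions yields by \<open>Z2_del_ddbar_exact\<close>; the rest of the argument
uses it in this form.\<close>

definition contractions_ddbar_exact :: bool where
  "contractions_ddbar_exact \<longleftrightarrow> (\<forall>\<psi> \<rho>. admissible \<psi> \<longrightarrow> admissible \<rho> \<longrightarrow>
     (\<exists>\<xi>\<in>forms A (int CARD('n) - 2) 1. del_form (contract \<psi> (contract \<rho> u)) = delbar_form (del_form \<xi>)))"

lemma admissibleI_closed:
  assumes "\<theta> \<in> vforms A 1" "del_form (contract \<theta> u) = 0" "delbar_form (contract \<theta> u) = 0"
  shows "admissible \<theta>"
  using assms by (simp add: admissible_def d_form_def)

text \<open>Each bracket is, up to sign, the vector form of some \<open>\<partial>-bar \<partial>\<xi>\<close>, and these are added up.\<close>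

lemma sum_brackets_delbar:
  assumes ext: contractions_ddbar_exact
    and "finite I" "\<And>i. i \<in> I \<Longrightarrow> admissible (\<psi> i)" "\<And>i. i \<in> I \<Longrightarrow> admissible (\<rho> i)"
  shows "\<exists>\<omega>\<in>forms A (int CARD('n) - 2) 1.
    vform_of_form u (delbar_form (del_form \<omega>)) = vscale (1/2) (\<Sum>i\<in>I. bracket (\<psi> i) (\<rho> i))"
  using assms(2-4)
proof (induction I rule: finite_induct)
  case empty
  have "vform_of_form u (delbar_form (del_form (0 :: ('a, 'n) form))) = vscale (1/2) 0"
    by (simp only: del_form_zero vform_of_form_zero vform_space.scale_zero_right)
  then show ?case
    unfolding sum.empty by (intro bexI[OF _ forms_zero])
next
  case (insert i I)
  then obtain \<omega> where \<omega>: "\<omega> \<in> forms A (int CARD('n) - 2) 1"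
    "vform_of_form u (delbar_form (del_form \<omega>)) = vscale (1/2) (\<Sum>i\<in>I. bracket (\<psi> i) (\<rho> i))" by auto
  have i: "admissible (\<psi> i)" "admissible (\<rho> i)" using insert.prems by auto
  with ext obtain \<xi> where \<xi>: "\<xi> \<in> forms A (int CARD('n) - 2) 1"
    "del_form (contract (\<psi> i) (contract (\<rho> i) u)) = delbar_form (del_form \<xi>)"
    unfolding contractions_ddbar_exact_def by blast
  \<comment> \<open>The minus sign compensates the one in the Tian-Todorov identity.\<close>
  let ?\<omega> = "\<omega> + fscale (- (1/2)) \<xi>"
  note s\<xi> = forms_scale[OF \<xi>(1), of "- (1/2)"]
  have "delbar_form (del_form ?\<omega>) = delbar_form (del_form \<omega>) + fscale (- (1/2)) (delbar_form (del_form \<xi>))"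
    by (simp only: del_form_add(1)[OF \<omega>(1) s\<xi>] del_form_scale(1)[OF \<xi>(1)]
        del_form_add(2)[OF del_form_forms[OF \<omega>(1)] forms_scale[OF del_form_forms[OF \<xi>(1)]]]
        del_form_scale(2)[OF del_form_forms[OF \<xi>(1)]])
  then have "vform_of_form u (delbar_form (del_form ?\<omega>))
     = vform_of_form u (delbar_form (del_form \<omega>)) + vscale (- (1/2)) (vform_of_form u (del_form (contract (\<psi> i) (contract (\<rho> i) u))))"
    by (simp only: vform_of_form_add vform_of_form_scale \<xi>(2))
  also have "vform_of_form u (del_form (contract (\<psi> i) (contract (\<rho> i) u))) = vscale (- 1) (bracket (\<psi> i) (\<rho> i))"
    using i unfolding admissible_def by (intro tian_todorov) auto
  also have "vscale (- (1/2)) (vscale (- 1) (bracket (\<psi> i) (\<rho> i))) = vscale (1/2) (bracket (\<psi> i) (\<rho> i))"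
    by simp
  finally have "vform_of_form u (delbar_form (del_form ?\<omega>)) = vscale (1/2) (\<Sum>i\<in>insert i I. bracket (\<psi> i) (\<rho> i))"
    unfolding \<omega>(2) sum.insert[OF insert.hyps] vform_space.scale_right_distrib by (simp only: add.commute)
  with forms_add[OF \<omega>(1) s\<xi>] show ?case by blast
qed

lemma sign_square: "(- 1) ^ Suc CARD('n) * (- 1) ^ Suc CARD('n) = (1 :: complex)"
  by (simp flip: power_mult_distrib)

text \<open>Solving for \<open>contract \<theta> u\<close> with a \<open>\<partial>\<close>-exact form makes the solution admissible again.\<close>

lemma next_term:
  assumes ext: contractions_ddbar_exact
    and "finite I" "\<And>i. i \<in> I \<Longrightarrow> admissible (\<psi> i)" "\<And>i. i \<in> I \<Longrightarrow> admissible (\<rho> i)"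
  shows "\<exists>\<theta>. admissible \<theta> \<and> delbar_vform \<theta> = vscale (1/2) (\<Sum>i\<in>I. bracket (\<psi> i) (\<rho> i))"
proof -
  define s :: complex where "s = (- 1) ^ Suc CARD('n)"
  have ss: "s * s = 1" unfolding s_def by (rule sign_square)
  obtain \<omega> where \<omega>: "\<omega> \<in> forms A (int CARD('n) - 2) 1"
    "vform_of_form u (delbar_form (del_form \<omega>)) = vscale (1/2) (\<Sum>i\<in>I. bracket (\<psi> i) (\<rho> i))"
    using sum_brackets_delbar[OF ext \<open>finite I\<close>, of \<psi> \<rho>] assms(3,4) by blast
  let ?\<theta> = "vform_of_form u (fscale s (del_form \<omega>))"
  have d\<omega>: "del_form \<omega> \<in> forms A (int CARD('n) - 1) 1"
    using del_form_forms[OF \<omega>(1)] by simp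
  note sd\<omega> = forms_scale[OF d\<omega>, of s]
  have "contract ?\<theta> u = fscale s (fscale s (del_form \<omega>))"
    unfolding s_def by (rule contract_vform_of_form[OF sd\<omega>[unfolded s_def]])
  then have c: "contract ?\<theta> u = del_form \<omega>"
    by (simp add: fscale_def mult.assoc[symmetric] ss)
  have "admissible ?\<theta>"
    unfolding admissible_def c using vform_of_form_vforms[OF sd\<omega>] del_form_relations(1)[OF \<omega>(1)] \<omega>(1) by blast
  moreover have "delbar_vform ?\<theta> = vscale s (vform_of_form u (fscale s (delbar_form (del_form \<omega>))))"
    unfolding delbar_vform_of_form[OF sd\<omega>] del_form_scale(2)[OF d\<omega>] unfolding s_def by (rule refl)
  moreover have "vscale s (vform_of_form u (fscale s (delbar_form (del_form \<omega>)))) = vscale (s * s) (vform_of_form u (delbar_form (del_form \<omega>)))"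
    unfolding vform_of_form_scale by (rule vform_space.scale_scale)
  ultimately have "admissible ?\<theta> \<and> delbar_vform ?\<theta> = vscale (1/2) (\<Sum>i\<in>I. bracket (\<psi> i) (\<rho> i))"
    by (simp only: ss vform_space.scale_one \<omega>(2) simp_thms)
  then show ?thesis by blast
qed

text \<open>Dependent choice along the recursion; the equation of order \<open>\<nu>\<close> involves earlier terms only.\<close>

lemma integrability_solvableI:
  assumes ext: contractions_ddbar_exact
    and \<psi>1: "admissible \<psi>1" "delbar_vform \<psi>1 = 0"
  shows "integrability_solvable A \<psi>1"
proof -
  \<comment> \<open>The equations start at order 2; the term of index 0 does not occur in them and is set to \<open>\<psi>1\<close> as well.\<close>
  define P where "P f \<nu> \<theta> \<longleftrightarrow> admissible \<theta> \<and> (if \<nu> < 2 then \<theta> = \<psi>1 else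
      delbar_vform \<theta> = vscale (1/2) (\<Sum>\<mu> = 1..\<nu> - 1. bracket (f \<mu>) (f (\<nu> - \<mu>))))"
    for f :: "nat \<Rightarrow> ('a, 'n) vform" and \<nu> \<theta>
  have "\<exists>\<psi>. \<forall>\<nu>. P \<psi> \<nu> (\<psi> \<nu>)"
  proof (rule dependent_wellorder_choice)
    show "P f \<nu> \<theta> = P g \<nu> \<theta>" if "\<And>\<mu>. \<mu> < \<nu> \<Longrightarrow> f \<mu> = g \<mu>" for f g \<nu> \<theta>
    proof -
      have "(\<Sum>\<mu> = 1..\<nu> - 1. bracket (f \<mu>) (f (\<nu> - \<mu>))) = (\<Sum>\<mu> = 1..\<nu> - 1. bracket (g \<mu>) (g (\<nu> - \<mu>)))" if "\<not> \<nu> < 2"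
        using that \<open>\<And>\<mu>. \<mu> < \<nu> \<Longrightarrow> f \<mu> = g \<mu>\<close> by (intro sum.cong refl arg_cong2[of _ _ _ _ bracket]) auto
      then show ?thesis unfolding P_def by (cases "\<nu> < 2") simp_all
    qed
    show "\<exists>\<theta>. P f \<nu> \<theta>" if prev: "\<And>\<mu>. \<mu> < \<nu> \<Longrightarrow> P f \<mu> (f \<mu>)" for \<nu> f
    proof (cases "\<nu> < 2")
      case True
      then show ?thesis using \<psi>1(1) by (auto simp: P_def)
    next
      case False
      have "admissible (f \<mu>)" if "\<mu> < \<nu>" for \<mu>
        using prev[OF that] by (simp add: P_def)
      then have "\<exists>\<theta>. admissible \<theta> \<and> delbar_vform \<theta> = vscale (1/2) (\<Sum>\<mu> = 1..\<nu> - 1. bracket (f \<mu>) (f (\<nu> - \<mu>)))"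
        using False by (intro next_term[OF ext]) auto
      then show ?thesis using False by (simp add: P_def)
    qed
  qed
  then obtain \<psi> where \<psi>: "\<And>\<nu>. P \<psi> \<nu> (\<psi> \<nu>)" by blast
  have "\<psi> 1 = \<psi>1" using \<psi>[of 1] by (simp add: P_def)
  moreover have "\<psi> \<nu> \<in> vforms A 1" for \<nu>
    using \<psi>[of \<nu>] by (simp add: P_def admissible_def)
  moreover have "delbar_vform (\<psi> \<nu>) = vscale (1/2) (\<Sum>\<mu> = 1..\<nu> - 1. bracket (\<psi> \<mu>) (\<psi> (\<nu> - \<mu>)))" if "\<nu> \<ge> 2" for \<nu>
    using \<psi>[of \<nu>] that by (simp add: P_def)
  moreover have "\<psi>1 \<in> vforms A 1" using \<psi>1(1) by (simp add: admissible_def)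
  ultimately show ?thesis
    unfolding integrability_solvable_def using \<psi>1(2) by blast
qed

lemma vform_of_form_closed:
  assumes \<alpha>: "\<alpha> \<in> forms A (int CARD('n) - 1) 1" "del_form \<alpha> = 0" "delbar_form \<alpha> = 0"
  obtains \<theta> where "admissible \<theta>" "delbar_vform \<theta> = 0" "contract \<theta> u = \<alpha>"
proof -
  define s :: complex where "s = (- 1) ^ Suc CARD('n)"
  have ss: "s * s = 1" unfolding s_def by (rule sign_square)
  let ?\<theta> = "vform_of_form u (fscale s \<alpha>)"
  note s\<alpha> = forms_scale[OF \<alpha>(1), of s]
  have "contract ?\<theta> u = fscale s (fscale s \<alpha>)"
    unfolding s_def by (rule contract_vform_of_form[OF s\<alpha>[unfolded s_def]])
  then have c: "contract ?\<theta> u = \<alpha>"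
    by (simp add: fscale_def mult.assoc[symmetric] ss)
  have "delbar_vform ?\<theta> = vscale s (vform_of_form u (fscale s 0))"
    unfolding delbar_vform_of_form[OF s\<alpha>] del_form_scale(2)[OF \<alpha>(1)] \<alpha>(3) unfolding s_def by (rule refl)
  also have "\<dots> = 0"
    unfolding vform_of_form_scale vform_of_form_zero vform_space.scale_zero_right by (rule refl)
  finally have "delbar_vform ?\<theta> = 0" .
  moreover have "admissible ?\<theta>"
    using vform_of_form_vforms[OF s\<alpha>] \<alpha> by (intro admissibleI_closed) (simp_all only: c)
  ultimately show thesis using c that by blast
qed

section \<open>Unobstructedness\<close>

theorem essential_unobstructed:
  assumes page1: "page1_ddbar A"
    and ext: contractions_ddbar_exact
  shows "essential_kuranishi_unobstructed A u"
  unfolding essential_kuranishi_unobstructed_def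
proof
  fix K assume K: "K \<in> E2 A (int CARD('n) - 1) 1"
  obtain \<alpha> where \<alpha>: "\<alpha> \<in> K" "d_form \<alpha> = 0"
    using page1 K unfolding page1_ddbar_def by blast
  then have "\<alpha> \<in> Z2 A (int CARD('n) - 1) 1"
    using K by (auto simp: E2_def E2_class_def)
  then have "\<alpha> \<in> forms A (int CARD('n) - 1) 1" "del_form \<alpha> = 0" "delbar_form \<alpha> = 0"
    using \<alpha>(2) by (simp_all add: Z2_def d_form_def)
  from vform_of_form_closed[OF this] obtain \<theta> where \<theta>: "admissible \<theta>" "delbar_vform \<theta> = 0" "contract \<theta> u = \<alpha>" .
  show "\<exists>\<psi>1\<in>vforms A 1. contract \<psi>1 u \<in> K \<and> integrability_solvable A \<psi>1"
    using integrability_solvableI[OF ext \<theta>(1,2)] \<theta> \<alpha>(1) unfolding admissible_def by blast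
qed

text \<open>The contraction \<open>\<alpha> = contract \<theta> u\<close> is \<open>\<partial>-bar\<close>-closed, so by assumption it has a class on the second page, and a \<open>d\<close>-closed
representative \<open>\<beta>\<close> of that class satisfies \<open>\<beta> - \<alpha> = \<partial>\<zeta> + \<partial>-bar \<xi>\<close>. Then \<open>\<beta> - \<partial>\<zeta>\<close> is \<open>d\<close>-closed and
\<open>\<partial>-bar\<close>-cohomologous to \<open>\<alpha>\<close>.\<close>

lemma closed_decomposition:
  assumes page1: "page1_ddbar A"
    and Z: "Z1 A (int CARD('n) - 1) 1 = Z2 A (int CARD('n) - 1) 1"
    and \<theta>: "\<theta> \<in> vforms A 1" "delbar_vform \<theta> = 0"
  obtains \<theta>' where "\<theta>' \<in> vforms A 1" "delbar_vform \<theta>' = 0" "del_form (contract \<theta>' u) = 0"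
    "\<theta> - \<theta>' \<in> delbar_vform ` vforms A 0"
proof -
  define s :: complex where "s = (- 1) ^ Suc CARD('n)"
  have ss: "s * s = 1" unfolding s_def by (rule sign_square)
  let ?p = "int CARD('n) - 1"
  let ?\<alpha> = "contract \<theta> u"
  have \<alpha>: "?\<alpha> \<in> forms A ?p 1" using contract_forms[OF \<theta>(1) u_form] by simp
  then have "?\<alpha> \<in> Z1 A ?p 1"
    using delbar_contract_zero[OF \<theta>] by (simp add: Z1_def)
  then have "?\<alpha> \<in> Z2 A ?p 1" using Z by blast
  then have "E2_class A ?p 1 ?\<alpha> \<in> E2 A ?p 1" by (simp add: E2_def)
  then obtain \<beta> where \<beta>: "\<beta> \<in> E2_class A ?p 1 ?\<alpha>" "d_form \<beta> = 0"
    using page1 unfolding page1_ddbar_def by blast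
  then obtain \<zeta> \<xi> where \<zeta>: "\<zeta> \<in> forms A (?p - 1) 1" "delbar_form \<zeta> = 0" and \<xi>: "\<xi> \<in> forms A ?p (1 - 1)"
    and eq: "\<beta> - ?\<alpha> = del_form \<zeta> + delbar_form \<xi>" and \<beta>_Z2: "\<beta> \<in> Z2 A ?p 1"
    by (auto simp: E2_class_def C2_def)
  have \<beta>_form: "\<beta> \<in> forms A ?p 1" and \<beta>0: "delbar_form \<beta> = 0" "del_form \<beta> = 0"
    using \<beta>_Z2 \<beta>(2) by (simp_all add: Z2_def d_form_def)
  have \<zeta>': "del_form \<zeta> \<in> forms A ?p 1" using del_form_forms[OF \<zeta>(1)] by simp
  have \<zeta>0: "delbar_form (del_form \<zeta>) = 0"
  proof -
    have "fscale (- 1) (delbar_form (del_form \<zeta>)) = 0"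
      using del_form_relations(2)[OF \<zeta>(1)] by (simp add: \<zeta>(2) del_form_zero)
    then show ?thesis by (simp add: fscale_def fun_eq_iff)
  qed
  \<comment> \<open>The \<open>d\<close>-closed form \<open>\<beta> - \<partial>\<zeta>\<close>, \<open>\<partial>-bar\<close>-cohomologous to the contraction of \<open>\<theta>\<close>.\<close>
  let ?\<gamma> = "\<beta> + fscale (- 1) (del_form \<zeta>)"
  note s\<zeta>' = forms_scale[OF \<zeta>', of "- 1"]
  have fz: "fscale t 0 = (0 :: ('a, 'n) form)" for t by (simp add: fscale_def fun_eq_iff)
  have \<gamma>: "?\<gamma> \<in> forms A ?p 1" by (rule forms_add[OF \<beta>_form s\<zeta>'])
  have "del_form ?\<gamma> = 0" "delbar_form ?\<gamma> = 0"
    by (simp_all only: del_form_add[OF \<beta>_form s\<zeta>'] del_form_scale[OF \<zeta>'] \<beta>0 \<zeta>0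
        del_form_relations(1)[OF \<zeta>(1)] fz add_0_left)
  from vform_of_form_closed[OF \<gamma> this] obtain \<theta>' where \<theta>': "admissible \<theta>'" "delbar_vform \<theta>' = 0" "contract \<theta>' u = ?\<gamma>" .
  have \<theta>'_form: "\<theta>' \<in> vforms A 1" and \<theta>'_del: "del_form (contract \<theta>' u) = 0"
    using \<theta>'(1) by (simp_all add: admissible_def)
  have \<xi>0: "\<xi> \<in> forms A ?p 0" using \<xi> by simp
  have "?\<gamma> = ?\<alpha> + delbar_form \<xi>"
    using eq by (simp add: fscale_def fun_eq_iff algebra_simps)
  then have "vform_of_form u (contract \<theta>' u) = vform_of_form u ?\<alpha> + vform_of_form u (delbar_form \<xi>)"
    unfolding \<theta>'(3) by (simp only: vform_of_form_add)
  then have "vscale s \<theta>' = vscale s \<theta> + vform_of_form u (delbar_form \<xi>)"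
    unfolding vform_of_form_contract[OF \<theta>(1)] vform_of_form_contract[OF \<theta>'_form] s_def .
  then have "vscale s (vscale s \<theta>') = vscale s (vscale s \<theta>) + vscale s (vform_of_form u (delbar_form \<xi>))"
    by (simp only: vform_space.scale_right_distrib)
  then have "\<theta>' = \<theta> + vscale s (vform_of_form u (delbar_form \<xi>))"
    by (simp only: vform_space.scale_scale ss vform_space.scale_one)
  then have "\<theta>' = \<theta> + delbar_vform (vform_of_form u \<xi>)"
    unfolding delbar_vform_of_form[OF \<xi>0] s_def .
  then have "\<theta> - \<theta>' = vscale (- 1) (delbar_vform (vform_of_form u \<xi>))"
    by (simp add: vform_space.scale_minus_left)
  then have "\<theta> - \<theta>' \<in> delbar_vform ` vforms A 0"
    using vform_space.subspace_scale[OF delbar_image_subspace imageI[OF vform_of_form_vforms[OF \<xi>0]], of "- 1"] by simp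
  with \<theta>'_form \<theta>'(2) \<theta>'_del show thesis by (rule that)
qed

text \<open>By \<open>closed_decomposition\<close> the space \<open>U\<close> of \<open>\<partial>-bar\<close>-closed elements with \<open>\<partial>\<close>-closed contraction surjects onto the
cohomology. A basis \<open>B0\<close> of the exact elements extends by elements of \<open>U\<close> to a basis of the sum of both spaces;
the added elements represent a basis of the cohomology. Since \<open>U\<close> is a subspace, all their linear
combinations are admissible.\<close>

theorem unobstructed:
  assumes page1: "page1_ddbar A"
    and Z: "Z1 A (int CARD('n) - 1) 1 = Z2 A (int CARD('n) - 1) 1"
    and ext: contractions_ddbar_exact
  shows "kuranishi_unobstructed A"
proof -
  let ?W = "delbar_vform ` vforms A 0 :: ('a, 'n) vform set"
  define U where "U = {\<theta> \<in> vforms A 1. delbar_vform \<theta> = 0 \<and> del_form (contract \<theta> u) = 0}"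
  have W: "vform_space.subspace ?W" by (rule delbar_image_subspace)
  obtain B0 where B0: "B0 \<subseteq> ?W" "vform_space.independent B0" "?W \<subseteq> vform_space.span B0"
    using vform_space.maximal_independent_subset[of ?W] by blast
  have W_span: "?W = vform_space.span B0"
    using B0(1,3) vform_space.span_minimal[OF B0(1) W] by blast
  obtain B1 where B1: "B0 \<subseteq> B1" "B1 \<subseteq> ?W \<union> U" "vform_space.independent B1" "?W \<union> U \<subseteq> vform_space.span B1"
    using vform_space.maximal_independent_subset_extend[of B0 "?W \<union> U"] B0(1,2) by blast
  define B where "B = B1 - B0"
  have B_U: "B \<subseteq> U"
  proof
    fix b assume b: "b \<in> B"
    have "b \<notin> vform_space.span B0"
    proof
      assume "b \<in> vform_space.span B0"
      then have "b \<in> vform_space.span (B1 - {b})"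
        using b B1(1) vform_space.span_mono[of B0 "B1 - {b}"] by (auto simp: B_def)
      then show False using B1(3) b unfolding vform_space.dependent_def B_def by blast
    qed
    then show "b \<in> U" using b B1(2) W_span by (auto simp: B_def)
  qed
  have indep: "t \<beta> = 0" if F: "finite F" "F \<subseteq> B" "(\<Sum>\<beta>\<in>F. vscale (t \<beta>) \<beta>) \<in> ?W" "\<beta> \<in> F" for F t \<beta>
  proof (rule ccontr)
    assume "t \<beta> \<noteq> 0"
    have "(\<Sum>\<beta>\<in>F. vscale (t \<beta>) \<beta>) \<in> vform_space.span (B1 - {\<beta>})"
      using F(2,3,4) B1(1) vform_space.span_mono[of B0 "B1 - {\<beta>}"] W_span by (auto simp: B_def)
    moreover have "(\<Sum>\<beta>\<in>F - {\<beta>}. vscale (t \<beta>) \<beta>) \<in> vform_space.span (B1 - {\<beta>})"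
      using F(2) by (intro vform_space.span_sum vform_space.span_scale vform_space.span_base) (auto simp: B_def)
    ultimately have "(\<Sum>\<beta>\<in>F. vscale (t \<beta>) \<beta>) - (\<Sum>\<beta>\<in>F - {\<beta>}. vscale (t \<beta>) \<beta>) \<in> vform_space.span (B1 - {\<beta>})"
      by (rule vform_space.span_diff)
    then have "vscale (t \<beta>) \<beta> \<in> vform_space.span (B1 - {\<beta>})"
      using sum.remove[OF F(1,4), of "\<lambda>\<beta>. vscale (t \<beta>) \<beta>"] by simp
    then have "vscale (inverse (t \<beta>)) (vscale (t \<beta>) \<beta>) \<in> vform_space.span (B1 - {\<beta>})"
      by (rule vform_space.span_scale)
    then have "\<beta> \<in> vform_space.span (B1 - {\<beta>})"
      using \<open>t \<beta> \<noteq> 0\<close> by simp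
    then show False
      using B1(3) F(2,4) unfolding vform_space.dependent_def B_def by blast
  qed
  have span: "\<exists>F t. finite F \<and> F \<subseteq> B \<and> \<theta> - (\<Sum>\<beta>\<in>F. vscale (t \<beta>) \<beta>) \<in> ?W"
    if \<theta>: "\<theta> \<in> vforms A 1" "delbar_vform \<theta> = 0" for \<theta>
  proof -
    obtain \<theta>' where \<theta>': "\<theta>' \<in> vforms A 1" "delbar_vform \<theta>' = 0" "del_form (contract \<theta>' u) = 0" "\<theta> - \<theta>' \<in> ?W"
      using closed_decomposition[OF page1 Z \<theta>] .
    then have "\<theta>' \<in> vform_space.span B1" using B1(4) by (auto simp: U_def)
    moreover have "B1 = B0 \<union> B" using B1(1) by (auto simp: B_def)
    ultimately obtain x y where xy: "x \<in> vform_space.span B0" "y \<in> vform_space.span B" "\<theta>' = x + y"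
      by (auto simp: vform_space.span_Un)
    obtain F t where F: "finite F" "F \<subseteq> B" "y = (\<Sum>\<beta>\<in>F. vscale (t \<beta>) \<beta>)"
      using xy(2) unfolding vform_space.span_explicit by blast
    have "\<theta> - y = (\<theta> - \<theta>') + x" by (simp add: xy(3))
    also have "\<dots> \<in> ?W"
      using vform_space.subspace_add[OF W \<theta>'(4)] xy(1) W_span by blast
    finally show ?thesis using F by blast
  qed
  have "H01T_basis_reps A B"
    unfolding H01T_basis_reps_def using B_U indep span by (auto simp: U_def)
  moreover have "integrability_solvable A (\<Sum>\<beta>\<in>F. vscale (t \<beta>) \<beta>)" if "finite F" "F \<subseteq> B" for F t
  proof -
    let ?\<theta> = "\<Sum>\<beta>\<in>F. vscale (t \<beta>) \<beta>"
    have "?\<theta> \<in> vforms A 1 \<and> delbar_vform ?\<theta> = 0 \<and> del_form (contract ?\<theta> u) = 0"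
      using that
    proof (induction F rule: finite_induct)
      case empty
      have "contract (0 :: ('a, 'n) vform) u = 0"
        by (simp add: contract_def fun_eq_iff)
      then show ?case
        by (simp only: sum.empty vforms_zero delbar_vform_zero del_form_zero simp_thms)
    next
      case (insert b F)
      let ?r = "\<Sum>\<beta>\<in>F. vscale (t \<beta>) \<beta>"
      have r: "?r \<in> vforms A 1" "delbar_vform ?r = 0" "del_form (contract ?r u) = 0"
        using insert.IH insert.prems by blast+
      have b: "b \<in> vforms A 1" "delbar_vform b = 0" "del_form (contract b u) = 0"
        using insert.prems B_U by (auto simp: U_def)
      note tb = vforms_scale[OF b(1), of "t b"]
      have "contract (vscale (t b) b + ?r) u = fscale (t b) (contract b u) + contract ?r u"
        by (simp add: contract_def fscale_def vscale_def fun_eq_iff cov_wedge_left_add cov_wedge_left_scale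
            sum.distrib sum_distrib_left)
      then have "del_form (contract (vscale (t b) b + ?r) u) = fscale (t b) (del_form (contract b u)) + del_form (contract ?r u)"
        by (simp only: del_form_add(1)[OF forms_scale[OF contract_forms[OF b(1) u_form]] contract_forms[OF r(1) u_form]]
            del_form_scale(1)[OF contract_forms[OF b(1) u_form]])
      then have "del_form (contract (vscale (t b) b + ?r) u) = 0"
        unfolding b(3) r(3) by (simp add: fscale_def fun_eq_iff)
      moreover have "delbar_vform (vscale (t b) b + ?r) = 0"
        unfolding delbar_vform_add[OF tb r(1)] delbar_vform_scale[OF b(1)] b(2) r(2) by simp
      ultimately show ?case
        using vforms_add[OF tb r(1)] by (simp only: sum.insert[OF insert.hyps] simp_thms)
    qed
    then show ?thesis
      using delbar_contract_zero by (intro integrability_solvableI[OF ext] admissibleI_closed) blast+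
  qed
  ultimately show ?thesis unfolding kuranishi_unobstructed_def by blast
qed

end

theorem theorem1p2:
  fixes X :: "'a topology"
    and A :: "('a, 'n::finite) chart set"
    and u :: "('a, 'n) form"
    and n :: nat
  assumes manifold: "compact_complex_manifold X A"
    and dim: "n = CARD('n)"
    and CY: "calabi_yau A"
    and page1: "page1_ddbar A"
    and u: "nonvanishing_holomorphic_top_form A u"
    and contraction: "\<And>\<psi> \<rho>. \<psi> \<in> vforms A 1 \<Longrightarrow> \<rho> \<in> vforms A 1 \<Longrightarrow>
      contract \<psi> u \<in> {\<alpha>. d_form \<alpha> = 0} \<union> del_form ` forms A (int n - 2) 1 \<Longrightarrow>
      contract \<rho> u \<in> {\<alpha>. d_form \<alpha> = 0} \<union> del_form ` forms A (int n - 2) 1 \<Longrightarrow>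
      contract \<psi> (contract \<rho> u) \<in> Z2 A (int n - 2) 2"
  shows "essential_kuranishi_unobstructed A u \<and>
    (Z1 A (int n - 1) 1 = Z2 A (int n - 1) 1 \<longrightarrow> kuranishi_unobstructed A)"
proof -
  interpret calabi_yau_manifold X A u
    using manifold u by (simp add: calabi_yau_manifold_def calabi_yau_manifold_axioms_def)
  have ext: contractions_ddbar_exact
    unfolding contractions_ddbar_exact_def
  proof (intro allI impI)
    fix \<psi> \<rho> assume "admissible \<psi>" "admissible \<rho>"
    then have "contract \<psi> (contract \<rho> u) \<in> Z2 A (int CARD('n) - 2) 2"
      using contraction unfolding admissible_def dim by blast
    from Z2_del_ddbar_exact[OF page1 this]
    show "\<exists>\<xi>\<in>forms A (int CARD('n) - 2) 1. del_form (contract \<psi> (contract \<rho> u)) = delbar_form (del_form \<xi>)"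
      by simp
  qed
  show ?thesis
    using essential_unobstructed[OF page1 ext] unobstructed[OF page1 _ ext] unfolding dim by blast
qed

end
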